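(* Let $M$ be a maximal planar graph on $n$ vertices. Then the packing of $n$ disks in the plane with contact graph $M$ is unique up to a generalized Möbius transformation; that is, for any two packings with contact graph $M$, there is a generalized Möbius transformation mapping the $i$-th disk of the first to the $i$-th disk of the second for every vertex $i$ of $M$.
   Context: Graphs are finite and simple. A packing is an indexed family of $n$ disks in $\mathbb R^2$ with positive radii and mutually disjoint interiors. Its contact graph is the graph on the index set with an edge $ij$ exactly when disks $i$ and $j$ are tangent. A maximal planar graph is a planar graph such that adding any extra edge on the same vertex set gives a non-planar graph. The generalized Möbius transformations of the extended plane $\mathbb R^2\cup\{\infty\}\cong\mathbb C\cup\{\infty\}$ are those generated by the Möbius transformations $z\mapsto (az+b)/(cz+d)$, $ad-bc\ne0$, and the reflections through lines. *)

theory Defs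
  imports "HOL-Analysis.Analysis"
begin

text \<open>A graph is given by its vertex set and its set of edges, an edge being the two-element set
  of its endpoints. The plane is the type of complex numbers.\<close>

definition simple_graph :: "'v set \<Rightarrow> 'v set set \<Rightarrow> bool" where
  "simple_graph V E \<longleftrightarrow> finite V \<and> (\<forall>e\<in>E. e \<subseteq> V \<and> card e = 2)"

text \<open>Drawings use arbitrary continuous simple arcs. Arcs of different edges meet only in the
  images of common endpoints, and an arc passes through no vertex other than its endpoints.\<close>

definition planar_drawing ::
  "'v set \<Rightarrow> 'v set set \<Rightarrow> ('v \<Rightarrow> complex) \<Rightarrow> ('v set \<Rightarrow> real \<Rightarrow> complex) \<Rightarrow> bool" where
  "planar_drawing V E p \<gamma> \<longleftrightarrow>
     inj_on p V \<and>
     (\<forall>e\<in>E. arc (\<gamma> e) \<and> {pathstart (\<gamma> e), pathfinish (\<gamma> e)} = p ` e \<and>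
        path_image (\<gamma> e) \<inter> p ` V = p ` e) \<and>
     (\<forall>e\<in>E. \<forall>e'\<in>E. e \<noteq> e' \<longrightarrow> path_image (\<gamma> e) \<inter> path_image (\<gamma> e') = p ` (e \<inter> e'))"

definition planar_graph :: "'v set \<Rightarrow> 'v set set \<Rightarrow> bool" where
  "planar_graph V E \<longleftrightarrow> simple_graph V E \<and> (\<exists>p \<gamma>. planar_drawing V E p \<gamma>)"

definition maximal_planar_graph :: "'v set \<Rightarrow> 'v set set \<Rightarrow> bool" where
  "maximal_planar_graph V E \<longleftrightarrow>
     planar_graph V E \<and>
     (\<forall>u\<in>V. \<forall>v\<in>V. u \<noteq> v \<and> {u, v} \<notin> E \<longrightarrow> \<not> planar_graph V (insert {u, v} E))"

definition is_disk :: "complex set \<Rightarrow> bool" where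
  "is_disk A \<longleftrightarrow> (\<exists>c r. 0 < r \<and> A = cball c r)"

definition disk_packing :: "'v set \<Rightarrow> ('v \<Rightarrow> complex set) \<Rightarrow> bool" where
  "disk_packing V D \<longleftrightarrow>
     (\<forall>i\<in>V. is_disk (D i)) \<and> disjoint_family_on (\<lambda>i. interior (D i)) V"

definition tangent_disks :: "complex set \<Rightarrow> complex set \<Rightarrow> bool" where
  "tangent_disks A B \<longleftrightarrow> is_disk A \<and> is_disk B \<and> (\<exists>p. A \<inter> B = {p})"

definition contact_graph_edges :: "'v set \<Rightarrow> ('v \<Rightarrow> complex set) \<Rightarrow> 'v set set" where
  "contact_graph_edges V D =
     {{i, j} | i j. i \<in> V \<and> j \<in> V \<and> i \<noteq> j \<and> tangent_disks (D i) (D j)}"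

text \<open>The extended plane is \<^typ>\<open>complex option\<close>, with \<^const>\<open>None\<close> as the point at infinity,
  as in \<^const>\<open>Alexandroff_compactification\<close>.\<close>

definition mobius_map ::
  "complex \<Rightarrow> complex \<Rightarrow> complex \<Rightarrow> complex \<Rightarrow> complex option \<Rightarrow> complex option" where
  "mobius_map a b c d w = (case w of
     None \<Rightarrow> if c = 0 then None else Some (a / c)
   | Some z \<Rightarrow> if c * z + d = 0 then None else Some ((a * z + b) / (c * z + d)))"

text \<open>Reflection through the line \<open>{p + t u | t real}\<close>, where \<open>u \<noteq> 0\<close>: the similarity
  \<open>z \<mapsto> (z - p) / u\<close> takes this line to the real axis, where reflection is conjugation.\<close>

definition line_reflection :: "complex \<Rightarrow> complex \<Rightarrow> complex option \<Rightarrow> complex option" where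
  "line_reflection p u = map_option (\<lambda>z. p + u * cnj ((z - p) / u))"

text \<open>Inverses need no separate clause: the inverse of a Moebius transformation is one, and
  reflections are involutions.\<close>

inductive_set generalized_mobius :: "(complex option \<Rightarrow> complex option) set" where
  mobius: "a * d - b * c \<noteq> 0 \<Longrightarrow> mobius_map a b c d \<in> generalized_mobius"
| reflection: "u \<noteq> 0 \<Longrightarrow> line_reflection p u \<in> generalized_mobius"
| comp: "f \<in> generalized_mobius \<Longrightarrow> g \<in> generalized_mobius \<Longrightarrow> f \<circ> g \<in> generalized_mobius"

end

theory Submission
  imports Defs
begin

text \<open>A disk with center \<open>c\<close> and radius \<open>r\<close> is a vector \<open>(c / r, 1 / r, (\<bar>c\<bar>\<^sup>2 - r\<^sup>2) / r)\<close> of norm 1 in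
  Lorentz space, on which Moebius transformations and reflections act by isometries. Two disks have
  product at most \<open>-1\<close> iff their interiors are disjoint, with equality iff they are tangent. It
  suffices to show that two packings with contact graph \<open>M\<close> have the same Gram matrix.

  Maximality is used twice: a straight-line drawing through the centers could otherwise be extended
  by an edge between two components, or by an edge between two neighbours of \<open>i\<close> that are
  consecutive in the cyclic order around \<open>i\<close>. It follows that every edge lies in two
  triangles \<open>i j k\<close> whose removal leaves \<open>M\<close> connected. In any packing all other disks then lie on the
  same side of such a triangle, the side being the sign of a \<open>4 \<times> 4\<close> determinant.

  Send the point of tangency of two adjacent disks \<open>a\<close>, \<open>b\<close> to infinity, so that they become the
  half-planes bounding a strip. Around a disk in the strip that does not touch both lines these triangles
  have angle sum \<open>2\<pi>\<close>, and the angles are monotone in the ratios of the curvatures, where half-planes have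
  curvature 0. By the maximum principle the curvatures of the two packings agree. The curvature of
  disk \<open>i\<close> in the strip is \<open>G i a + G i b\<close>, where \<open>G\<close> is the negated Gram matrix. So the difference
  \<open>\<delta>\<close> of the two Gram matrices satisfies \<open>\<delta> i a = - \<delta> i b\<close> for every edge \<open>a b\<close>; going around a triangle, \<open>\<delta> = 0\<close>.\<close>

section \<open>Disks as Lorentz vectors\<close>

text \<open>The two packings might arrange the neighbours of a vertex in different cyclic orders, so
  faces are read off the graph alone: \<open>facial\<close> refers to no drawing, and both packings
  have the same facial triangles by definition. Cyclic orders enter the proof that each edge has two
  of them. Lorentz vectors treat disks and half-planes alike, so the angle formulas survive sending
  a point of tangency to infinity. In the strip, the half-planes have curvature 0 and the disks
  touching both lines have curvature 2 in either packing; these are the boundary values for the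
  maximum principle. One choice of the strip controls only a sum of two columns of the Gram matrix,
  which is why every edge takes its turn at infinity. Two triangles at an edge require four
  vertices. With two or three vertices \<open>M\<close> is complete and all products are 1 or -1; a
  single disk is moved by a similarity.\<close>

type_synonym lvec = "complex \<times> real \<times> real"

abbreviation lw :: "lvec \<Rightarrow> complex" where "lw u \<equiv> fst u"
abbreviation lk :: "lvec \<Rightarrow> real" where "lk u \<equiv> fst (snd u)"
abbreviation ll :: "lvec \<Rightarrow> real" where "ll u \<equiv> snd (snd u)"

text \<open>The vector \<open>(w, k, l)\<close> stands for the set of all \<open>z\<close> with \<open>k \<bar>z\<bar>\<^sup>2 - 2 Re (w cnj z) + l \<le> 0\<close>: a disk if
  \<open>k > 0\<close>, a half-plane if \<open>k = 0\<close>, the exterior of a disk if \<open>k < 0\<close>.\<close>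

definition lor :: "lvec \<Rightarrow> lvec \<Rightarrow> real" where
  "lor u v = Re (lw u * cnj (lw v)) - (lk u * ll v + ll u * lk v) / 2"

text \<open>In homogeneous coordinates, with infinity as (1, 0), the Hermitian form of the
  inequality takes the value \<open>lk u\<close> there; so half-planes contain infinity and disks do
  not.\<close>

fun mem :: "lvec \<Rightarrow> complex option \<Rightarrow> bool" where
  "mem u None \<longleftrightarrow> lk u \<le> 0"
| "mem u (Some z) \<longleftrightarrow> lk u * (norm z)\<^sup>2 - 2 * Re (lw u * cnj z) + ll u \<le> 0"

text \<open>The inverse is carried along since \<open>generalized_mobius\<close> is generated by
  composition alone. It makes the relation symmetric and shows in the end that \<open>f\<close> maps
  disks onto disks.\<close>

definition mobius_equiv :: "'v set \<Rightarrow> ('v \<Rightarrow> lvec) \<Rightarrow> ('v \<Rightarrow> lvec) \<Rightarrow> bool" where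
  "mobius_equiv V s s' \<longleftrightarrow> (\<exists>f\<in>generalized_mobius. \<exists>g\<in>generalized_mobius.
     (\<forall>x. g (f x) = x) \<and> (\<forall>x. f (g x) = x) \<and>
     (\<forall>i\<in>V. \<forall>x. mem (s i) x \<longleftrightarrow> mem (s' i) (f x)))"

lemma mobius_equivI:
  assumes "f \<in> generalized_mobius" "g \<in> generalized_mobius"
    and "\<And>x. g (f x) = x" "\<And>x. f (g x) = x"
    and "\<And>i x. i \<in> V \<Longrightarrow> mem (s i) x \<longleftrightarrow> mem (s' i) (f x)"
  shows "mobius_equiv V s s'"
  using assms unfolding mobius_equiv_def by blast

lemma mobius_equiv_sym:
  assumes "mobius_equiv V s s'" shows "mobius_equiv V s' s"
  using assms unfolding mobius_equiv_def by metis

lemma mobius_equiv_trans: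
  assumes "mobius_equiv V s s'" "mobius_equiv V s' s''" shows "mobius_equiv V s s''"
proof -
  obtain f g where fg: "f \<in> generalized_mobius" "g \<in> generalized_mobius"
    "\<And>x. g (f x) = x" "\<And>x. f (g x) = x" "\<And>i x. i \<in> V \<Longrightarrow> mem (s i) x \<longleftrightarrow> mem (s' i) (f x)"
    using assms(1) unfolding mobius_equiv_def by blast
  obtain f' g' where fg': "f' \<in> generalized_mobius" "g' \<in> generalized_mobius"
    "\<And>x. g' (f' x) = x" "\<And>x. f' (g' x) = x" "\<And>i x. i \<in> V \<Longrightarrow> mem (s' i) x \<longleftrightarrow> mem (s'' i) (f' x)"
    using assms(2) unfolding mobius_equiv_def by blast
  show ?thesis unfolding mobius_equiv_def
    by (rule bexI[of _ "f' \<circ> f"], rule bexI[of _ "g \<circ> g'"])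
      (auto simp: fg(3-5) fg'(3-5) intro: generalized_mobius.comp fg fg')
qed

section \<open>Generators of the transformation group acting on Lorentz vectors\<close>

lemmas cmod_mult_self = cmod_power2 [unfolded power2_eq_square]

lemma Re_of_real_mult: "Re (of_real r * z) = r * Re z"
  by simp

lemma nonpos_iff_of_mult_eq: "x * n = y \<Longrightarrow> 0 < n \<Longrightarrow> y \<le> 0 \<longleftrightarrow> x \<le> (0::real)"
  by (auto simp: mult_le_0_iff)

text \<open>The actions induced by z + b, 1/z, a z and - cnj z: the inverse map is substituted into
  the inequality of \<open>mem\<close>. In \<open>lscale\<close> the result is multiplied by
  \<open>norm a\<close>, so that \<open>lor\<close> is preserved.\<close>

definition ltrans :: "complex \<Rightarrow> lvec \<Rightarrow> lvec" where
  "ltrans b u = (lw u + lk u *\<^sub>R b, lk u, ll u + 2 * Re (lw u * cnj b) + lk u * (norm b)\<^sup>2)"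

definition linv :: "lvec \<Rightarrow> lvec" where
  "linv u = (cnj (lw u), ll u, lk u)"

definition lscale :: "complex \<Rightarrow> lvec \<Rightarrow> lvec" where
  "lscale a u = (lw u * sgn a, lk u / norm a, ll u * norm a)"

definition lrefl :: "lvec \<Rightarrow> lvec" where
  "lrefl u = (- cnj (lw u), lk u, ll u)"

lemma lor_ltrans [simp]: "lor (ltrans b u) (ltrans b v) = lor u v"
  by (simp add: lor_def ltrans_def power2_eq_square cmod_mult_self field_simps)

lemma lor_linv [simp]: "lor (linv u) (linv v) = lor u v"
  by (simp add: lor_def linv_def)

lemma lor_lscale [simp]: "a \<noteq> 0 \<Longrightarrow> lor (lscale a u) (lscale a v) = lor u v"
proof -
  assume a: "a \<noteq> 0"
  have "lw u * sgn a * cnj (lw v * sgn a) = lw u * cnj (lw v) * (sgn a * cnj (sgn a))"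
    by (simp only: complex_cnj_mult mult_ac)
  also have "sgn a * cnj (sgn a) = 1"
    using a complex_norm_square[of "sgn a"] by (simp add: norm_sgn)
  finally have "lw u * sgn a * cnj (lw v * sgn a) = lw u * cnj (lw v)" by (simp only: mult_1_right)
  then show ?thesis using a by (simp only: lor_def lscale_def fst_conv snd_conv) simp
qed

lemma lor_lrefl [simp]: "lor (lrefl u) (lrefl v) = lor u v"
  by (simp add: lor_def lrefl_def)

lemma mobius_equiv_ltrans: "mobius_equiv V s (\<lambda>i. ltrans b (s i))"
proof (rule mobius_equivI[of "mobius_map 1 b 0 1" "mobius_map 1 (-b) 0 1"])
  show "mobius_map 1 b 0 1 \<in> generalized_mobius" "mobius_map 1 (-b) 0 1 \<in> generalized_mobius"
    by (rule generalized_mobius.mobius; simp)+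
  fix x i
  show "mobius_map 1 (-b) 0 1 (mobius_map 1 b 0 1 x) = x"
    "mobius_map 1 b 0 1 (mobius_map 1 (-b) 0 1 x) = x"
    by (cases x; simp add: mobius_map_def)+
  show "mem (s i) x \<longleftrightarrow> mem (ltrans b (s i)) (mobius_map 1 b 0 1 x)"
    by (cases x) (simp_all add: mobius_map_def ltrans_def power2_eq_square cmod_mult_self algebra_simps)
qed

lemma mobius_equiv_linv: "mobius_equiv V s (\<lambda>i. linv (s i))"
proof (rule mobius_equivI[of "mobius_map 0 1 1 0" "mobius_map 0 1 1 0"])
  show "mobius_map 0 1 1 0 \<in> generalized_mobius" "mobius_map 0 1 1 0 \<in> generalized_mobius"
    by (rule generalized_mobius.mobius; simp)+
  fix x i
  show "mobius_map 0 1 1 0 (mobius_map 0 1 1 0 x) = x" "mobius_map 0 1 1 0 (mobius_map 0 1 1 0 x) = x"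
    by (cases x; simp add: mobius_map_def)+
  show "mem (s i) x \<longleftrightarrow> mem (linv (s i)) (mobius_map 0 1 1 0 x)"
  proof (cases x)
    case (Some z)
    show ?thesis
    proof (cases "z = 0")
      case False
      have n: "norm z > 0" using False by simp
      have "Re (cnj (lw (s i)) * cnj (1 / z)) * (norm z)\<^sup>2 = Re (cnj (lw (s i)) * (cnj (1/z) * (norm z)\<^sup>2))"
        by (metis Re_of_real_mult mult.assoc mult.commute)
      also have "cnj (1/z) * (norm z)\<^sup>2 = z"
        using False by (simp add: complex_norm_square flip: of_real_power)
      also have "Re (cnj (lw (s i)) * z) = Re (lw (s i) * cnj z)" by simp
      finally have e: "Re (cnj (lw (s i)) * cnj (1 / z)) * (norm z)\<^sup>2 = Re (lw (s i) * cnj z)" .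
      have "(ll (s i) * (norm (1/z))\<^sup>2 - 2 * Re (cnj (lw (s i)) * cnj (1/z)) + lk (s i)) * (norm z)\<^sup>2
         = ll (s i) - 2 * (Re (cnj (lw (s i)) * cnj (1/z)) * (norm z)\<^sup>2) + lk (s i) * (norm z)\<^sup>2"
        using n by (simp add: norm_divide power_divide algebra_simps)
      then have "(ll (s i) * (norm (1/z))\<^sup>2 - 2 * Re (cnj (lw (s i)) * cnj (1/z)) + lk (s i)) * (norm z)\<^sup>2
         = lk (s i) * (norm z)\<^sup>2 - 2 * Re (lw (s i) * cnj z) + ll (s i)"
        unfolding e by simp
      then have "lk (s i) * (norm z)\<^sup>2 - 2 * Re (lw (s i) * cnj z) + ll (s i) \<le> 0 \<longleftrightarrow>
         ll (s i) * (norm (1/z))\<^sup>2 - 2 * Re (cnj (lw (s i)) * cnj (1/z)) + lk (s i) \<le> 0"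
        by (rule nonpos_iff_of_mult_eq) (use n in simp)
      then show ?thesis using Some False by (simp add: mobius_map_def linv_def)
    qed (simp add: Some mobius_map_def linv_def)
  qed (simp add: mobius_map_def linv_def)
qed

lemma mobius_equiv_lscale:
  assumes a: "a \<noteq> 0" shows "mobius_equiv V s (\<lambda>i. lscale a (s i))"
proof (rule mobius_equivI[of "mobius_map a 0 0 1" "mobius_map (1/a) 0 0 1"])
  show "mobius_map a 0 0 1 \<in> generalized_mobius" "mobius_map (1/a) 0 0 1 \<in> generalized_mobius"
    by (rule generalized_mobius.mobius; simp add: a)+
  fix x i
  show "mobius_map (1/a) 0 0 1 (mobius_map a 0 0 1 x) = x" "mobius_map a 0 0 1 (mobius_map (1/a) 0 0 1 x) = x"
    by (cases x; simp add: mobius_map_def a)+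
  show "mem (s i) x \<longleftrightarrow> mem (lscale a (s i)) (mobius_map a 0 0 1 x)"
  proof (cases x)
    case (Some z)
    have n: "norm a > 0" using a by simp
    have "sgn a * cnj a = of_real (norm a)"
      using a by (simp add: sgn_eq complex_norm_square[symmetric] power2_eq_square)
    then have "lw (s i) * sgn a * cnj (a * z) = norm a * (lw (s i) * cnj z)"
      by (simp only: complex_cnj_mult) (metis (no_types, lifting) mult.assoc mult.commute)
    then have "Re (lw (s i) * sgn a * cnj (a * z)) = norm a * Re (lw (s i) * cnj z)"
      by (simp only: Re_of_real_mult)
    then have "lk (s i) / norm a * (norm (a*z))\<^sup>2 - 2 * Re (lw (s i) * sgn a * cnj (a*z)) + ll (s i) * norm a
      = norm a * (lk (s i) * (norm z)\<^sup>2 - 2 * Re (lw (s i) * cnj z) + ll (s i))"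
      using n by (simp add: norm_mult power_mult_distrib power2_eq_square algebra_simps del: Re_complex_of_real complex_cnj_mult)
    then show ?thesis using n Some by (simp add: mobius_map_def lscale_def mult_le_0_iff del: complex_cnj_mult)
  qed (use a in \<open>simp add: mobius_map_def lscale_def divide_le_0_iff\<close>)
qed

lemma mobius_equiv_lrefl: "mobius_equiv V s (\<lambda>i. lrefl (s i))"
proof (rule mobius_equivI[of "line_reflection 0 \<i>" "line_reflection 0 \<i>"])
  show "line_reflection 0 \<i> \<in> generalized_mobius" "line_reflection 0 \<i> \<in> generalized_mobius"
    by (rule generalized_mobius.reflection; simp)+
  fix x i
  show "line_reflection 0 \<i> (line_reflection 0 \<i> x) = x" "line_reflection 0 \<i> (line_reflection 0 \<i> x) = x"
    by (cases x; simp add: line_reflection_def)+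
  show "mem (s i) x \<longleftrightarrow> mem (lrefl (s i)) (line_reflection 0 \<i> x)"
    by (cases x) (simp_all add: line_reflection_def lrefl_def)
qed

section \<open>Determinants of four Lorentz vectors\<close>

lemma det_4:
  "det (A::'a::comm_ring_1^4^4) =
    A$1$1 * (A$2$2 * (A$3$3 * A$4$4 - A$3$4 * A$4$3) - A$2$3 * (A$3$2 * A$4$4 - A$3$4 * A$4$2)
      + A$2$4 * (A$3$2 * A$4$3 - A$3$3 * A$4$2))
  - A$1$2 * (A$2$1 * (A$3$3 * A$4$4 - A$3$4 * A$4$3) - A$2$3 * (A$3$1 * A$4$4 - A$3$4 * A$4$1)
      + A$2$4 * (A$3$1 * A$4$3 - A$3$3 * A$4$1))
  + A$1$3 * (A$2$1 * (A$3$2 * A$4$4 - A$3$4 * A$4$2) - A$2$2 * (A$3$1 * A$4$4 - A$3$4 * A$4$1)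
      + A$2$4 * (A$3$1 * A$4$2 - A$3$2 * A$4$1))
  - A$1$4 * (A$2$1 * (A$3$2 * A$4$3 - A$3$3 * A$4$2) - A$2$2 * (A$3$1 * A$4$3 - A$3$3 * A$4$1)
      + A$2$3 * (A$3$1 * A$4$2 - A$3$2 * A$4$1))"
proof -
  have f1: "finite {2::4, 3, 4}" "1 \<notin> {2::4, 3, 4}" by auto
  have f2: "finite {3::4, 4}" "2 \<notin> {3::4, 4}" by auto
  have f3: "finite {4::4}" "3 \<notin> {4::4}" by auto
  show ?thesis
    unfolding det_def UNIV_4
    unfolding sum_over_permutations_insert[OF f1]
    unfolding sum_over_permutations_insert[OF f2]
    unfolding sum_over_permutations_insert[OF f3]
    unfolding permutes_sing
    by (simp add: sign_swap_id permutation_swap_id sign_compose sign_id swap_id_eq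
        permutation_compose algebra_simps)
qed

definition lrow :: "lvec \<Rightarrow> real^4" where
  "lrow u = vector [Re (lw u), Im (lw u), lk u, ll u]"

lemma lrow_nth [simp]:
  "lrow u $ 1 = Re (lw u)" "lrow u $ 2 = Im (lw u)" "lrow u $ 3 = lk u" "lrow u $ 4 = ll u"
  by (simp_all add: lrow_def vector_def)

definition ldet :: "lvec \<Rightarrow> lvec \<Rightarrow> lvec \<Rightarrow> lvec \<Rightarrow> real" where
  "ldet a b c d = det (vector [lrow a, lrow b, lrow c, lrow d] :: real^4^4)"

lemma vector_4_nth [simp]:
  "(vector [a, b, c, d] :: 'a::zero^4) $ 1 = a" "(vector [a, b, c, d] :: 'a::zero^4) $ 2 = b"
  "(vector [a, b, c, d] :: 'a::zero^4) $ 3 = c" "(vector [a, b, c, d] :: 'a::zero^4) $ 4 = d"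
  by (simp_all add: vector_def)

text \<open>With \<open>J\<close> the matrix of \<open>lor\<close>, the product
  \<open>M ** J ** transpose N\<close> is a mixed Gram matrix, and \<open>det J = -1/4\<close>
  explains the constants. Whether two disks lie on the same side of a triangle can thus be decided
  from the products \<open>lor\<close> alone.\<close>

lemma ldet_mult:
  assumes "lor a a = 1" "lor b b = 1" "lor c c = 1" "lor a b = -1" "lor a c = -1" "lor b c = -1"
  shows "ldet a b c d * ldet a b c e = 16 * lor d e +
    8 * (lor a d * (lor b e + lor c e) + lor b d * (lor a e + lor c e) + lor c d * (lor a e + lor b e))"
proof -
  define J :: "real^4^4" where
    "J = vector [vector [1,0,0,0], vector [0,1,0,0], vector [0,0,0,-1/2], vector [0,0,-1/2,0]]"
  define M :: "real^4^4" where "M = vector [lrow a, lrow b, lrow c, lrow d]"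
  define N :: "real^4^4" where "N = vector [lrow a, lrow b, lrow c, lrow e]"
  have com: "lor x y = lor y x" for x y by (simp add: lor_def)
  have *: "M ** J ** transpose N = vector [vector [lor a a, lor a b, lor a c, lor a e],
     vector [lor b a, lor b b, lor b c, lor b e], vector [lor c a, lor c b, lor c c, lor c e],
     vector [lor d a, lor d b, lor d c, lor d e]]"
    by (simp add: vec_eq_iff forall_4 matrix_matrix_mult_def transpose_def sum_4 J_def M_def N_def lor_def add_divide_distrib)
  have "det (M ** J ** transpose N) = det M * det J * det N"
    by (simp add: det_mul det_transpose)
  moreover have "det J = -1/4"
    by (simp add: det_4 J_def)
  moreover have "det (M ** J ** transpose N) = -4 * lor d e
      - 2 * (lor a d * (lor b e + lor c e) + lor b d * (lor a e + lor c e) + lor c d * (lor a e + lor b e))"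
    unfolding * det_4 using assms by (simp add: com[of b a] com[of c a] com[of c b] com[of d a] com[of d b] com[of d c] algebra_simps)
  ultimately show ?thesis
    by (simp add: ldet_def M_def N_def)
qed

lemma ldet_swap23: "ldet a c b d = - ldet a b c d"
  and ldet_swap12: "ldet b a c d = - ldet a b c d"
  and ldet_swap34: "ldet a b d c = - ldet a b c d"
  by (simp_all add: ldet_def det_4 algebra_simps)

section \<open>Triangles of tangent disks\<close>

definition connected_on :: "'v set set \<Rightarrow> 'v set \<Rightarrow> bool" where
  "connected_on E U \<longleftrightarrow> (\<forall>x\<in>U. \<forall>y\<in>U. (x, y) \<in> {(x, y). x \<in> U \<and> y \<in> U \<and> {x, y} \<in> E}\<^sup>*)"

definition facial :: "'v set \<Rightarrow> 'v set set \<Rightarrow> 'v \<Rightarrow> 'v \<Rightarrow> 'v \<Rightarrow> bool" where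
  "facial V E i j k \<longleftrightarrow>
     {i, j} \<in> E \<and> {i, k} \<in> E \<and> {j, k} \<in> E \<and> connected_on E (V - {i, j, k})"

lemma connected_on_invariant:
  assumes "connected_on E U" "x \<in> U" "y \<in> U" "P x"
    and step: "\<And>x y. x \<in> U \<Longrightarrow> y \<in> U \<Longrightarrow> {x, y} \<in> E \<Longrightarrow> P x \<Longrightarrow> P y"
  shows "P y"
proof -
  have "(x, y) \<in> {(x, y). x \<in> U \<and> y \<in> U \<and> {x, y} \<in> E}\<^sup>*"
    using assms unfolding connected_on_def by blast
  then show ?thesis
    by (induction rule: rtrancl_induct) (use assms in auto)
qed

lemma simple_graph_edgeD:
  assumes "simple_graph V E" "{i, j} \<in> E"
  shows "i \<in> V" "j \<in> V" "i \<noteq> j"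
  using assms unfolding simple_graph_def by (auto simp: card_insert_if)

lemma facial_swap: "facial V E i j k \<Longrightarrow> facial V E i k j"
  unfolding facial_def by (simp add: insert_commute)

locale lorentz_packing =
  fixes V :: "'v set" and E :: "'v set set" and s :: "'v \<Rightarrow> lvec"
  assumes simple: "simple_graph V E"
    and lor_self: "i \<in> V \<Longrightarrow> lor (s i) (s i) = 1"
    and lor_le: "i \<in> V \<Longrightarrow> j \<in> V \<Longrightarrow> i \<noteq> j \<Longrightarrow> lor (s i) (s j) \<le> -1"
    and edge_iff: "i \<in> V \<Longrightarrow> j \<in> V \<Longrightarrow> i \<noteq> j \<Longrightarrow> {i, j} \<in> E \<longleftrightarrow> lor (s i) (s j) = -1"
begin

lemma finite_V: "finite V"
  using simple by (simp add: simple_graph_def)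

lemmas edgeD = simple_graph_edgeD [OF simple]

lemma lor_edge: "{i, j} \<in> E \<Longrightarrow> lor (s i) (s j) = -1"
  using edgeD edge_iff by blast

text \<open>Tangent disks are not separated by a triangle: in \<open>ldet_mult\<close> the first
  term is at least -16, while each of the three summands in the bracket is at least 2, which gives
  at least 8 * 6.\<close>

lemma ldet_mult_pos:
  assumes "{i, j} \<in> E" "{i, k} \<in> E" "{j, k} \<in> E"
    and m: "m \<in> V - {i, j, k}" "m' \<in> V - {i, j, k}" and "m = m' \<or> {m, m'} \<in> E"
  shows "ldet (s i) (s j) (s k) (s m) * ldet (s i) (s j) (s k) (s m') > 0"
proof -
  have le: "lor (s p) (s q) \<le> -1" if "p \<in> {i, j, k}" "q \<in> {m, m'}" for p q
    using that assms edgeD lor_le by blast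
  have prod: "x * (y + z) \<ge> 2" if "x \<le> -1" "y \<le> -1" "z \<le> (-1::real)" for x y z
  proof -
    have "1 * 2 \<le> (-x) * (-(y + z))"
      by (rule mult_mono) (use that in auto)
    then show ?thesis by (simp add: algebra_simps)
  qed
  have "lor (s m) (s m') \<ge> -1"
    using assms(6) lor_self m lor_edge by fastforce
  moreover have "lor (s i) (s m) * (lor (s j) (s m') + lor (s k) (s m')) \<ge> 2"
    "lor (s j) (s m) * (lor (s i) (s m') + lor (s k) (s m')) \<ge> 2"
    "lor (s k) (s m) * (lor (s i) (s m') + lor (s j) (s m')) \<ge> 2"
    by (rule prod; rule le; simp)+
  ultimately show ?thesis
    using assms(1-3) edgeD
    by (subst ldet_mult) (auto simp: lor_self lor_edge)
qed

lemma facial_same_side: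
  assumes f: "facial V E i j k" and m: "m \<in> V - {i, j, k}" "m' \<in> V - {i, j, k}"
  shows "ldet (s i) (s j) (s k) (s m) * ldet (s i) (s j) (s k) (s m') > 0"
proof -
  have E: "{i, j} \<in> E" "{i, k} \<in> E" "{j, k} \<in> E"
    using f by (auto simp: facial_def)
  show ?thesis
  proof (rule connected_on_invariant[of E "V - {i, j, k}" m m'])
    show "connected_on E (V - {i, j, k})" using f by (simp add: facial_def)
    show "0 < ldet (s i) (s j) (s k) (s m) * ldet (s i) (s j) (s k) (s m)"
      by (rule ldet_mult_pos[OF E m(1) m(1)]) simp
    fix x y
    assume xy: "x \<in> V - {i, j, k}" "y \<in> V - {i, j, k}" "{x, y} \<in> E"
      "0 < ldet (s i) (s j) (s k) (s m) * ldet (s i) (s j) (s k) (s x)"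
    have "ldet (s i) (s j) (s k) (s x) * ldet (s i) (s j) (s k) (s y) > 0"
      by (rule ldet_mult_pos[OF E]) (use xy in auto)
    with xy(4) show "0 < ldet (s i) (s j) (s k) (s m) * ldet (s i) (s j) (s k) (s y)"
      by (auto simp: zero_less_mult_iff)
  qed (use m in auto)
qed

end

section \<open>Directions of tangency and their orientation\<close>

definition orient :: "complex \<Rightarrow> complex \<Rightarrow> complex \<Rightarrow> real" where
  "orient a b c = Im (cnj (b - a) * (c - a))"

text \<open>The unit vector pointing from the center of the disk \<open>u\<close> to its point of tangency with \<open>v\<close>.\<close>

definition tdir :: "lvec \<Rightarrow> lvec \<Rightarrow> complex" where
  "tdir u v = (lk u / (lk v + lk u)) *\<^sub>R (lw v + lw u) - lw u"

text \<open>The sum \<open>u + v\<close> has norm \<open>1 + 1 - 2 = 0\<close>; it is the null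
  vector of the point of tangency. Hence \<open>v\<close> is recovered from \<open>u\<close>, the
  direction and \<open>lk v\<close>, also when \<open>v\<close> is a half-plane and has no
  center.\<close>

lemma tangent_lvec:
  assumes u: "lor u u = 1" "lk u > 0" and v: "lor v v = 1" "lk v \<ge> 0" and uv: "lor u v = -1"
  shows "lw v = ((lk v + lk u) / lk u) *\<^sub>R (tdir u v + lw u) - lw u"
    and "ll v = (lk v + lk u) / (lk u)\<^sup>2 * (norm (tdir u v + lw u))\<^sup>2 - ll u"
    and "norm (tdir u v) = 1"
proof -
  define \<mu> where "\<mu> = lk v + lk u"
  have \<mu>: "\<mu> > 0" using assms by (simp add: \<mu>_def)
  have t: "tdir u v = (lk u / \<mu>) *\<^sub>R (lw v + lw u) - lw u" by (simp add: tdir_def \<mu>_def)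
  show "lw v = ((lk v + lk u) / lk u) *\<^sub>R (tdir u v + lw u) - lw u"
    using \<mu> u by (simp add: t flip: \<mu>_def)
  have null: "(norm (lw v + lw u))\<^sup>2 = \<mu> * (ll v + ll u)"
    using u v uv unfolding lor_def \<mu>_def cmod_power2
    by (simp add: power2_eq_square algebra_simps)
  have "(norm (tdir u v + lw u))\<^sup>2 = (lk u / \<mu>)\<^sup>2 * (norm (lw v + lw u))\<^sup>2"
    using \<mu> u(2) by (simp add: t power_mult_distrib power_divide)
  also have "\<dots> = (lk u)\<^sup>2 * (ll v + ll u) / \<mu>"
    unfolding null using \<mu> by (simp add: power2_eq_square)
  finally have n2: "(norm (tdir u v + lw u))\<^sup>2 = (lk u)\<^sup>2 * (ll v + ll u) / \<mu>" .
  then show "ll v = (lk v + lk u) / (lk u)\<^sup>2 * (norm (tdir u v + lw u))\<^sup>2 - ll u"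
    using \<mu> u(2) by (simp flip: \<mu>_def)
  have c: "(norm (x - y))\<^sup>2 = (norm x)\<^sup>2 - 2 * (x \<bullet> y) + (norm y)\<^sup>2" for x y :: complex
    by (simp add: power2_norm_eq_inner inner_diff inner_commute)
  have wu: "(norm (lw u))\<^sup>2 = 1 + lk u * ll u"
    using u(1) unfolding lor_def cmod_power2 by (simp add: power2_eq_square)
  have wv: "lw v \<bullet> lw u = -1 + (lk u * ll v + ll u * lk v) / 2"
    using uv unfolding lor_def by (simp add: inner_complex_def algebra_simps)
  have "(norm (tdir u v))\<^sup>2 = (lk u)\<^sup>2 * (ll v + ll u) / \<mu> - 2 * (lk u / \<mu>) * ((lw v + lw u) \<bullet> lw u) + (norm (lw u))\<^sup>2"
    using n2 by (subst t, subst c) (simp add: t)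
  also have "\<dots> = 1"
    using \<mu> by (simp add: inner_add_left wv wu flip: power2_norm_eq_inner)
      (simp add: \<mu>_def field_simps power2_eq_square)
  finally show "norm (tdir u v) = 1"
    by (simp add: power2_eq_1_iff) (use norm_ge_zero[of "tdir u v"] in linarith)
qed

text \<open>The law of cosines in the triangle of centers, in a form valid for half-planes
  \<open>v\<close>, \<open>x\<close>. For tangent \<open>v\<close>, \<open>x\<close> the right side
  is 4 times the product of \<open>lk u / (lk v + lk u)\<close> and
  \<open>lk u / (lk x + lk u)\<close>.\<close>

lemma norm_tdir_diff:
  assumes u: "lor u u = 1" "lk u > 0" and v: "lor v v = 1" "lk v \<ge> 0" "lor u v = -1"
    and x: "lor x x = 1" "lk x \<ge> 0" "lor u x = -1"
  shows "(norm (tdir u v - tdir u x))\<^sup>2 = 2 * (lk u)\<^sup>2 * (1 - lor v x) / ((lk v + lk u) * (lk x + lk u))"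
proof -
  define \<mu> where "\<mu> = lk v + lk u"
  define \<nu> where "\<nu> = lk x + lk u"
  have p: "\<mu> > 0" "\<nu> > 0" using assms by (simp_all add: \<mu>_def \<nu>_def)
  define P where "P = lw v + lw u" define Q where "Q = lw x + lw u"
  have PP: "P \<bullet> P = \<mu> * (ll v + ll u)"
    using u v unfolding lor_def \<mu>_def P_def inner_complex_def by (simp add: algebra_simps)
  have QQ: "Q \<bullet> Q = \<nu> * (ll x + ll u)"
    using u x unfolding lor_def \<nu>_def Q_def inner_complex_def by (simp add: algebra_simps)
  have PQ: "P \<bullet> Q = lor v x - 1 + (\<mu> * (ll x + ll u) + \<nu> * (ll v + ll u)) / 2"
    using u x v unfolding lor_def \<nu>_def \<mu>_def Q_def P_def inner_complex_def
    by (simp add: algebra_simps add_divide_distrib)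
  have "(norm (tdir u v - tdir u x))\<^sup>2 = (norm (lk u *\<^sub>R (P /\<^sub>R \<mu> - Q /\<^sub>R \<nu>)))\<^sup>2"
    by (simp add: tdir_def P_def Q_def \<mu>_def \<nu>_def algebra_simps divide_inverse)
  also have "\<dots> = (lk u)\<^sup>2 * (P \<bullet> P / \<mu>\<^sup>2 - 2 * (P \<bullet> Q) / (\<mu> * \<nu>) + Q \<bullet> Q / \<nu>\<^sup>2)"
    by (simp only: norm_scaleR power_mult_distrib power2_norm_eq_inner power2_abs)
      (simp add: inner_diff inner_commute power2_eq_square field_simps)
  also have "\<dots> = 2 * (lk u)\<^sup>2 * (1 - lor v x) / (\<mu> * \<nu>)"
    using p unfolding PP QQ PQ by (simp add: field_simps power2_eq_square)
  finally show ?thesis by (simp add: \<mu>_def \<nu>_def)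
qed

text \<open>Adding the row of \<open>u\<close> to the others turns them into multiples of the null
  vectors of the points of tangency. So the side of the triangle \<open>u v x\<close> on which
  \<open>y\<close> lies is the orientation of three points on the circle of
  \<open>u\<close>.\<close>

lemma ldet_tangent:
  assumes u: "lor u u = 1" "lk u > 0" and v: "lor v v = 1" "lk v \<ge> 0" "lor u v = -1"
    and x: "lor x x = 1" "lk x \<ge> 0" "lor u x = -1"
    and y: "lor y y = 1" "lk y \<ge> 0" "lor u y = -1"
  shows "ldet u v x y = 2 * (lk v + lk u) * (lk x + lk u) * (lk y + lk u) / (lk u)^3 *
    orient (tdir u v) (tdir u x) (tdir u y)"
proof -
  have main: "ldet u v x y = 2 * \<alpha> * \<beta> * \<gamma> / k^3 * orient e f g"
    if "norm e = 1" "norm f = 1" "norm g = 1" "lk u = k" "k > 0"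
      and "lw v = (\<alpha> / k) *\<^sub>R (e + lw u) - lw u" "ll v = \<alpha> / k\<^sup>2 * (norm (e + lw u))\<^sup>2 - ll u" "lk v = \<alpha> - k"
      and "lw x = (\<beta> / k) *\<^sub>R (f + lw u) - lw u" "ll x = \<beta> / k\<^sup>2 * (norm (f + lw u))\<^sup>2 - ll u" "lk x = \<beta> - k"
      and "lw y = (\<gamma> / k) *\<^sub>R (g + lw u) - lw u" "ll y = \<gamma> / k\<^sup>2 * (norm (g + lw u))\<^sup>2 - ll u" "lk y = \<gamma> - k"
    for e f g \<alpha> \<beta> \<gamma> k
  proof -
    define a b where "a = Re (lw u)" "b = Im (lw u)"
    define n where "n = a * a + b * b"
    have lu: "ll u = (n - 1) / k"
      using u that(4,5) unfolding lor_def n_def a_b_def by (simp add: field_simps)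
    have nn: "(norm (h + lw u))\<^sup>2 = 1 + 2 * (Re h * a + Im h * b) + n" if "norm h = 1" for h
    proof -
      have "Re h * Re h + Im h * Im h = 1"
        using that cmod_power2[of h] by (simp add: power2_eq_square)
      then show ?thesis
        by (simp add: cmod_mult_self power2_eq_square n_def flip: a_b_def) (simp add: algebra_simps)
    qed
    define R where "R = (\<lambda>h. (vector [k * (Re h + a), k * (Im h + b), k\<^sup>2, 1 + 2 * (Re h * a + Im h * b) + n] :: real^4))"
    have r: "lrow v = (\<alpha> / k\<^sup>2) *\<^sub>R R e - lrow u" "lrow x = (\<beta> / k\<^sup>2) *\<^sub>R R f - lrow u"
        "lrow y = (\<gamma> / k\<^sup>2) *\<^sub>R R g - lrow u"
      using that(5) by (simp_all add: vec_eq_iff forall_4 that(4,6-) nn that(1-3) R_def a_b_def)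
        (simp_all add: power2_eq_square)
    have ru: "lrow u = (1/k) *\<^sub>R vector [k * a, k * b, k\<^sup>2, n - 1]"
      using that(5) by (simp add: vec_eq_iff forall_4 that(4) a_b_def lu power2_eq_square)
    have split: "det (vector [p, c1 *\<^sub>R q1 - p, c2 *\<^sub>R q2 - p, c3 *\<^sub>R q3 - p] :: real^4^4) =
      c1 * c2 * c3 * det (vector [p, q1, q2, q3] :: real^4^4)" for p q1 q2 q3 c1 c2 c3
      by (simp add: det_4 algebra_simps)
    have "ldet u v x y = (\<alpha> / k\<^sup>2) * (\<beta> / k\<^sup>2) * (\<gamma> / k\<^sup>2) * det (vector [lrow u, R e, R f, R g])"
      unfolding ldet_def r split ..
    also have "det (vector [lrow u, R e, R f, R g]) = 2 * k^3 * orient e f g"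
      unfolding ru R_def det_4 orient_def using that(5)
      by (simp add: n_def power2_eq_square power3_eq_cube algebra_simps)
    finally show ?thesis
      using that(5) by (simp add: field_simps power2_eq_square power3_eq_cube)
  qed
  show ?thesis
    by (rule main) (use tangent_lvec[OF u v] tangent_lvec[OF u x] tangent_lvec[OF u y] u(2) in simp_all)
qed

text \<open>\<open>(0, 0, c)\<close> is a multiple of the null vector of infinity. For
  \<open>c > 0\<close> its side of the triangle is the sign of the sine of the angle from
  \<open>tdir u v\<close> to \<open>tdir u x\<close>.\<close>

lemma ldet_tangent_infinity:
  assumes u: "lor u u = 1" "lk u > 0" and v: "lor v v = 1" "lk v \<ge> 0" "lor u v = -1"
    and x: "lor x x = 1" "lk x \<ge> 0" "lor u x = -1"
  shows "ldet u v x (0, 0, c) = c * (lk v + lk u) * (lk x + lk u) / lk u *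
    Im (cnj (tdir u v) * tdir u x)"
proof -
  have *: "lrow v $ 1 = (lk v + lk u) / lk u * (Re (tdir u v) + Re (lw u)) - Re (lw u)"
    "lrow v $ 2 = (lk v + lk u) / lk u * (Im (tdir u v) + Im (lw u)) - Im (lw u)"
    "lrow x $ 1 = (lk x + lk u) / lk u * (Re (tdir u x) + Re (lw u)) - Re (lw u)"
    "lrow x $ 2 = (lk x + lk u) / lk u * (Im (tdir u x) + Im (lw u)) - Im (lw u)"
    using arg_cong[OF tangent_lvec(1)[OF u v], of Re] arg_cong[OF tangent_lvec(1)[OF u v], of Im]
      arg_cong[OF tangent_lvec(1)[OF u x], of Re] arg_cong[OF tangent_lvec(1)[OF u x], of Im] by simp_all
  have "ldet u v x (0, 0, c) = c * (lrow u $ 1 * (lrow v $ 2 * lk x - lk v * lrow x $ 2)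
     - lrow u $ 2 * (lrow v $ 1 * lk x - lk v * lrow x $ 1)
     + lk u * (lrow v $ 1 * lrow x $ 2 - lrow v $ 2 * lrow x $ 1))"
    by (simp add: ldet_def det_4 algebra_simps)
  also have "\<dots> = c * (lk v + lk u) * (lk x + lk u) / lk u * Im (cnj (tdir u v) * tdir u x)"
    unfolding * using u(2) by (simp add: field_simps)
  finally show ?thesis .
qed

section \<open>Angles around a point\<close>

text \<open>Twice the signed area of a triangle inscribed in the unit circle is four times the
  product of the sines of its angles, and these are half the central angles.\<close>

lemma orient_cis:
  assumes "norm e = 1"
  shows "orient (e * cis \<alpha>) (e * cis \<beta>) (e * cis \<gamma>) =
    4 * sin ((\<beta> - \<alpha>) / 2) * sin ((\<gamma> - \<beta>) / 2) * sin ((\<gamma> - \<alpha>) / 2)"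
proof -
  have "cnj e * e = 1"
    using complex_norm_square[of e] assms by (simp add: mult.commute)
  moreover have "cnj (e * cis \<beta> - e * cis \<alpha>) * (e * cis \<gamma> - e * cis \<alpha>) =
      (cnj e * e) * (cnj (cis \<beta> - cis \<alpha>) * (cis \<gamma> - cis \<alpha>))"
    by (simp add: algebra_simps)
  ultimately have *: "cnj (e * cis \<beta> - e * cis \<alpha>) * (e * cis \<gamma> - e * cis \<alpha>) =
      cnj (cis \<beta> - cis \<alpha>) * (cis \<gamma> - cis \<alpha>)"
    by (simp only: mult_1)
  have "orient (e * cis \<alpha>) (e * cis \<beta>) (e * cis \<gamma>) =
      sin (\<gamma> - \<beta>) + sin (\<beta> - \<alpha>) - sin (\<gamma> - \<alpha>)"
    unfolding orient_def * by (simp add: sin_diff algebra_simps)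
  moreover define x y where "x = (\<beta> - \<alpha>) / 2" "y = (\<gamma> - \<beta>) / 2"
  then have "\<gamma> - \<beta> = 2 * y" "\<beta> - \<alpha> = 2 * x" "\<gamma> - \<alpha> = 2 * (x + y)" "(\<gamma> - \<alpha>) / 2 = x + y"
    by (simp_all add: field_simps)
  moreover have "sin (2 * y) + sin (2 * x) - sin (2 * (x + y)) = 4 * sin x * sin y * sin (x + y)"
  proof -
    have "cos x * cos x = 1 - sin x * sin x" "cos y * cos y = 1 - sin y * sin y"
      using sin_cos_squared_add[of x] sin_cos_squared_add[of y] by (simp_all add: power2_eq_square)
    then show ?thesis
      unfolding sin_double sin_add cos_add by algebra
  qed
  ultimately show ?thesis
    by (metis x_y_def)
qed

lemma orient_cis_pos:
  assumes "norm e = 1" "\<alpha> < \<beta>" "\<beta> < \<gamma>" "\<gamma> < \<alpha> + 2 * pi"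
  shows "orient (e * cis \<alpha>) (e * cis \<beta>) (e * cis \<gamma>) > 0"
  unfolding orient_cis[OF assms(1)]
  by (intro mult_pos_pos sin_gt_zero) (use assms in auto)

lemma orient_rotate: "orient a b c = orient b c a"
  and orient_swap: "orient b a c = - orient a b c"
  by (simp_all add: orient_def algebra_simps)

lemma circle_enum:
  assumes "finite N" "j \<in> N" "inj_on e N" and unit: "\<And>p. p \<in> N \<Longrightarrow> norm (e p) = 1"
  obtains f :: "nat \<Rightarrow> 'v" and \<psi> :: "nat \<Rightarrow> real" where "bij_betw f {..<card N} N" "f 0 = j" "\<psi> 0 = 0"
    "\<And>l. l < card N \<Longrightarrow> 0 \<le> \<psi> l \<and> \<psi> l < 2 * pi \<and> e (f l) = e j * cis (\<psi> l)"
    "\<And>l m. l < m \<Longrightarrow> m < card N \<Longrightarrow> \<psi> l < \<psi> m"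
proof -
  define \<theta> where "\<theta> p = Arg2pi (e p / e j)" for p
  have nz: "e p \<noteq> 0" if "p \<in> N" for p using unit[OF that] by auto
  have e: "e p = e j * cis (\<theta> p)" if "p \<in> N" for p
    using Arg2pi_eq[of "e p / e j"] unit[OF that] unit[OF assms(2)] nz[OF assms(2)]
    by (simp add: \<theta>_def norm_divide exp_eq_polar field_simps)
  have inj: "inj_on \<theta> N"
    by (rule inj_onI) (metis e assms(3) inj_onD)
  define xs where "xs = sorted_list_of_set (\<theta> ` N)"
  have xs: "set xs = \<theta> ` N" "length xs = card N" "sorted_wrt (<) xs" "distinct xs"
    using assms(1) inj by (auto simp: xs_def card_image)
  define f where "f l = the_inv_into N \<theta> (xs ! l)" for l
  have "bij_betw (\<lambda>l. xs ! l) {..<card N} (\<theta> ` N)"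
    using bij_betw_nth[OF xs(4), of "{..<card N}" "\<theta> ` N"] xs by auto
  moreover have "bij_betw (the_inv_into N \<theta>) (\<theta> ` N) N"
    using inj by (simp add: bij_betw_the_inv_into inj_on_imp_bij_betw)
  ultimately have bij: "bij_betw f {..<card N} N"
    using bij_betw_trans unfolding f_def comp_def by fastforce
  have \<theta>f: "\<theta> (f l) = xs ! l" "f l \<in> N" if "l < card N" for l
    using that xs(1,2) inj unfolding f_def
    by (metis f_the_inv_into_f nth_mem, metis nth_mem order_refl the_inv_into_into)
  have lt: "xs ! l < xs ! m" if "l < m" "m < card N" for l m
    using sorted_wrt_nth_less[OF xs(3)] that xs(2) by auto
  have j: "\<theta> j = 0" using nz[OF assms(2)] by (simp add: \<theta>_def Arg2pi_eq_0)
  have rng: "0 \<le> \<theta> p" "\<theta> p < 2 * pi" for p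
    by (auto simp: \<theta>_def Arg2pi_ge_0 Arg2pi_lt_2pi)
  have pos: "card N > 0" using assms(1,2) card_gt_0_iff by blast
  obtain t where t: "t < card N" "f t = j"
    using bij assms(2) unfolding bij_betw_def by (metis imageE lessThan_iff)
  have "t = 0"
    using lt[of 0 t] t \<theta>f[of t] \<theta>f(1)[OF pos] rng(1)[of "f 0"] j by (cases "t = 0") auto
  show ?thesis
  proof (rule that[of f "\<lambda>l. xs ! l"])
    show "bij_betw f {..<card N} N" by (fact bij)
    show "f 0 = j" using t \<open>t = 0\<close> by simp
    then show "xs ! 0 = 0" using \<theta>f(1)[OF pos] j by simp
    show "0 \<le> xs ! l \<and> xs ! l < 2 * pi \<and> e (f l) = e j * cis (xs ! l)" if "l < card N" for l
      using \<theta>f[OF that] rng[of "f l"] e[of "f l"] by auto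
  qed (use lt in auto)
qed

lemma sum_cyclic_gaps:
  fixes \<psi> :: "nat \<Rightarrow> real"
  assumes "0 < k"
  shows "(\<Sum>l<k. if Suc l < k then \<psi> (Suc l) - \<psi> l else t + \<psi> 0 - \<psi> l) = t"
proof -
  obtain n where k: "k = Suc n" using assms by (cases k) auto
  have "(\<Sum>l<n. if Suc l < k then \<psi> (Suc l) - \<psi> l else t + \<psi> 0 - \<psi> l) = (\<Sum>l<n. \<psi> (Suc l) - \<psi> l)"
    by (intro sum.cong) (auto simp: k)
  then show ?thesis by (simp add: k sum_lessThan_telescope)
qed

lemma inner_cis_mult:
  "norm e = 1 \<Longrightarrow> (e * cis \<alpha>) \<bullet> (e * cis \<beta>) = cos (\<beta> - \<alpha>)"
  "norm e = 1 \<Longrightarrow> Im (cnj (e * cis \<alpha>) * (e * cis \<beta>)) = sin (\<beta> - \<alpha>)"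
proof -
  assume "norm e = 1"
  then have "Re e * Re e + Im e * Im e = 1"
    using cmod_power2[of e] by (simp add: power2_eq_square)
  then show "(e * cis \<alpha>) \<bullet> (e * cis \<beta>) = cos (\<beta> - \<alpha>)"
    "Im (cnj (e * cis \<alpha>) * (e * cis \<beta>)) = sin (\<beta> - \<alpha>)"
    unfolding inner_complex_def cos_diff sin_diff by (simp_all, algebra+)
qed

text \<open>By \<open>empty_arc\<close> no further point lies on the shorter arc of a pair in
  \<open>C\<close>, so pairs are neighbours in the cyclic order; since every point has two partners,
  all neighbouring pairs occur. The factor \<open>Im\<close> makes the gap smaller than
  \<open>pi\<close>, so that \<open>arccos\<close> returns the gap itself.\<close>

lemma sum_angles_around:
  fixes e :: "'v \<Rightarrow> complex"
  assumes fin: "finite N" and ne: "N \<noteq> {}" and inj: "inj_on e N"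
    and unit: "\<And>p. p \<in> N \<Longrightarrow> norm (e p) = 1"
    and C: "\<And>c. c \<in> C \<Longrightarrow> \<exists>p\<in>N. \<exists>q\<in>N. p \<noteq> q \<and> c = {p, q}"
    and empty_arc: "\<And>p q m. {p, q} \<in> C \<Longrightarrow> m \<in> N - {p, q} \<Longrightarrow>
      orient (e p) (e q) (e m) * Im (cnj (e p) * e q) > 0"
    and two: "\<And>p. p \<in> N \<Longrightarrow> \<exists>q q'. q \<noteq> q' \<and> {p, q} \<in> C \<and> {p, q'} \<in> C"
    and \<alpha>: "\<And>p q. {p, q} \<in> C \<Longrightarrow> \<alpha> {p, q} = arccos (e p \<bullet> e q)"
  shows "(\<Sum>c\<in>C. \<alpha> c) = 2 * pi"
proof -
  obtain j where j: "j \<in> N" using ne by blast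
  define k where "k = card N"
  obtain f \<psi> where f: "bij_betw f {..<k} N" "f 0 = j" "\<psi> 0 = (0::real)"
    "\<And>l. l < k \<Longrightarrow> 0 \<le> \<psi> l \<and> \<psi> l < 2 * pi \<and> e (f l) = e j * cis (\<psi> l)"
    "\<And>l m. l < m \<Longrightarrow> m < k \<Longrightarrow> \<psi> l < \<psi> m"
    using circle_enum[OF fin j inj unit] unfolding k_def by metis
  have ej: "norm (e j) = 1" using unit j by auto
  have inN: "f l \<in> N" if "l < k" for l using f(1) that by (auto simp: bij_betw_def)
  have feq: "f l = f m \<longleftrightarrow> l = m" if "l < k" "m < k" for l m
    using f(1) that by (auto simp: bij_betw_def inj_on_def)
  have ex: "\<exists>l<k. p = f l" if "p \<in> N" for p
    using f(1) that unfolding bij_betw_def by (metis imageE lessThan_iff)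
  have pairN: "p \<in> N \<and> q \<in> N \<and> p \<noteq> q" if "{p, q} \<in> C" for p q
    using C[OF that] by (auto simp: doubleton_eq_iff)
  \<comment> \<open>With only two points, predecessor and successor would coincide and
    \<open>c\<close> below would not be injective.\<close>
  have k3: "k \<ge> 3"
  proof -
    obtain q q' where q: "q \<noteq> q'" "{j, q} \<in> C" "{j, q'} \<in> C" using two[OF j] by blast
    then have "{j, q, q'} \<subseteq> N" "card {j, q, q'} = 3"
      using pairN[of j q] pairN[of j q'] by auto
    then show ?thesis unfolding k_def using card_mono[OF fin] by metis
  qed
  have side: "orient (e (f x)) (e (f y)) (e (f z)) > 0" if "x < y" "y < z" "z < k" for x y z
    using that f(4)[of x] f(4)[of y] f(4)[of z] f(5)[of x y] f(5)[of y z]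
    by (auto intro!: orient_cis_pos[OF ej])
  text \<open>A pair in \<open>C\<close> has all other points of \<open>N\<close> on one side, so it is adjacent in the cyclic order.\<close>
  have adj: "y = Suc x \<or> x = 0 \<and> y = k - 1" if xy: "x < y" "y < k" "{f x, f y} \<in> C" for x y
  proof (rule ccontr)
    assume n: "\<not> ?thesis"
    then obtain z where z: "x < z" "z < y"
      using xy(1) by (metis Suc_lessI lessI)
    obtain w where w: "w < k" "w < x \<or> y < w"
    proof (cases "x = 0")
      case True
      then show ?thesis using n xy that[of "k - 1"] by auto
    qed (use xy that[of 0] in auto)
    have m: "f z \<in> N - {f x, f y}" "f w \<in> N - {f x, f y}"
      using z w xy inN feq by auto
    have "orient (e (f x)) (e (f y)) (e (f z)) < 0"
      using side[OF z xy(2)] by (metis neg_less_0_iff_less orient_rotate orient_swap)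
    moreover have "orient (e (f x)) (e (f y)) (e (f w)) > 0"
      using w(2) side[of w x y] side[of x y w] xy w by (metis orient_rotate)
    ultimately show False
      using empty_arc[OF xy(3) m(1)] empty_arc[OF xy(3) m(2)] by (auto simp: zero_less_mult_iff)
  qed
  define c where "c l = {f l, f (Suc l mod k)}" for l
  define gap where "gap l = (if Suc l < k then \<psi> (Suc l) - \<psi> l else 2 * pi + \<psi> 0 - \<psi> l)" for l
  have modk: "Suc l mod k = (if Suc l < k then Suc l else 0)" if "l < k" for l
    using that by (auto simp: mod_Suc)
  have onto: "c' \<in> c ` {..<k}" if c': "c' \<in> C" for c'
  proof -
    obtain p q where pq: "p \<in> N" "q \<in> N" "p \<noteq> q" "c' = {p, q}" using C[OF c'] by blast
    obtain x y where xy: "x < k" "y < k" "p = f x" "q = f y" using ex pq by metis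
    have *: "{f x, f y} \<in> c ` {..<k}" if "x < y" "y < k" "{f x, f y} \<in> C" for x y
      using adj[OF that]
    proof
      assume "y = Suc x"
      then show ?thesis using that modk[of x] by (intro image_eqI[of _ _ x]) (auto simp: c_def)
    next
      assume "x = 0 \<and> y = k - 1"
      then show ?thesis using that modk[of y] by (intro image_eqI[of _ _ y]) (auto simp: c_def)
    qed
    show ?thesis
      using *[of x y] *[of y x] xy pq c' by (cases x y rule: linorder_cases) (auto simp: insert_commute)
  qed
  have into: "c l \<in> C" if l: "l < k" for l
  proof -
    obtain q q' where q: "q \<noteq> q'" "{f l, q} \<in> C" "{f l, q'} \<in> C" using two[OF inN[OF l]] by blast
    \<comment> \<open>\<open>pr\<close> is the cyclic predecessor. The two distinct partners of
      \<open>f l\<close> are among predecessor and successor, hence the successor is one of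
      them.\<close>
    define pr where "pr = (if l = 0 then k - 1 else l - 1)"
    have nb: "r = f (Suc l mod k) \<or> r = f pr" if r: "{f l, r} \<in> C" for r
    proof -
      obtain y where y: "y < k" "r = f y" using pairN[OF r] ex by metis
      have "y \<noteq> l" using pairN[OF r] y by auto
      then have "y = Suc l mod k \<or> y = pr"
        using adj[of l y] adj[of y l] r y l modk[OF l] unfolding pr_def
        by (cases l y rule: linorder_cases) (auto simp: insert_commute)
      then show ?thesis using y by auto
    qed
    then show ?thesis using q unfolding c_def by metis
  qed
  have "inj_on c {..<k}"
  proof (rule inj_onI)
    fix l m assume lm: "l \<in> {..<k}" "m \<in> {..<k}" "c l = c m"
    have "Suc l mod k < k" "Suc m mod k < k" using k3 by auto
    then have "l = m \<or> (l = Suc m mod k \<and> m = Suc l mod k)"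
      using lm by (auto simp: c_def doubleton_eq_iff feq)
    then show "l = m"
      using lm modk[of l] modk[of m] k3 by (auto split: if_splits)
  qed
  then have "(\<Sum>c\<in>C. \<alpha> c) = (\<Sum>l<k. \<alpha> (c l))"
    using onto into by (intro sum.reindex_cong[of c]) auto
  also have "\<dots> = (\<Sum>l<k. gap l)"
  proof (rule sum.cong)
    fix l assume "l \<in> {..<k}"
    then have l: "l < k" by simp
    define n where "n = Suc l mod k"
    have n: "n < k" "n \<noteq> l" using k3 l modk[OF l] by (auto simp: n_def)
    have el: "e (f l) = e j * cis (\<psi> l)" and en: "e (f n) = e j * cis (\<psi> l + gap l)"
      using f(4)[OF l] f(4)[OF n(1)] f(3) modk[OF l]
      by (auto simp: gap_def n_def cis_mult[symmetric] cis_divide[symmetric] f)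
    have gap0: "0 < gap l" "gap l < 2 * pi"
      using f(4)[OF l] f(4)[of "Suc l"] f(5)[of l "Suc l"] f(5)[of 0 l] f(3) k3 l
      unfolding gap_def by (auto split: if_splits)
    \<comment> \<open>A third point as a test for \<open>empty_arc\<close>: its orientation is
      known, so the sign of \<open>Im\<close> follows.\<close>
    obtain m where m: "m < k" "m \<noteq> l" "m \<noteq> n"
    proof -
      have "card {l, n} < card {..<k}" using k3 by (auto simp: card_insert_if)
      then show ?thesis using that by (metis card_mono finite.emptyI finite.insertI insertCI lessThan_iff not_le subsetI)
    qed
    have "orient (e (f l)) (e (f n)) (e (f m)) > 0"
    proof (cases "Suc l < k")
      case True
      then have "n = Suc l" by (simp add: n_def)
      then show ?thesis using side[of l n m] side[of m l n] m n True
          orient_rotate[of "e (f m)" "e (f l)" "e (f n)"]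
        by (cases "m < l") auto
    next
      case False
      then have "n = 0" "l = k - 1" using l by (auto simp: n_def modk)
      then show ?thesis using side[of n m l] m l orient_rotate[of "e (f l)" "e (f n)" "e (f m)"]
        by (cases "m = 0") auto
    qed
    moreover have "{f l, f n} \<in> C" using into[OF l] by (simp add: c_def n_def)
    moreover have "f m \<in> N - {f l, f n}" using m n l inN feq by auto
    ultimately have "Im (cnj (e (f l)) * e (f n)) > 0"
      using empty_arc by (metis zero_less_mult_pos)
    then have "sin (gap l) > 0"
      unfolding el en inner_cis_mult(2)[OF ej] by simp
    then have "gap l < pi"
      using gap0 sin_le_zero[of "gap l"] by (meson not_less)
    moreover have "\<alpha> (c l) = arccos (cos (gap l))"
      using \<alpha>[of "f l" "f n"] \<open>{f l, f n} \<in> C\<close> unfolding el en inner_cis_mult(1)[OF ej]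
      by (simp add: c_def n_def)
    ultimately show "\<alpha> (c l) = gap l"
      using gap0 by (simp add: arccos_cos)
  qed simp
  also have "\<dots> = 2 * pi"
    unfolding gap_def using sum_cyclic_gaps[of k \<psi> "2 * pi"] k3 by simp
  finally show ?thesis .
qed

section \<open>Packings of a strip\<close>

lemma lorentz_packing_cong:
  assumes "lorentz_packing V E s" "\<And>i j. i \<in> V \<Longrightarrow> j \<in> V \<Longrightarrow> lor (t i) (t j) = lor (s i) (s j)"
  shows "lorentz_packing V E t"
  using assms unfolding lorentz_packing_def by simp

lemma strip_normal_form:
  assumes "lorentz_packing V E s" and ab: "{a, b} \<in> E" and pos: "lk (s a) > 0" "lk (s b) > 0"
  obtains t where "mobius_equiv V s t" "\<And>i j. lor (t i) (t j) = lor (s i) (s j)"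
    "t a = (\<i>, 0, 1)" "t b = (-\<i>, 0, 1)"
proof -
  interpret lorentz_packing V E s by fact
  have V: "a \<in> V" "b \<in> V" and ne: "a \<noteq> b" using edgeD[OF ab] by auto
  define \<mu> where "\<mu> = lk (s a) + lk (s b)"
  \<comment> \<open>The point of tangency of \<open>s a\<close> and \<open>s b\<close>, to be moved
    to 0 and then to infinity.\<close>
  define p where "p = (lw (s a) + lw (s b)) /\<^sub>R \<mu>"
  have \<mu>: "\<mu> > 0" using pos by (simp add: \<mu>_def)
  have laa: "lw (s a) \<bullet> lw (s a) = 1 + lk (s a) * ll (s a)"
    and lbb: "lw (s b) \<bullet> lw (s b) = 1 + lk (s b) * ll (s b)"
    and lab: "lw (s a) \<bullet> lw (s b) = -1 + (lk (s a) * ll (s b) + ll (s a) * lk (s b)) / 2"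
    using lor_self[OF V(1)] lor_self[OF V(2)] lor_edge[OF ab]
    unfolding lor_def inner_complex_def by (simp_all add: algebra_simps)
  have np: "(norm p)\<^sup>2 = (ll (s a) + ll (s b)) / \<mu>"
  proof -
    have "(lw (s a) + lw (s b)) \<bullet> (lw (s a) + lw (s b)) = \<mu> * (ll (s a) + ll (s b))"
      by (simp add: inner_add_left inner_add_right inner_commute[of "lw (s b)" "lw (s a)"] laa lbb lab \<mu>_def
          algebra_simps add_divide_distrib)
    then show ?thesis
      using \<mu> by (simp only: power2_norm_eq_inner p_def inner_scaleR_left inner_scaleR_right)
        (simp add: field_simps)
  qed
  have dp: "Re (lw u * cnj p) = lw u \<bullet> (lw (s a) + lw (s b)) / \<mu>" for u
    by (simp add: p_def inner_complex_def divide_inverse algebra_simps)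
  define s1 where "s1 i = linv (ltrans (-p) (s i))" for i
  have k1: "lk (s1 a) = 0" "lk (s1 b) = 0" and l1: "ll (s1 a) = lk (s a)" "ll (s1 b) = lk (s b)"
    using \<mu> by (simp_all add: s1_def linv_def ltrans_def np dp inner_add_right laa lbb lab
        inner_commute[of "lw (s b)" "lw (s a)"] del: Re_complex_of_real times_complex.sel)
      (simp_all add: field_simps \<mu>_def)
  have lor1: "lor (s1 i) (s1 j) = lor (s i) (s j)" for i j by (simp add: s1_def)
  define w where "w = lw (s1 a)"
  have ww: "w \<bullet> w = 1"
    using lor1[of a a] lor_self[OF V(1)] k1 by (simp add: lor_def inner_complex_def w_def)
  then have nw: "norm w = 1" by (simp add: norm_eq_sqrt_inner)
  have wb: "lw (s1 b) = - w"
  proof -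
    have "lw (s1 b) \<bullet> lw (s1 b) = 1" "w \<bullet> lw (s1 b) = -1"
      using lor1[of b b] lor_self[OF V(2)] lor1[of a b] lor_edge[OF ab] k1
      by (simp_all add: lor_def inner_complex_def w_def)
    then have "(w + lw (s1 b)) \<bullet> (w + lw (s1 b)) = 0"
      using ww by (simp add: inner_add_left inner_add_right inner_commute)
    then show ?thesis by (simp add: eq_neg_iff_add_eq_0 add.commute)
  qed
  \<comment> \<open>The rotation \<open>\<i> * cnj w\<close> turns the normal \<open>w\<close> into
    \<open>\<i>\<close>, the factor \<open>2 / \<mu>\<close> makes the strip 1 wide, and the
    translation by \<open>\<beta>\<close> below centers it at the real axis.\<close>
  define \<alpha> where "\<alpha> = of_real (2 / \<mu>) * (\<i> * cnj w)"
  have n\<alpha>: "norm \<alpha> = 2 / \<mu>"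
    unfolding \<alpha>_def norm_mult norm_of_real using \<mu> nw by simp
  have \<alpha>: "\<alpha> \<noteq> 0" "norm \<alpha> = 2 / \<mu>" "sgn \<alpha> = \<i> * cnj w"
    using \<mu> n\<alpha> by (auto simp: sgn_eq) (simp add: \<alpha>_def)
  have wcw: "w * cnj w = 1" using nw complex_norm_square[of w] by simp
  define s2 where "s2 i = lscale \<alpha> (s1 i)" for i
  define c where "c = 2 * lk (s a) / \<mu>"
  have c: "2 * lk (s b) / \<mu> = 2 - c" using \<mu> by (simp add: c_def field_simps) (simp add: \<mu>_def)
  have s2a: "s2 a = (\<i>, 0, c)"
    using wcw by (simp add: s2_def lscale_def k1 l1 \<alpha> c_def flip: w_def)
  have s2b: "s2 b = (-\<i>, 0, 2 - c)"
    using wcw by (simp add: s2_def lscale_def k1 l1 \<alpha> wb flip: c)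
  define \<beta> where "\<beta> = \<i> * of_real ((1 - c) / 2)"
  define t where "t i = ltrans \<beta> (s2 i)" for i
  show ?thesis
  proof (rule that[of t])
    note [trans] = mobius_equiv_trans
    have "mobius_equiv V s (\<lambda>i. ltrans (-p) (s i))" by (rule mobius_equiv_ltrans)
    also have "mobius_equiv V (\<lambda>i. ltrans (-p) (s i)) s1"
      using mobius_equiv_linv[of V "\<lambda>i. ltrans (-p) (s i)"] by (simp add: s1_def[abs_def])
    also have "mobius_equiv V s1 s2"
      using mobius_equiv_lscale[OF \<alpha>(1), of V s1] by (simp add: s2_def[abs_def])
    also have "mobius_equiv V s2 t"
      using mobius_equiv_ltrans[of V s2 \<beta>] by (simp add: t_def[abs_def])
    finally show "mobius_equiv V s t" .
    show "lor (t i) (t j) = lor (s i) (s j)" for i j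
      using \<alpha>(1) by (simp add: t_def s2_def lor1)
    show "t a = (\<i>, 0, 1)" "t b = (-\<i>, 0, 1)"
      by (simp_all add: t_def ltrans_def s2a s2b \<beta>_def field_simps)
  qed
qed

definition edges_in_two_faces :: "'v set \<Rightarrow> 'v set set \<Rightarrow> bool" where
  "edges_in_two_faces V E \<longleftrightarrow>
     (\<forall>i j. {i, j} \<in> E \<longrightarrow> (\<exists>k l. k \<noteq> l \<and> facial V E i j k \<and> facial V E i j l))"

text \<open>The link of \<open>i\<close>: each facial triangle at \<open>i\<close> contributes its
  opposite edge.\<close>

definition link_edges :: "'v set \<Rightarrow> 'v set set \<Rightarrow> 'v \<Rightarrow> 'v set set" where
  "link_edges V E i = {{j, k} | j k. facial V E i j k}"

lemma link_edges_iff: "{j, k} \<in> link_edges V E i \<longleftrightarrow> facial V E i j k"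
  unfolding link_edges_def using facial_swap by (auto simp: doubleton_eq_iff)

text \<open>The disks \<open>a\<close> and \<open>b\<close> are the half-planes \<open>Im z \<ge> 1/2\<close> and \<open>Im z \<le> -1/2\<close>.\<close>

locale strip_packing = lorentz_packing +
  fixes a b :: 'a
  assumes aV: "a \<in> V" and bV: "b \<in> V" and ab_ne: "a \<noteq> b"
    and sa: "s a = (\<i>, 0, 1)" and sb: "s b = (-\<i>, 0, 1)"
begin

lemma ab_edge: "{a, b} \<in> E"
  using edge_iff[OF aV bV ab_ne] by (simp add: sa sb lor_def)

text \<open>\<open>s a + s b = (0, 0, 2)\<close> is a null vector of infinity, and pairing with it
  reads off the curvature.\<close>

lemma lk_eq: "lk (s i) = - (lor (s i) (s a) + lor (s i) (s b))"
  by (simp add: sa sb lor_def)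

lemma lk_ge: "i \<in> V \<Longrightarrow> i \<notin> {a, b} \<Longrightarrow> lk (s i) \<ge> 2"
  using lor_le[of i a] lor_le[of i b] aV bV by (simp add: lk_eq)

lemma lk_pos: "i \<in> V \<Longrightarrow> i \<notin> {a, b} \<Longrightarrow> lk (s i) > 0"
  using lk_ge by fastforce

lemma lk_nonneg: "i \<in> V \<Longrightarrow> lk (s i) \<ge> 0"
  using lk_pos[of i] sa sb by force

lemma lk_touching: "{i, a} \<in> E \<Longrightarrow> {i, b} \<in> E \<Longrightarrow> lk (s i) = 2"
  by (simp add: lk_eq lor_edge)

text \<open>For disks this is \<open>r p / (r i + r p)\<close> in terms of radii, for a half-plane
  \<open>p\<close> it is 1. The product of the weights of tangent \<open>p\<close>, \<open>q\<close>
  is the squared sine of half the angle at \<open>i\<close>, so the angle increases with either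
  weight.\<close>

definition weight :: "'a \<Rightarrow> 'a \<Rightarrow> real" where
  "weight i p = lk (s i) / (lk (s p) + lk (s i))"

lemma norm_tdir:
  assumes "i \<notin> {a, b}" "{i, p} \<in> E"
  shows "norm (tdir (s i) (s p)) = 1"
  using assms edgeD[OF assms(2)] lor_self lk_pos lk_nonneg lor_edge tangent_lvec(3) by meson

lemma small_arc_empty:
  assumes i: "i \<notin> {a, b}" and f: "facial V E i j k" and jk: "{j, k} \<noteq> {a, b}"
    and m: "{i, m} \<in> E" "m \<notin> {j, k}"
  shows "orient (tdir (s i) (s j)) (tdir (s i) (s k)) (tdir (s i) (s m)) *
     Im (cnj (tdir (s i) (s j)) * tdir (s i) (s k)) > 0"
proof -
  have E: "{i, j} \<in> E" "{i, k} \<in> E" "{j, k} \<in> E" using f by (auto simp: facial_def)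
  have V: "i \<in> V" "j \<in> V" "k \<in> V" "m \<in> V" and ne: "m \<noteq> i"
    using E m edgeD by blast+
  define L where "L x = ldet (s i) (s j) (s k) x" for x
  have mV: "m \<in> V - {i, j, k}" using V ne m by auto
  have same: "L (s m) * L (s x) > 0" if "x \<in> V - {i, j, k}" for x
    unfolding L_def using facial_same_side[OF f mV that] .
  \<comment> \<open>Infinity is the sum of the half-planes. One of \<open>a\<close>,
    \<open>b\<close> lies outside the triangle and has the sign of \<open>m\<close>; the other has
    this sign too or contributes 0.\<close>
  have "L (0, 0, 2) = L (s a) + L (s b)"
    by (simp add: L_def ldet_def det_4 sa sb algebra_simps)
  moreover have "a \<notin> {i, j, k} \<or> b \<notin> {i, j, k}"
    using i jk ab_ne by auto
  moreover have "L (s j) = 0" "L (s k) = 0"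
    by (simp_all add: L_def ldet_def det_4 algebra_simps)
  ultimately have pos: "L (s m) * L (0, 0, 2) > 0"
    using same[of a] same[of b] aV bV i
    by (cases "a \<in> {j, k}"; cases "b \<in> {j, k}") (auto simp: distrib_left add_pos_pos)
  have u: "lor (s i) (s i) = 1" "lk (s i) > 0" using V(1) i lor_self lk_pos by auto
  have t: "lor (s p) (s p) = 1" "lk (s p) \<ge> 0" "lor (s i) (s p) = -1" if "{i, p} \<in> E" for p
    using edgeD[OF that] lor_self lk_nonneg lor_edge[OF that] by auto
  have k: "lk (s p) + lk (s i) > 0" if "{i, p} \<in> E" for p
    using t(2)[OF that] u by simp
  define A where "A = 2 * (lk (s j) + lk (s i)) * (lk (s k) + lk (s i)) * (lk (s m) + lk (s i)) / (lk (s i))^3"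
  define B where "B = 2 * (lk (s j) + lk (s i)) * (lk (s k) + lk (s i)) / lk (s i)"
  have AB: "A > 0" "B > 0" unfolding A_def B_def using k[OF E(1)] k[OF E(2)] k[OF m(1)] u by (auto intro!: divide_pos_pos mult_pos_pos)
  have "L (s m) * L (0, 0, 2) = (A * B) * (orient (tdir (s i) (s j)) (tdir (s i) (s k)) (tdir (s i) (s m)) *
     Im (cnj (tdir (s i) (s j)) * tdir (s i) (s k)))"
    unfolding L_def ldet_tangent[OF u t[OF E(1)] t[OF E(2)] t[OF m(1)]]
      ldet_tangent_infinity[OF u t[OF E(1)] t[OF E(2)]] A_def[symmetric] B_def[symmetric]
    by (simp only: mult_ac)
  then show ?thesis using pos AB
    by (metis mult_pos_pos zero_less_mult_pos)
qed

lemma sum_link_angles: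
  assumes Z: "edges_in_two_faces V E" and i: "i \<notin> {a, b}" "\<not> ({i, a} \<in> E \<and> {i, b} \<in> E)"
    and deg: "{i, p0} \<in> E"
  shows "(\<Sum>c\<in>link_edges V E i. arccos (1 - 2 * (\<Prod>p\<in>c. weight i p))) = 2 * pi"
proof -
  define N where "N = {p. {i, p} \<in> E}"
  define e where "e p = tdir (s i) (s p)" for p
  have iV: "i \<in> V" using edgeD[OF deg] by simp
  have u: "lor (s i) (s i) = 1" "lk (s i) > 0" using iV i lor_self lk_pos by auto
  have t: "lor (s p) (s p) = 1" "lk (s p) \<ge> 0" "lor (s i) (s p) = -1" if "{i, p} \<in> E" for p
    using edgeD[OF that] lor_self lk_nonneg lor_edge[OF that] by auto
  have k: "lk (s p) + lk (s i) > 0" if "{i, p} \<in> E" for p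
    using t(2)[OF that] u by simp
  have diff: "(norm (e p - e q))\<^sup>2 = 2 * (lk (s i))\<^sup>2 * (1 - lor (s p) (s q)) / ((lk (s p) + lk (s i)) * (lk (s q) + lk (s i)))"
    if "{i, p} \<in> E" "{i, q} \<in> E" for p q
    unfolding e_def by (rule norm_tdir_diff[OF u t[OF that(1)] t[OF that(2)]])
  show ?thesis
  proof (rule sum_angles_around[of N e])
    show "finite N" using edgeD finite_V by (auto simp: N_def intro: finite_subset[of _ V])
    show "N \<noteq> {}" using deg by (auto simp: N_def)
    show "inj_on e N"
    proof (rule inj_onI, rule ccontr)
      fix p q assume pq: "p \<in> N" "q \<in> N" "e p = e q" "p \<noteq> q"
      then have "lor (s p) (s q) \<le> -1"
        using lor_le edgeD by (auto simp: N_def)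
      then have "2 * (lk (s i))\<^sup>2 * (1 - lor (s p) (s q)) / ((lk (s p) + lk (s i)) * (lk (s q) + lk (s i))) > 0"
        using u k pq by (intro divide_pos_pos mult_pos_pos) (auto simp: N_def)
      then show False using diff[of p q] pq by (auto simp: N_def)
    qed
    show "norm (e p) = 1" if "p \<in> N" for p
      using norm_tdir[OF i(1)] that by (simp add: e_def N_def)
    show "\<exists>p\<in>N. \<exists>q\<in>N. p \<noteq> q \<and> c = {p, q}" if "c \<in> link_edges V E i" for c
      using that edgeD by (fastforce simp: link_edges_def facial_def N_def)
    show "\<exists>q q'. q \<noteq> q' \<and> {p, q} \<in> link_edges V E i \<and> {p, q'} \<in> link_edges V E i" if "p \<in> N" for p
      using Z that unfolding edges_in_two_faces_def link_edges_iff N_def by blast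
    show "orient (e p) (e q) (e m) * Im (cnj (e p) * e q) > 0"
      if "{p, q} \<in> link_edges V E i" "m \<in> N - {p, q}" for p q m
      unfolding e_def
    proof (rule small_arc_empty[OF i(1)])
      show "facial V E i p q" using that by (simp add: link_edges_iff)
      then show "{p, q} \<noteq> {a, b}" using i(2) by (auto simp: facial_def doubleton_eq_iff)
    qed (use that in \<open>auto simp: N_def\<close>)
    show "arccos (1 - 2 * (\<Prod>p\<in>{p, q}. weight i p)) = arccos (e p \<bullet> e q)"
      if "{p, q} \<in> link_edges V E i" for p q
    proof -
      have E: "{i, p} \<in> E" "{i, q} \<in> E" "{p, q} \<in> E"
        using that by (auto simp: link_edges_iff facial_def)
      \<comment> \<open>The squared chord \<open>2 - 2 cos\<close> is compared with
        \<open>norm_tdir_diff\<close> for tangent \<open>p\<close>, \<open>q\<close>.\<close>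
      have "1 + 1 - 2 * (e p \<bullet> e q) = (norm (e p - e q))\<^sup>2"
        using norm_tdir[OF i(1) E(1)] norm_tdir[OF i(1) E(2)]
        by (simp add: e_def power2_norm_eq_inner inner_diff inner_commute norm_eq_1)
      also have "\<dots> = 4 * (weight i p * weight i q)"
        unfolding diff[OF E(1,2)] lor_edge[OF E(3)] weight_def by (simp add: power2_eq_square)
      finally have "e p \<bullet> e q = 1 - 2 * (weight i p * weight i q)" by simp
      then show ?thesis using edgeD[OF E(3)] by simp
    qed
  qed
qed

end

section \<open>Rigidity\<close>

text \<open>A vertex outside the two triangles at \<open>a b\<close> is joined to \<open>k\<close>
  by a path that avoids \<open>a\<close>, \<open>b\<close> and \<open>l\<close>.\<close>

lemma has_neighbour:
  assumes "simple_graph V E" and Z: "edges_in_two_faces V E" and ab: "{a, b} \<in> E" and i: "i \<in> V"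
  shows "\<exists>p. {i, p} \<in> E"
proof -
  obtain k l where kl: "k \<noteq> l" "facial V E a b k" "facial V E a b l"
    using Z ab unfolding edges_in_two_faces_def by blast
  have E: "{a, k} \<in> E" "{b, l} \<in> E" "{a, l} \<in> E" "{b, k} \<in> E" using kl by (auto simp: facial_def)
  note V = simple_graph_edgeD[OF assms(1)]
  show ?thesis
  proof (cases "i \<in> {a, b, k, l}")
    case True
    then show ?thesis using ab E by (auto simp: insert_commute)
  next
    case False
    have "connected_on E (V - {a, b, l})" "k \<in> V - {a, b, l}" "i \<in> V - {a, b, l}"
      using kl False i V[OF E(1)] V[OF E(4)] by (auto simp: facial_def)
    then have "(i, k) \<in> {(x, y). x \<in> V - {a, b, l} \<and> y \<in> V - {a, b, l} \<and> {x, y} \<in> E}\<^sup>*"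
      by (auto simp: connected_on_def)
    then show ?thesis using False by (auto elim: converse_rtranclE)
  qed
qed

text \<open>The maximum principle: where the ratio of the curvatures is extremal, all the angles of the
  second packing are at most those of the first, while both angle sums are \<open>2\<pi>\<close>.\<close>

lemma strip_curvature_le:
  assumes "strip_packing V E s a b" "strip_packing V E t a b" and Z: "edges_in_two_faces V E"
    and i: "i \<in> V"
  shows "lk (s i) \<le> lk (t i)"
proof (cases "i \<in> {a, b}")
  case True
  interpret s: strip_packing V E s a b by fact
  interpret t: strip_packing V E t a b by fact
  show ?thesis using True s.sa t.sa s.sb t.sb by auto
next
  case False
  interpret s: strip_packing V E s a b by fact
  interpret t: strip_packing V E t a b by fact
  define W where "W = V - {a, b}"
  define q where "q x = lk (t x) / lk (s x)" for x
  have W: "finite W" "i \<in> W" using s.finite_V i False by (auto simp: W_def)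
  have pos: "lk (s x) > 0" "lk (t x) > 0" if "x \<in> W" for x
    using that s.lk_pos t.lk_pos by (auto simp: W_def)
  \<comment> \<open>The half-planes are left out, as the ratio would be 0/0 there. The aim is
    \<open>m = 1\<close>.\<close>
  define m where "m = Min (q ` W)"
  have m_le: "m \<le> q x" if "x \<in> W" for x using that W by (simp add: m_def)
  have "m \<in> q ` W" unfolding m_def using W by (intro Min_in) auto
  then obtain x0 where x0: "x0 \<in> W" "q x0 = m" by auto
  have touch: "q x = 1" if "{x, a} \<in> E" "{x, b} \<in> E" for x
    using that by (simp add: q_def s.lk_touching t.lk_touching)
  \<comment> \<open>Relative to \<open>x\<close> no neighbour has lost curvature in
    \<open>t\<close>, so no weight and no angle at \<open>x\<close> increases. Both angle sums are
    \<open>2 * pi\<close>, hence nothing changes and the neighbours have the ratio \<open>m\<close>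
    too.\<close>
  have spread: "q y = m" if x: "x \<in> W" "q x = m" and y: "y \<in> W" "{x, y} \<in> E"
    and nt: "\<not> ({x, a} \<in> E \<and> {x, b} \<in> E)" for x y
  proof -
    have xi: "x \<notin> {a, b}" using x by (simp add: W_def)
    define A where "A c = arccos (1 - 2 * (\<Prod>p\<in>c. s.weight x p))" for c
    define B where "B c = arccos (1 - 2 * (\<Prod>p\<in>c. t.weight x p))" for c
    have wle: "t.weight x p \<le> s.weight x p" and wpos: "t.weight x p > 0" and w1: "s.weight x p \<le> 1"
      if p: "{x, p} \<in> E" for p
    proof -
      have pV: "p \<in> V" using s.edgeD[OF p] by simp
      have "lk (s p) * lk (t x) \<le> lk (t p) * lk (s x)"
      proof (cases "p \<in> {a, b}")
        case True
        then show ?thesis using s.sa t.sa s.sb t.sb by auto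
      next
        case False
        then have "p \<in> W" using pV by (simp add: W_def)
        then have "q x \<le> q p" using m_le x by simp
        then show ?thesis using pos[OF x(1)] pos[OF \<open>p \<in> W\<close>] by (simp add: q_def field_simps)
      qed
      then show "t.weight x p \<le> s.weight x p"
        using pos[OF x(1)] s.lk_nonneg[OF pV] t.lk_nonneg[OF pV]
        by (simp add: s.weight_def t.weight_def divide_simps add_nonneg_pos algebra_simps)
      show "t.weight x p > 0" "s.weight x p \<le> 1"
        using pos[OF x(1)] s.lk_nonneg[OF pV] t.lk_nonneg[OF pV]
        by (auto simp: s.weight_def t.weight_def intro!: divide_pos_pos add_nonneg_pos)
    qed
    have pair: "(\<Prod>p\<in>{j, k}. s.weight x p) = s.weight x j * s.weight x k"
      "(\<Prod>p\<in>{j, k}. t.weight x p) = t.weight x j * t.weight x k"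
      "{x, j} \<in> E" "{x, k} \<in> E" if "{j, k} \<in> link_edges V E x" for j k
      using that s.edgeD[of j k] by (auto simp: link_edges_iff facial_def)
    have le1: "0 < t.weight x j * t.weight x k" "t.weight x j * t.weight x k \<le> s.weight x j * s.weight x k"
        "s.weight x j * s.weight x k \<le> 1" if "{x, j} \<in> E" "{x, k} \<in> E" for j k
    proof -
      note w = wle[OF that(1)] wpos[OF that(1)] w1[OF that(1)] wle[OF that(2)] wpos[OF that(2)] w1[OF that(2)]
      show "0 < t.weight x j * t.weight x k" using w by simp
      show "t.weight x j * t.weight x k \<le> s.weight x j * s.weight x k" using w by (intro mult_mono) auto
      show "s.weight x j * s.weight x k \<le> 1" using w by (intro mult_le_one) auto
    qed
    have BA: "B c \<le> A c" if c: "c \<in> link_edges V E x" for c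
    proof -
      obtain j k where jk: "c = {j, k}" using c by (auto simp: link_edges_def)
      note pr = pair[OF c[unfolded jk]]
      show ?thesis
        unfolding jk A_def B_def pr(1,2)
        by (rule arccos_le_arccos) (use le1[OF pr(3,4)] in linarith)+
    qed
    have "c \<subseteq> V" if "c \<in> link_edges V E x" for c
      using that s.edgeD(1) s.edgeD(2) unfolding link_edges_def facial_def by blast
    then have fin: "finite (link_edges V E x)"
      using s.finite_V finite_subset[of "link_edges V E x" "Pow V"] by auto
    have "sum A (link_edges V E x) = 2 * pi" "sum B (link_edges V E x) = 2 * pi"
      using s.sum_link_angles[OF Z xi nt y(2)] t.sum_link_angles[OF Z xi nt y(2)]
      by (simp_all add: A_def[abs_def] B_def[abs_def])
    then have eq: "B c = A c" if "c \<in> link_edges V E x" for c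
      using sum_mono_inv[of B "link_edges V E x" A c] BA fin that by simp
    obtain k where k: "{y, k} \<in> link_edges V E x"
      using Z y(2) unfolding edges_in_two_faces_def link_edges_iff by blast
    note E = pair(3,4)[OF k]
    have "t.weight x y * t.weight x k = s.weight x y * s.weight x k"
    proof -
      have "cos (B {y, k}) = cos (A {y, k})" using eq[OF k] by simp
      then show ?thesis
        using le1[OF E] by (simp add: A_def B_def pair[OF k] cos_arccos)
    qed
    \<comment> \<open>Both factors are positive and at most those of \<open>s\<close>, so equal
      products force equal factors.\<close>
    then have "t.weight x y = s.weight x y"
      using wle[OF E(1)] wle[OF E(2)] wpos[OF E(1)] wpos[OF E(2)]
      by (smt (verit) mult_left_mono mult_strict_right_mono)
    then have "lk (s y) * lk (t x) = lk (t y) * lk (s x)"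
      using pos[OF x(1)] pos[OF y(1)] by (simp add: s.weight_def t.weight_def field_simps)
    then show "q y = m"
      using x(2) pos[OF x(1)] pos[OF y(1)] by (simp add: q_def field_simps)
  qed
  obtain k l where kl: "k \<noteq> l" "facial V E a b k" "facial V E a b l"
    using Z s.ab_edge unfolding edges_in_two_faces_def by blast
  have E: "{k, a} \<in> E" "{k, b} \<in> E" "{l, a} \<in> E" "{l, b} \<in> E"
    using kl by (auto simp: facial_def insert_commute)
  \<comment> \<open>Disks touching both lines have ratio 1. If \<open>m\<close> differs from 1, no
    disk of ratio \<open>m\<close> is of this kind, so \<open>spread\<close> always applies; as
    \<open>a b l\<close> is facial, the minimum then reaches \<open>k\<close> without passing
    \<open>l\<close>. But \<open>k\<close> touches both lines.\<close>
  have "m = 1"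
  proof (rule ccontr)
    assume m1: "m \<noteq> 1"
    have k: "k \<in> V - {a, b, l}"
      using s.edgeD[OF E(1)] s.edgeD[OF E(2)] kl(1) by auto
    have "x0 \<noteq> l" using touch[of l] E x0 m1 by auto
    then have x0V: "x0 \<in> V - {a, b, l}" using x0 by (auto simp: W_def)
    have "q k = m"
    proof (rule connected_on_invariant[of E "V - {a, b, l}" x0 k "\<lambda>x. q x = m"])
      show "connected_on E (V - {a, b, l})" using kl by (simp add: facial_def)
      fix x y assume "x \<in> V - {a, b, l}" "y \<in> V - {a, b, l}" "{x, y} \<in> E" "q x = m"
      then show "q y = m" using spread[of x y] touch[of x] m1 by (auto simp: W_def)
    qed (use k x0 x0V in auto)
    then show False using touch[of k] E m1 by simp
  qed
  then show ?thesis
    using m_le[OF W(2)] pos[OF W(2)] by (simp add: q_def field_simps)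
qed

lemma lorentz_packing_rigid:
  assumes s: "lorentz_packing V E s" and t: "lorentz_packing V E t" and Z: "edges_in_two_faces V E"
    and pos: "\<And>i. i \<in> V \<Longrightarrow> lk (s i) > 0" "\<And>i. i \<in> V \<Longrightarrow> lk (t i) > 0"
    and i: "i \<in> V" and j: "j \<in> V" and E: "E \<noteq> {}"
  shows "lor (s i) (s j) = lor (t i) (t j)"
proof -
  interpret s: lorentz_packing V E s by fact
  define \<delta> where "\<delta> j = lor (s i) (s j) - lor (t i) (t j)" for j
  have *: "\<delta> a + \<delta> b = 0" if ab: "{a, b} \<in> E" for a b
  proof -
    have V: "a \<in> V" "b \<in> V" "a \<noteq> b" using s.edgeD[OF ab] by auto
    obtain s' where s': "\<And>i j. lor (s' i) (s' j) = lor (s i) (s j)"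
      "s' a = (\<i>, 0, 1)" "s' b = (-\<i>, 0, 1)"
      using strip_normal_form[OF s ab] pos V by metis
    obtain t' where t': "\<And>i j. lor (t' i) (t' j) = lor (t i) (t j)"
      "t' a = (\<i>, 0, 1)" "t' b = (-\<i>, 0, 1)"
      using strip_normal_form[OF t ab] pos V by metis
    have ss: "strip_packing V E s' a b" "strip_packing V E t' a b"
      using lorentz_packing_cong[OF s, of s'] lorentz_packing_cong[OF t, of t'] s' t' V
      by (auto simp: strip_packing_def strip_packing_axioms_def)
    have "lk (s' i) = lk (t' i)"
      using strip_curvature_le[OF ss Z i] strip_curvature_le[OF ss(2,1) Z i] by simp
    then show ?thesis
      using strip_packing.lk_eq[OF ss(1), of i] strip_packing.lk_eq[OF ss(2), of i] s'(1) t'(1)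
      by (simp add: \<delta>_def)
  qed
  \<comment> \<open>Since \<open>i\<close> is fixed, the triangle only has to contain
    \<open>j\<close>.\<close>
  obtain x y where "{x, y} \<in> E"
    using E s.simple unfolding simple_graph_def by (metis all_not_in_conv card_2_iff)
  then obtain p where p: "{j, p} \<in> E" using has_neighbour[OF s.simple Z _ j] by blast
  then obtain r where "facial V E j p r" using Z unfolding edges_in_two_faces_def by blast
  then have "\<delta> j + \<delta> p = 0" "\<delta> j + \<delta> r = 0" "\<delta> p + \<delta> r = 0"
    using * by (auto simp: facial_def)
  then show ?thesis by (simp add: \<delta>_def)
qed

text \<open>A pair of distinct values decides the sign; comparing any further point with both
  members of the pair leaves no choice for its image.\<close>

lemma real_isometry:
  fixes x y :: "'v \<Rightarrow> real"
  assumes "\<And>i j. i \<in> A \<Longrightarrow> j \<in> A \<Longrightarrow> (x i - x j)\<^sup>2 = (y i - y j)\<^sup>2"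
  shows "\<exists>\<sigma> c. (\<sigma> = 1 \<or> \<sigma> = -1) \<and> (\<forall>i\<in>A. y i = \<sigma> * x i + c)"
proof (cases "\<exists>i\<in>A. \<exists>j\<in>A. x i \<noteq> x j")
  case False
  then show ?thesis
  proof (cases "A = {}")
    case False
    then obtain j where j: "j \<in> A" by blast
    have "y i = 1 * x i + (y j - x j)" if "i \<in> A" for i
    proof -
      have "x i = x j" using \<open>\<not> (\<exists>i\<in>A. \<exists>j\<in>A. x i \<noteq> x j)\<close> that j by blast
      then show ?thesis using assms[OF that j] by simp
    qed
    then show ?thesis by blast
  qed auto
next
  case True
  then obtain p q where pq: "p \<in> A" "q \<in> A" "x p \<noteq> x q" by blast
  have "(y q - y p) = x q - x p \<or> y q - y p = - (x q - x p)"
    using assms[OF pq(2,1)] by (simp add: power2_eq_iff) linarith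
  then obtain \<sigma> :: real where \<sigma>: "\<sigma> = 1 \<or> \<sigma> = -1" "y q - y p = \<sigma> * (x q - x p)"
    by force
  have "y i = \<sigma> * x i + (y p - \<sigma> * x p)" if i: "i \<in> A" for i
  proof -
    have ss: "\<sigma> * \<sigma> = 1" using \<sigma>(1) by auto
    define u v w where "u = x i - x p" "v = y i - y p" "w = x q - x p"
    have e1: "v\<^sup>2 = u\<^sup>2" using assms[OF i pq(1)] by (simp add: u_v_w_def)
    have "(y q - y i)\<^sup>2 = (x q - x i)\<^sup>2" using assms[OF i pq(2)] by (simp add: power2_commute)
    moreover have "y q - y i = \<sigma> * w - v" "x q - x i = w - u"
      using \<sigma>(2) by (simp_all add: u_v_w_def)
    ultimately have "(\<sigma> * w - v)\<^sup>2 = (w - u)\<^sup>2" by simp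
    then have "2 * w * (\<sigma> * v - u) = 0"
      using e1 ss by algebra
    then have "\<sigma> * v = u" using pq(3) by (simp add: u_v_w_def)
    then have "v = \<sigma> * u" using ss by (metis mult.assoc mult_1)
    then show ?thesis by (simp add: u_v_w_def algebra_simps)
  qed
  then show ?thesis using \<sigma>(1) by blast
qed

text \<open>In the strip, curvatures and imaginary parts are products with the half-planes
  \<open>a\<close>, \<open>b\<close>, hence equal. The remaining products determine the distances
  between the real parts of the centers, so the packings differ by a translation along the strip and
  possibly a reflection.\<close>

lemma mobius_equiv_of_lor_eq:
  assumes s: "lorentz_packing V E s" and t: "lorentz_packing V E t"
    and pos: "\<And>i. i \<in> V \<Longrightarrow> lk (s i) > 0" "\<And>i. i \<in> V \<Longrightarrow> lk (t i) > 0"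
    and eq: "\<And>i j. i \<in> V \<Longrightarrow> j \<in> V \<Longrightarrow> lor (s i) (s j) = lor (t i) (t j)"
    and ab: "{a, b} \<in> E"
  shows "mobius_equiv V s t"
proof -
  interpret s: lorentz_packing V E s by fact
  have V: "a \<in> V" "b \<in> V" "a \<noteq> b" using s.edgeD[OF ab] by auto
  obtain s' where s': "mobius_equiv V s s'" "\<And>i j. lor (s' i) (s' j) = lor (s i) (s j)"
    "s' a = (\<i>, 0, 1)" "s' b = (-\<i>, 0, 1)"
    using strip_normal_form[OF s ab] pos V by metis
  obtain t' where t': "mobius_equiv V t t'" "\<And>i j. lor (t' i) (t' j) = lor (t i) (t j)"
    "t' a = (\<i>, 0, 1)" "t' b = (-\<i>, 0, 1)"
    using strip_normal_form[OF t ab] pos V by metis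
  interpret S: strip_packing V E s' a b
    using lorentz_packing_cong[OF s, of s'] s' V by (auto simp: strip_packing_def strip_packing_axioms_def)
  interpret T: strip_packing V E t' a b
    using lorentz_packing_cong[OF t, of t'] t' V by (auto simp: strip_packing_def strip_packing_axioms_def)
  have eq': "lor (s' i) (s' j) = lor (t' i) (t' j)" if "i \<in> V" "j \<in> V" for i j
    using that eq s' t' by simp
  have k: "lk (s' i) = lk (t' i)" if "i \<in> V" for i
    using eq' that V by (simp add: S.lk_eq T.lk_eq)
  have im: "Im (lw (s' i)) = Im (lw (t' i))" if "i \<in> V" for i
    using eq'[OF that V(1)] k[OF that] by (simp add: s'(3) t'(3) lor_def)
  define A where "A = V - {a, b}"
  have kp: "lk (t' i) > 0" if "i \<in> A" for i using that T.lk_pos by (auto simp: A_def)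
  have lls: "ll (s' i) = ((Re (lw (s' i)))\<^sup>2 + (Im (lw (t' i)))\<^sup>2 - 1) / lk (t' i)"
    and llt: "ll (t' i) = ((Re (lw (t' i)))\<^sup>2 + (Im (lw (t' i)))\<^sup>2 - 1) / lk (t' i)" if "i \<in> A" for i
    using S.lor_self[of i] T.lor_self[of i] kp[OF that] that k[of i] im[of i]
    by (auto simp: lor_def A_def field_simps power2_eq_square)
  have "(Re (lw (s' i)) / lk (t' i) - Re (lw (s' j)) / lk (t' j))\<^sup>2 =
      (Re (lw (t' i)) / lk (t' i) - Re (lw (t' j)) / lk (t' j))\<^sup>2" if ij: "i \<in> A" "j \<in> A" for i j
  proof -
    have *: "(x / k - y / l)\<^sup>2 = (x\<^sup>2 + p\<^sup>2 - 1) / k / k + (y\<^sup>2 + q\<^sup>2 - 1) / l / l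
      - p\<^sup>2 / k\<^sup>2 - q\<^sup>2 / l\<^sup>2 + 1 / k\<^sup>2 + 1 / l\<^sup>2 - 2 * x * y / (k * l)"
      if "k > 0" "l > 0" for x y k l p q :: real
      using that by (simp add: field_simps power2_eq_square)
    have "Re (lw (s' i)) * Re (lw (s' j)) - (lk (t' i) * ll (s' j) + ll (s' i) * lk (t' j)) / 2 =
      Re (lw (t' i)) * Re (lw (t' j)) - (lk (t' i) * ll (t' j) + ll (t' i) * lk (t' j)) / 2"
      using eq'[of i j] ij k[of i] k[of j] im[of i] im[of j] by (simp add: lor_def A_def)
    then have **: "Re (lw (s' i)) * Re (lw (s' j)) * 2 - (lk (t' i) * ll (s' j) + ll (s' i) * lk (t' j)) =
      Re (lw (t' i)) * Re (lw (t' j)) * 2 - (lk (t' i) * ll (t' j) + ll (t' i) * lk (t' j))" by argo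
    show ?thesis
      using ** kp[OF ij(1)] kp[OF ij(2)]
      unfolding lls[OF ij(1)] lls[OF ij(2)] llt[OF ij(1)] llt[OF ij(2)]
      by (simp add: field_simps power2_eq_square)
  qed
  then obtain \<sigma> c where \<sigma>: "\<sigma> = 1 \<or> \<sigma> = -1"
    and c: "\<And>i. i \<in> A \<Longrightarrow> Re (lw (t' i)) / lk (t' i) = \<sigma> * (Re (lw (s' i)) / lk (t' i)) + c"
    using real_isometry[of A "\<lambda>i. Re (lw (s' i)) / lk (t' i)" "\<lambda>i. Re (lw (t' i)) / lk (t' i)"] by blast
  define r where "r = (if \<sigma> = 1 then (\<lambda>u. u) else lrefl)"
  have r: "mobius_equiv V s' (\<lambda>i. r (s' i))"
  proof (cases "\<sigma> = 1")
    case True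
    \<comment> \<open>Reflexivity, obtained by going to \<open>s\<close> and back.\<close>
    have "mobius_equiv V s' s'"
      by (rule mobius_equiv_trans[OF mobius_equiv_sym[OF s'(1)] s'(1)])
    then show ?thesis using True by (simp add: r_def)
  qed (simp add: r_def mobius_equiv_lrefl)
  have re: "Re (lw (r u)) = \<sigma> * Re (lw u)" "Im (lw (r u)) = Im (lw u)" "lk (r u) = lk u" "ll (r u) = ll u" for u
    using \<sigma> by (auto simp: r_def lrefl_def)
  have "ltrans (of_real c) (r (s' i)) = t' i" if i: "i \<in> V" for i
  proof (cases "i \<in> A")
    case False
    then have "i = a \<or> i = b" using i by (auto simp: A_def)
    then show ?thesis
      using s'(3,4) t'(3,4) by (auto simp: ltrans_def r_def lrefl_def)
  next
    case True
    have R: "Re (lw (t' i)) = \<sigma> * Re (lw (s' i)) + c * lk (t' i)"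
      using c[OF True] kp[OF True] by (simp add: field_simps)
    have ss: "\<sigma> * \<sigma> = 1" using \<sigma> by auto
    have "lw (ltrans (of_real c) (r (s' i))) = lw (t' i)"
      by (simp add: ltrans_def complex_eq_iff re R im[OF i] k[OF i])
    moreover have "ll (s' i) + 2 * (\<sigma> * Re (lw (s' i))) * c + lk (t' i) * (c * c) = ll (t' i)"
      unfolding lls[OF True] llt[OF True] R using kp[OF True] ss
      by (simp add: field_simps power2_eq_square)
    then have "ll (ltrans (of_real c) (r (s' i))) = ll (t' i)"
      by (simp add: ltrans_def re k[OF i] power2_eq_square)
    moreover have "lk (ltrans (of_real c) (r (s' i))) = lk (t' i)"
      by (simp add: ltrans_def re k[OF i])
    ultimately show ?thesis by (simp add: prod_eq_iff)
  qed
  moreover have "mobius_equiv V s' (\<lambda>i. ltrans (of_real c) (r (s' i)))"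
    by (rule mobius_equiv_trans[OF r mobius_equiv_ltrans])
  ultimately have "mobius_equiv V s' t'"
    unfolding mobius_equiv_def by simp
  then show ?thesis
    using mobius_equiv_trans mobius_equiv_sym s'(1) t'(1) by metis
qed

section \<open>The cyclic order of the neighbours\<close>

lemma connected_on_path:
  assumes "\<And>l. a \<le> l \<Longrightarrow> Suc l < b \<Longrightarrow> {f l, f (Suc l)} \<in> E"
  shows "connected_on E (f ` {a..<b})"
proof -
  let ?r = "{(x, y). x \<in> f ` {a..<b} \<and> y \<in> f ` {a..<b} \<and> {x, y} \<in> E}"
  have *: "(f a, f l) \<in> ?r\<^sup>*" if "a \<le> l" "l < b" for l
    using that
  proof (induction l rule: dec_induct)
    case (step l)
    then have "(f l, f (Suc l)) \<in> ?r" using assms by auto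
    moreover have "(f a, f l) \<in> ?r\<^sup>*" using step by simp
    ultimately show ?case by (rule rtrancl_into_rtrancl[rotated])
  qed simp
  have "sym ?r" by (auto simp: sym_def insert_commute)
  then have **: "(f l, f a) \<in> ?r\<^sup>*" if "a \<le> l" "l < b" for l
    using *[OF that] by (meson sym_rtrancl symD)
  show ?thesis unfolding connected_on_def
  proof (intro ballI)
    fix x y assume "x \<in> f ` {a..<b}" "y \<in> f ` {a..<b}"
    then obtain l m where "x = f l" "y = f m" "a \<le> l" "l < b" "a \<le> m" "m < b" by auto
    then show "(x, y) \<in> ?r\<^sup>*" using rtrancl_trans[OF **[of l] *[of m]] by simp
  qed
qed

text \<open>What the drawings have to deliver to the combinatorics: connectedness, and adjacency of
  two neighbours of \<open>i\<close> when the turn by \<phi> from \<open>j\<close> counterclockwise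
  to \<open>k\<close> passes no other neighbour. \<phi> may exceed \<open>pi\<close>.\<close>

locale rotation_packing = lorentz_packing +
  assumes lk_pos: "i \<in> V \<Longrightarrow> lk (s i) > 0"
    and connected: "connected_on E V"
    and successor_adjacent: "{i, j} \<in> E \<Longrightarrow> {i, k} \<in> E \<Longrightarrow> j \<noteq> k \<Longrightarrow> 0 < \<phi> \<Longrightarrow> \<phi> < 2 * pi \<Longrightarrow>
      tdir (s i) (s k) = tdir (s i) (s j) * cis \<phi> \<Longrightarrow>
      (\<And>m. {i, m} \<in> E \<Longrightarrow> m \<noteq> j \<Longrightarrow>
        \<exists>\<psi>. \<phi> \<le> \<psi> \<and> \<psi> < 2 * pi \<and> tdir (s i) (s m) = tdir (s i) (s j) * cis \<psi>) \<Longrightarrow> {j, k} \<in> E"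
begin

abbreviation nbrs :: "'a \<Rightarrow> 'a set" where "nbrs i \<equiv> {p. {i, p} \<in> E}"

abbreviation sdet :: "'a \<Rightarrow> 'a \<Rightarrow> 'a \<Rightarrow> 'a \<Rightarrow> real" where
  "sdet i j k m \<equiv> ldet (s i) (s j) (s k) (s m)"

text \<open>\<open>k\<close> is the successor and \<open>l\<close> the predecessor of
  \<open>j\<close> in the counterclockwise order around \<open>i\<close>; by
  \<open>ldet_tangent\<close> the signs express this order. Each neighbour is adjacent to its
  successor, so without \<open>j\<close> and \<open>k\<close>, or \<open>j\<close> and
  \<open>l\<close>, the neighbours form a path.\<close>

lemma rotation:
  assumes ij: "{i, j} \<in> E" and p: "{i, p} \<in> E" "p \<noteq> j"
  obtains k l where "{i, k} \<in> E" "{i, l} \<in> E" "{j, k} \<in> E" "{j, l} \<in> E"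
    "k = l \<Longrightarrow> nbrs i = {j, k}"
    "\<And>m. m \<in> nbrs i - {j, k} \<Longrightarrow> sdet i j k m > 0"
    "\<And>m. m \<in> nbrs i - {j, l} \<Longrightarrow> sdet i j l m < 0"
    "\<And>q. q \<in> nbrs i - {j, k, l} \<Longrightarrow> sdet i j q k < 0 \<and> sdet i j q l > 0"
    "connected_on E (nbrs i - {j, k})" "connected_on E (nbrs i - {j, l})"
proof -
  define e where "e p = tdir (s i) (s p)" for p
  have iV: "i \<in> V" using edgeD[OF ij] by simp
  have u: "lor (s i) (s i) = 1" "lk (s i) > 0" using iV lor_self lk_pos by auto
  have t: "lor (s p) (s p) = 1" "lk (s p) \<ge> 0" "lor (s i) (s p) = -1" if "{i, p} \<in> E" for p
    using edgeD[OF that] lor_self lk_pos[of p] lor_edge[OF that] by auto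
  have k: "lk (s p) + lk (s i) > 0" if "{i, p} \<in> E" for p
    using t(2)[OF that] u by simp
  have fin: "finite (nbrs i)"
    by (rule finite_subset[OF _ finite_V]) (use edgeD(2) in auto)
  have unit: "norm (e p) = 1" if "p \<in> nbrs i" for p
    unfolding e_def using tangent_lvec(3)[OF u] t that by simp
  have inj: "inj_on e (nbrs i)"
  proof (rule inj_onI, rule ccontr)
    fix p q assume pq: "p \<in> nbrs i" "q \<in> nbrs i" "e p = e q" "p \<noteq> q"
    then have "lor (s p) (s q) \<le> -1"
      using lor_le[of p q] edgeD(2)[of i p] edgeD(2)[of i q] by auto
    then have "2 * (lk (s i))\<^sup>2 * (1 - lor (s p) (s q)) / ((lk (s p) + lk (s i)) * (lk (s q) + lk (s i))) > 0"
      using u k pq by (intro divide_pos_pos mult_pos_pos) auto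
    then show False using norm_tdir_diff[OF u t t, of p q] pq by (auto simp: e_def)
  qed
  define n where "n = card (nbrs i)"
  have jN: "j \<in> nbrs i" using ij by simp
  obtain f \<psi> where f: "bij_betw f {..<n} (nbrs i)" "f 0 = j" "\<psi> 0 = (0::real)"
    "\<And>l. l < n \<Longrightarrow> 0 \<le> \<psi> l \<and> \<psi> l < 2 * pi \<and> e (f l) = e j * cis (\<psi> l)"
    "\<And>l m. l < m \<Longrightarrow> m < n \<Longrightarrow> \<psi> l < \<psi> m"
  proof (rule circle_enum[OF fin jN inj unit, folded n_def], goal_cases)
    case (2 f \<psi>)
    then show ?case by (intro that)
  qed
  have ej: "norm (e j) = 1" using unit ij by auto
  have inN: "{i, f l} \<in> E" if "l < n" for l using f(1) that by (auto simp: bij_betw_def)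
  have feq: "f l = f m \<longleftrightarrow> l = m" if "l < n" "m < n" for l m
    using f(1) that by (auto simp: bij_betw_def inj_on_def)
  have ex: "\<exists>l<n. q = f l" if "{i, q} \<in> E" for q
    using f(1) that unfolding bij_betw_def by (metis (mono_tags, lifting) imageE lessThan_iff mem_Collect_eq)
  have n2: "n \<ge> 2"
    using card_mono[OF fin, of "{j, p}"] ij p by (simp add: n_def)
  have pos: "sdet i (f x) (f y) (f z) > 0" if "x < y" "y < z" "z < n" for x y z
  proof -
    have "orient (e (f x)) (e (f y)) (e (f z)) > 0"
      using that f(4)[of x] f(4)[of y] f(4)[of z] f(5)[of x y] f(5)[of y z]
      by (auto intro!: orient_cis_pos[OF ej])
    moreover have N: "{i, f x} \<in> E" "{i, f y} \<in> E" "{i, f z} \<in> E" using that inN by auto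
    ultimately show ?thesis
      unfolding ldet_tangent[OF u t[OF N(1)] t[OF N(2)] t[OF N(3)]] e_def
      using k[OF N(1)] k[OF N(2)] k[OF N(3)] u(2) by (intro mult_pos_pos divide_pos_pos) auto
  qed
  have step: "{f x, f (Suc x)} \<in> E" if x: "Suc x < n" for x
  proof (rule successor_adjacent[of i "f x" "f (Suc x)" "\<psi> (Suc x) - \<psi> x"])
    have x': "x < n" using x by simp
    show "{i, f x} \<in> E" "{i, f (Suc x)} \<in> E" "f x \<noteq> f (Suc x)" using x inN feq by auto
    show "0 < \<psi> (Suc x) - \<psi> x" "\<psi> (Suc x) - \<psi> x < 2 * pi"
      using f(5)[of x "Suc x"] f(4)[OF x] f(4)[OF x'] x by auto
    have rel: "e (f y) = e (f x) * cis (\<psi> y - \<psi> x)" if "y < n" for y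
      using f(4)[OF that] f(4)[OF x'] by (simp add: cis_mult)
    show "tdir (s i) (s (f (Suc x))) = tdir (s i) (s (f x)) * cis (\<psi> (Suc x) - \<psi> x)"
      using rel[OF x] by (simp add: e_def)
    fix m assume m: "{i, m} \<in> E" "m \<noteq> f x"
    then obtain y where y: "y < n" "m = f y" using ex by blast
    show "\<exists>\<psi>'. \<psi> (Suc x) - \<psi> x \<le> \<psi>' \<and> \<psi>' < 2 * pi \<and> tdir (s i) (s m) = tdir (s i) (s (f x)) * cis \<psi>'"
    proof (cases "x < y")
      case True
      then have "\<psi> (Suc x) \<le> \<psi> y" using f(5)[of "Suc x" y] y by (cases "Suc x = y") auto
      then show ?thesis
        using rel[OF y(1)] y f(4)[OF y(1)] f(4)[OF x'] by (intro exI[of _ "\<psi> y - \<psi> x"]) (auto simp: e_def)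
    next
      case False
      then have "y < x" using m y by (cases "x = y") auto
      then have "\<psi> y < \<psi> x" using f(5) x' by auto
      \<comment> \<open>Neighbours listed before \<open>f x\<close> are met only after passing
        \<open>j\<close>, so their angle from \<open>f x\<close> needs a full turn added.\<close>
      moreover have "cis (\<psi> y - \<psi> x + 2 * pi) = cis (\<psi> y - \<psi> x)" by (simp flip: cis_mult)
      ultimately show ?thesis
        using rel[OF y(1)] y f(4)[OF y(1)] f(4)[OF x] by (intro exI[of _ "\<psi> y - \<psi> x + 2 * pi"]) (auto simp: e_def)
    qed
  qed
  \<comment> \<open>The index of the predecessor of \<open>j\<close>; for \<open>n = 2\<close> it is
    the successor as well.\<close>
  define L where "L = n - 1"
  have L: "L < n" "L \<ge> 1" using n2 by (auto simp: L_def)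
  have last: "{f L, j} \<in> E"
  proof (rule successor_adjacent[of i "f L" j "2 * pi - \<psi> L"])
    show "{i, f L} \<in> E" "{i, j} \<in> E" using inN L ij by auto
    show "f L \<noteq> j" using feq[of L 0] L f(2) by auto
    show "0 < 2 * pi - \<psi> L" "2 * pi - \<psi> L < 2 * pi"
      using f(4)[OF L(1)] f(5)[of 0 L] L f(3) by auto
    have rel: "e (f y) = e (f L) * cis (\<psi> y + 2 * pi - \<psi> L)" if "y < n" for y
      using f(4)[OF that] f(4)[OF L(1)] by (simp add: cis_mult) (simp flip: cis_mult)
    show "tdir (s i) (s j) = tdir (s i) (s (f L)) * cis (2 * pi - \<psi> L)"
      using rel[of 0] L f(2,3) by (simp add: e_def)
    fix m assume m: "{i, m} \<in> E" "m \<noteq> f L"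
    then obtain y where y: "y < n" "m = f y" using ex by blast
    then have "y < L" using m by (cases "y = L") (auto simp: L_def)
    then have "\<psi> y < \<psi> L" using f(5) L by auto
    then show "\<exists>\<psi>'. 2 * pi - \<psi> L \<le> \<psi>' \<and> \<psi>' < 2 * pi \<and> tdir (s i) (s m) = tdir (s i) (s (f L)) * cis \<psi>'"
      using rel[OF y(1)] y f(4)[OF y(1)] by (intro exI[of _ "\<psi> y + 2 * pi - \<psi> L"]) (auto simp: e_def)
  qed
  have neg: "sdet i (f x) (f y) (f z) < 0" if "x < z" "z < y" "y < n" for x y z
    using pos[OF that] ldet_swap34[of "s i" "s (f x)" "s (f y)" "s (f z)"] by simp
  have N: "nbrs i = f ` {..<n}" using f(1) by (simp add: bij_betw_def)
  show ?thesis
  proof (rule that[of "f 1" "f L"])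
    show "{i, f 1} \<in> E" "{i, f L} \<in> E" using inN L n2 by auto
    show "{j, f 1} \<in> E" using step[of 0] n2 f(2) by simp
    show "{j, f L} \<in> E" using last by (simp add: insert_commute)
    show "nbrs i = {j, f 1}" if "f 1 = f L"
    proof -
      have "L = 1" using that feq[of 1 L] L n2 by auto
      then have "{..<n} = {0, 1}" using n2 by (auto simp: L_def)
      then show ?thesis using N f(2) by simp
    qed
    have idx: "\<exists>x. 0 < x \<and> x < n \<and> m = f x" if "m \<in> nbrs i" "m \<noteq> j" for m
      using ex[of m] that f(2) by (metis gr0I mem_Collect_eq)
    show "sdet i j (f 1) m > 0" if "m \<in> nbrs i - {j, f 1}" for m
    proof -
      obtain x where "0 < x" "x < n" "m = f x" using idx \<open>m \<in> _\<close> by blast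
      then show ?thesis using pos[of 0 1 x] f(2) \<open>m \<in> _\<close> by (cases "x = 1") auto
    qed
    show "sdet i j (f L) m < 0" if "m \<in> nbrs i - {j, f L}" for m
    proof -
      obtain x where "0 < x" "x < n" "m = f x" using idx \<open>m \<in> _\<close> by blast
      then show ?thesis using neg[of 0 x L] f(2) \<open>m \<in> _\<close> L by (cases "x = L") (auto simp: L_def)
    qed
    show "sdet i j q (f 1) < 0 \<and> sdet i j q (f L) > 0" if "q \<in> nbrs i - {j, f 1, f L}" for q
    proof -
      obtain x where x: "0 < x" "x < n" "q = f x" using idx \<open>q \<in> _\<close> by blast
      then have "x \<noteq> 1" "x \<noteq> L" using \<open>q \<in> _\<close> by auto
      then show ?thesis using x pos[of 0 x L] neg[of 0 1 x] f(2) L by (auto simp: L_def)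
    qed
    have i1: "inj_on f {..<n}" using f(1) by (simp add: bij_betw_def)
    have "nbrs i - {j, f 1} = f ` ({..<n} - {0, 1})"
      unfolding N using inj_on_image_set_diff[OF i1, of "{..<n}" "{0, 1}"] n2 f(2) by auto
    also have "{..<n} - {0, 1} = {2..<n}" by auto
    finally show "connected_on E (nbrs i - {j, f 1})"
      using connected_on_path[of 2 n f E] step by simp
    have "nbrs i - {j, f L} = f ` ({..<n} - {0, L})"
      unfolding N using inj_on_image_set_diff[OF i1, of "{..<n}" "{0, L}"] n2 f(2) L by auto
    also have "{..<n} - {0, L} = {1..<L}" by (auto simp: L_def)
    finally show "connected_on E (nbrs i - {j, f L})"
      using connected_on_path[of 1 L f E] step L by simp
  qed
qed

text \<open>The side on which the other neighbours of \<open>i\<close> lie is left open, so no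
  orientation enters; this allows the notion to be symmetric in \<open>i\<close>, \<open>j\<close>
  and \<open>k\<close>.\<close>

definition consecutive :: "'a \<Rightarrow> 'a \<Rightarrow> 'a \<Rightarrow> bool" where
  "consecutive i j k \<longleftrightarrow> {i, j} \<in> E \<and> {i, k} \<in> E \<and> {j, k} \<in> E \<and>
     connected_on E (nbrs i - {j, k}) \<and>
     (\<forall>m\<in>nbrs i - {j, k}. \<forall>m'\<in>nbrs i - {j, k}. sdet i j k m * sdet i j k m' > 0)"

lemma consecutive_swap:
  assumes "consecutive i j k" shows "consecutive i k j"
proof -
  have "{k, j} = {j, k}" "nbrs i - {k, j} = nbrs i - {j, k}" by auto
  then show ?thesis
    using assms unfolding consecutive_def ldet_swap23[of "s i" "s k" "s j"] by simp
qed

text \<open>Successor and predecessor of \<open>j\<close> with the orientation forgotten; any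
  further neighbour \<open>q\<close> separates them.\<close>

lemma two_consecutive:
  assumes ij: "{i, j} \<in> E" and p: "{i, p} \<in> E" "p \<noteq> j"
  obtains k l where "consecutive i j k" "consecutive i j l" "k = l \<Longrightarrow> nbrs i = {j, k}"
    "\<And>q. q \<in> nbrs i - {j, k, l} \<Longrightarrow> sdet i j q k * sdet i j q l < 0"
proof -
  obtain k l where kl: "{i, k} \<in> E" "{i, l} \<in> E" "{j, k} \<in> E" "{j, l} \<in> E"
    "k = l \<Longrightarrow> nbrs i = {j, k}"
    "\<And>m. m \<in> nbrs i - {j, k} \<Longrightarrow> sdet i j k m > 0"
    "\<And>m. m \<in> nbrs i - {j, l} \<Longrightarrow> sdet i j l m < 0"
    "\<And>q. q \<in> nbrs i - {j, k, l} \<Longrightarrow> sdet i j q k < 0 \<and> sdet i j q l > 0"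
    "connected_on E (nbrs i - {j, k})" "connected_on E (nbrs i - {j, l})"
  proof (rule rotation[OF ij p], goal_cases)
    case (1 k l)
    then show ?case by (intro that)
  qed
  show ?thesis
  proof (rule that[of k l])
    show "consecutive i j k" "consecutive i j l"
      unfolding consecutive_def using kl(1-4,6,7,9,10) ij
      by (simp_all add: mult_neg_neg)
    show "nbrs i = {j, k}" if "k = l" using kl(5)[OF that] .
    show "sdet i j q k * sdet i j q l < 0" if "q \<in> nbrs i - {j, k, l}" for q
      using kl(8)[OF that] by (simp add: mult_neg_pos)
  qed
qed

text \<open>If the neighbours \<open>k'\<close>, \<open>l'\<close> of \<open>i\<close> in the cyclic order around \<open>j\<close> were both different from \<open>k\<close>,
  they would lie on different sides of the triangle \<open>i j k\<close>, although both are neighbours of \<open>i\<close>.\<close>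

lemma consecutive_rotate:
  assumes c: "consecutive i j k" shows "consecutive j i k"
proof -
  have E: "{j, i} \<in> E" "{j, k} \<in> E" "{i, k} \<in> E"
    using c by (auto simp: consecutive_def insert_commute)
  have "k \<noteq> i" using edgeD(3)[OF E(3)] by simp
  then obtain k' l' where kl: "consecutive j i k'" "consecutive j i l'"
    "\<And>q. q \<in> nbrs j - {i, k', l'} \<Longrightarrow> sdet j i q k' * sdet j i q l' < 0"
    using two_consecutive[OF E(1,2)] by metis
  have "k = k' \<or> k = l'"
  proof (rule ccontr)
    assume n: "\<not> (k = k' \<or> k = l')"
    then have "sdet j i k k' * sdet j i k l' < 0"
      using kl(3)[of k] E \<open>k \<noteq> i\<close> by auto
    then have "sdet i j k k' * sdet i j k l' < 0"
      using ldet_swap12[of "s i" "s j" "s k"] by simp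
    moreover have K: "{i, k'} \<in> E" "{i, l'} \<in> E" "{j, k'} \<in> E" "{j, l'} \<in> E"
      using kl(1,2) by (auto simp: consecutive_def)
    then have "k' \<in> nbrs i - {j, k}" "l' \<in> nbrs i - {j, k}"
      using n edgeD(3)[OF K(3)] edgeD(3)[OF K(4)] by auto
    then have "sdet i j k k' * sdet i j k l' > 0"
      using c unfolding consecutive_def by blast
    ultimately show False by simp
  qed
  then show ?thesis using kl by auto
qed

section \<open>From consecutive neighbours to facial triangles\<close>

lemma connected_closed:
  assumes "x \<in> A" "A \<subseteq> V" "\<And>y. y \<in> A \<Longrightarrow> nbrs y \<subseteq> A"
  shows "A = V"
proof -
  have "y \<in> A" if "y \<in> V" for y
    by (rule connected_on_invariant[OF connected, of x y "\<lambda>z. z \<in> A"]) (use assms that in auto)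
  then show ?thesis using assms(2) by auto
qed

lemma has_nbr: "i \<in> V \<Longrightarrow> card V \<ge> 2 \<Longrightarrow> \<exists>p. {i, p} \<in> E"
proof (rule ccontr)
  assume "i \<in> V" "card V \<ge> 2" "\<nexists>p. {i, p} \<in> E"
  then have "{i} = V" by (intro connected_closed[of i]) auto
  then have "card V = card {i}" by simp
  then show False using \<open>card V \<ge> 2\<close> by simp
qed

text \<open>A vertex with one or two neighbours would lie in a component with at most three
  vertices.\<close>

lemma three_neighbours:
  assumes V4: "card V \<ge> 4" and ij: "{i, j} \<in> E"
  obtains k l where "consecutive i j k" "consecutive i j l" "k \<noteq> l"
proof -
  note V = edgeD[OF ij]
  have card_le: "card A \<le> 3 \<Longrightarrow> A \<noteq> V" for A using V4 by auto
  have "\<exists>p. {i, p} \<in> E \<and> p \<noteq> j"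
  proof (rule ccontr)
    assume n: "\<not> ?thesis"
    show False
    proof (cases "\<exists>p. {j, p} \<in> E \<and> p \<noteq> i")
      case True
      then obtain k where "consecutive j i k"
        using two_consecutive[of j i] ij by (metis insert_commute)
      then have K: "{i, k} \<in> E" "{j, k} \<in> E" by (auto simp: consecutive_def)
      then show False using n edgeD(3)[OF K(2)] by auto
    next
      case False
      have "{i, j} = V"
        by (rule connected_closed[of i]) (use n False V in auto)
      then show False using card_le[of "{i, j}"] V by simp
    qed
  qed
  then obtain k l where kl: "consecutive i j k" "consecutive i j l" "k = l \<Longrightarrow> nbrs i = {j, k}"
    using two_consecutive[OF ij] by metis
  have "k \<noteq> l"
  proof
    assume "k = l"
    then have Ni: "nbrs i = {j, k}" using kl by simp
    have E: "{j, i} \<in> E" "{k, i} \<in> E" "{j, k} \<in> E" "{k, j} \<in> E"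
      using kl(1) by (auto simp: consecutive_def insert_commute)
    \<comment> \<open>The vertices next to \<open>i\<close> around \<open>x\<close> are adjacent to
      \<open>i\<close>, whose only neighbours are \<open>j\<close> and \<open>k\<close>; so both
      equal \<open>y\<close>, and \<open>x\<close> has no neighbours but \<open>i\<close> and
      \<open>y\<close>.\<close>
    have sub: "nbrs x \<subseteq> {i, y}" if x: "{x, i} \<in> E" "{x, y} \<in> E" "y \<noteq> i" "{x, y} = {j, k}" for x y
    proof -
      obtain k' l' where kl': "consecutive x i k'" "consecutive x i l'" "k' = l' \<Longrightarrow> nbrs x = {i, k'}"
        using two_consecutive[OF x(1-3)] by metis
      then have K: "{i, k'} \<in> E" "{i, l'} \<in> E" "{x, k'} \<in> E" "{x, l'} \<in> E"
        by (auto simp: consecutive_def)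
      then have "k' \<in> {j, k}" "l' \<in> {j, k}" using Ni by auto
      then have "k' = y" "l' = y" using edgeD(3)[OF K(3)] edgeD(3)[OF K(4)] x(4) by auto
      then show ?thesis using kl'(3) by simp
    qed
    have "nbrs j \<subseteq> {i, k}" "nbrs k \<subseteq> {i, j}"
      using sub[of j k] sub[of k j] E edgeD(3)[OF E(1)] edgeD(3)[OF E(2)] by auto
    then have "{i, j, k} = V"
      by (intro connected_closed[of i]) (use Ni V edgeD(1)[OF E(2)] in auto)
    then show False using card_le[of "{i, j, k}"] by (simp add: card_insert_if)
  qed
  then show ?thesis using kl that by blast
qed

text \<open>The other neighbours of each corner are connected among themselves, and the second
  triangle at an edge supplies a neighbour common to two corners. So everything adjacent to the
  triangle lies in one component \<open>R\<close> of the remainder, and connectedness of the graph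
  makes \<open>R\<close> the whole remainder.\<close>

lemma facial_of_consecutive:
  assumes V4: "card V \<ge> 4" and c: "consecutive i j k"
  shows "facial V E i j k"
proof -
  define U where "U = V - {i, j, k}"
  define r where "r = {(x, y). x \<in> U \<and> y \<in> U \<and> {x, y} \<in> E}"
  have E: "{i, j} \<in> E" "{i, k} \<in> E" "{j, k} \<in> E" using c by (auto simp: consecutive_def)
  note ne = edgeD(3)[OF E(1)] edgeD(3)[OF E(2)] edgeD(3)[OF E(3)]
  have nU: "nbrs i - {j, k} \<subseteq> U" "nbrs j - {i, k} \<subseteq> U" "nbrs k - {i, j} \<subseteq> U"
    using edgeD(2,3) unfolding U_def by blast+
  have cs: "connected_on E (nbrs i - {j, k})" "connected_on E (nbrs j - {i, k})" "connected_on E (nbrs k - {i, j})"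
    using c consecutive_rotate[OF c] consecutive_rotate[OF consecutive_swap[OF c]]
    by (auto simp: consecutive_def)
  \<comment> \<open>Of the two triangles at \<open>x y\<close>, at least one has a third vertex
    different from \<open>z\<close>.\<close>
  have common: "\<exists>m. m \<in> nbrs x \<inter> nbrs y - {x, y, z}" if xy: "{x, y} \<in> E" for x y z
  proof -
    obtain l l' where l: "consecutive x y l" "consecutive x y l'" "l \<noteq> l'"
      by (rule three_neighbours[OF V4 xy])
    then have L: "{x, l} \<in> E" "{y, l} \<in> E" "{x, l'} \<in> E" "{y, l'} \<in> E"
      by (auto simp: consecutive_def)
    then have "l \<in> nbrs x \<inter> nbrs y - {x, y}" "l' \<in> nbrs x \<inter> nbrs y - {x, y}"
      using edgeD(3)[OF L(1)] edgeD(3)[OF L(2)] edgeD(3)[OF L(3)] edgeD(3)[OF L(4)] by auto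
    then show ?thesis using l(3) by (cases "l = z") auto
  qed
  obtain m where m: "m \<in> nbrs i \<inter> nbrs j - {i, j, k}" using common[OF E(1), of k] by blast
  obtain m' where m': "m' \<in> nbrs i \<inter> nbrs k - {i, k, j}" using common[OF E(2), of j] by blast
  define R where "R = {x \<in> U. (m, x) \<in> r\<^sup>*}"
  have spread: "A \<subseteq> R" if A: "connected_on E A" "A \<subseteq> U" "x \<in> A" "x \<in> R" for A x
  proof
    fix y assume y: "y \<in> A"
    then have "(x, y) \<in> {(x, y). x \<in> A \<and> y \<in> A \<and> {x, y} \<in> E}\<^sup>*"
      using A by (auto simp: connected_on_def)
    moreover have "{(x, y). x \<in> A \<and> y \<in> A \<and> {x, y} \<in> E} \<subseteq> r"
      using A(2) by (auto simp: r_def)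
    ultimately have "(x, y) \<in> r\<^sup>*" using rtrancl_mono by blast
    then have "(m, y) \<in> r\<^sup>*" using A(4) unfolding R_def by (auto intro: rtrancl_trans)
    then show "y \<in> R" using y A(2) by (auto simp: R_def)
  qed
  have "m \<in> R" using m nU(1) by (auto simp: R_def)
  then have RR: "nbrs i - {j, k} \<subseteq> R" "nbrs j - {i, k} \<subseteq> R"
    using spread[OF cs(1) nU(1), of m] spread[OF cs(2) nU(2), of m] m by auto
  moreover have "m' \<in> R" using RR(1) m' by auto
  then have "nbrs k - {i, j} \<subseteq> R"
    using spread[OF cs(3) nU(3), of m'] m' by auto
  ultimately have close: "nbrs i - {j, k} \<subseteq> R" "nbrs j - {i, k} \<subseteq> R" "nbrs k - {i, j} \<subseteq> R" by auto
  have iR: "{i, j, k} \<union> R = V"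
  proof (rule connected_closed[of i])
    show "{i, j, k} \<union> R \<subseteq> V" using edgeD(1,2)[OF E(1)] edgeD(2)[OF E(2)] by (auto simp: R_def U_def)
    fix y assume y: "y \<in> {i, j, k} \<union> R"
    show "nbrs y \<subseteq> {i, j, k} \<union> R"
    proof (cases "y \<in> {i, j, k}")
      case False
      then have yR: "y \<in> U" "(m, y) \<in> r\<^sup>*" using y by (auto simp: R_def)
      show ?thesis
      proof
        fix z assume z: "z \<in> nbrs y"
        show "z \<in> {i, j, k} \<union> R"
        proof (cases "z \<in> {i, j, k}")
          case False
          then have "z \<in> U" using z edgeD(2)[of y z] by (auto simp: U_def)
          then have "(y, z) \<in> r" using yR z by (auto simp: r_def)
          then show ?thesis using yR \<open>z \<in> U\<close> by (auto simp: R_def intro: rtrancl_into_rtrancl)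
        qed auto
      qed
    qed (use close in auto)
  qed simp
  have "sym r" by (auto simp: r_def sym_def insert_commute)
  then have symr: "(x, y) \<in> r\<^sup>* \<Longrightarrow> (y, x) \<in> r\<^sup>*" for x y by (meson sym_rtrancl symD)
  have "(x, y) \<in> r\<^sup>*" if "x \<in> U" "y \<in> U" for x y
  proof -
    have "x \<in> R" "y \<in> R" using that iR by (auto simp: U_def)
    then show ?thesis using symr rtrancl_trans by (fastforce simp: R_def)
  qed
  then have "connected_on E U" by (auto simp: connected_on_def r_def)
  then show ?thesis using E by (auto simp: facial_def U_def)
qed

lemma edges_in_two_faces:
  assumes "card V \<ge> 4" shows "edges_in_two_faces V E"
  unfolding edges_in_two_faces_def
proof (intro allI impI)
  fix i j assume "{i, j} \<in> E"
  then obtain k l where "consecutive i j k" "consecutive i j l" "k \<noteq> l"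
    by (rule three_neighbours[OF assms])
  then show "\<exists>k l. k \<noteq> l \<and> facial V E i j k \<and> facial V E i j l"
    using facial_of_consecutive[OF assms] by blast
qed

text \<open>If \<open>i\<close> and \<open>j\<close> are not adjacent, both are adjacent to the
  third vertex \<open>p\<close>; but around \<open>p\<close> a neighbour consecutive to
  \<open>i\<close> can only be \<open>j\<close>.\<close>

lemma complete_if_small:
  assumes n: "card V \<le> 3" and ij: "i \<in> V" "j \<in> V" "i \<noteq> j"
  shows "{i, j} \<in> E"
proof (rule ccontr)
  assume no: "{i, j} \<notin> E"
  have "card {i, j} \<le> card V" using ij finite_V by (intro card_mono) auto
  then have V2: "card V \<ge> 2" using ij by simp
  obtain p q where p: "{i, p} \<in> E" and q: "{j, q} \<in> E"
    using has_nbr[OF ij(1) V2] has_nbr[OF ij(2) V2] by blast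
  note pD = edgeD[OF p] and qD = edgeD[OF q]
  have pj: "p \<noteq> j" "q \<noteq> i" using no p q by (auto simp: insert_commute)
  have "{i, j, p} = V"
    by (rule card_subset_eq[OF finite_V])
      (use ij pD pj n card_mono[OF finite_V, of "{i, j, p}"] in \<open>auto simp: card_insert_if\<close>)
  then have "q = p" using qD pj by auto
  then have "{p, i} \<in> E" "{p, j} \<in> E" using p q by (simp_all add: insert_commute)
  then obtain k where "consecutive p i k"
    using two_consecutive[of p i j] ij by metis
  then have K: "{i, k} \<in> E" "{p, k} \<in> E" by (auto simp: consecutive_def)
  then have "k = j" using edgeD(2)[OF K(1)] edgeD(3)[OF K(1)] edgeD(3)[OF K(2)] \<open>{i, j, p} = V\<close> by auto
  then show False using K no by simp
qed

end

section \<open>Drawings through the centers\<close>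

text \<open>Divided by \<open>p\<close>, \<open>q\<close>, \<open>t\<close>, the vectors have norm
  at most 1 and pairwise inner products at most -1, so their sum would have squared norm at most 3 -
  6. For disks: three with disjoint interiors have no common point.\<close>

lemma three_opposite_vectors:
  fixes a b d :: complex
  assumes "p > 0" "q > 0" "t > 0" "norm a \<le> p" "norm b \<le> q" "norm d \<le> t"
    and "dist a b \<ge> p + q" "dist a d \<ge> p + t" "dist b d \<ge> q + t"
  shows False
proof -
  have ip: "x \<bullet> y \<le> - (m * n)" if "m > 0" "n > 0" "norm x \<le> m" "norm y \<le> n" "dist x y \<ge> m + n" for x y :: complex and m n
  proof -
    have "(m + n)\<^sup>2 \<le> (dist x y)\<^sup>2" using that by (intro power_mono) auto
    also have "\<dots> = (norm x)\<^sup>2 + (norm y)\<^sup>2 - 2 * (x \<bullet> y)"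
      by (simp add: dist_norm power2_norm_eq_inner inner_diff inner_commute)
    also have "\<dots> \<le> m\<^sup>2 + n\<^sup>2 - 2 * (x \<bullet> y)"
      using power_mono[OF that(3) norm_ge_zero, of 2] power_mono[OF that(4) norm_ge_zero, of 2] by linarith
    finally show ?thesis by (simp add: power2_eq_square algebra_simps)
  qed
  define a' b' d' where "a' = a /\<^sub>R p" "b' = b /\<^sub>R q" "d' = d /\<^sub>R t"
  have sc: "(x /\<^sub>R m) \<bullet> (y /\<^sub>R n) \<le> -1" if "x \<bullet> y \<le> - (m * n)" "m > 0" "n > 0" for x y :: complex and m n
    using that by (simp add: field_simps)
  have nn: "(x /\<^sub>R m) \<bullet> (x /\<^sub>R m) \<le> 1" if "norm x \<le> m" "m > 0" for x :: complex and m
  proof -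
    have "norm (x /\<^sub>R m) \<le> 1" using that by (simp add: field_simps)
    from power_mono[OF this norm_ge_zero, of 2] show ?thesis by (simp only: power2_norm_eq_inner power_one)
  qed
  have "0 \<le> (a' + b' + d') \<bullet> (a' + b' + d')" by simp
  also have "\<dots> = a' \<bullet> a' + b' \<bullet> b' + d' \<bullet> d' + 2 * (a' \<bullet> b') + 2 * (a' \<bullet> d') + 2 * (b' \<bullet> d')"
    by (simp only: inner_add_left inner_add_right) (simp add: inner_commute)
  also have "\<dots> \<le> 1 + 1 + 1 + 2 * (-1) + 2 * (-1) + 2 * (-1)"
    unfolding a'_b'_d'_def using assms
    by (intro add_mono mult_left_mono sc ip nn) auto
  finally show False by simp
qed

locale disk_layout =
  fixes V :: "'v set" and E :: "'v set set" and c :: "'v \<Rightarrow> complex" and r :: "'v \<Rightarrow> real"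
  assumes simple: "simple_graph V E"
    and r_pos: "i \<in> V \<Longrightarrow> 0 < r i"
    and dist_ge: "i \<in> V \<Longrightarrow> j \<in> V \<Longrightarrow> i \<noteq> j \<Longrightarrow> r i + r j \<le> dist (c i) (c j)"
    and edge_iff: "i \<in> V \<Longrightarrow> j \<in> V \<Longrightarrow> i \<noteq> j \<Longrightarrow> {i, j} \<in> E \<longleftrightarrow> dist (c i) (c j) = r i + r j"
begin

lemmas edgeD = simple_graph_edgeD [OF simple]

lemma finite_V: "finite V"
  using simple by (simp add: simple_graph_def)

lemma dist_edge: "{i, j} \<in> E \<Longrightarrow> dist (c i) (c j) = r i + r j"
  using edge_iff[of i j] edgeD[of i j] by simp

lemma edge_exI: "e \<in> E \<Longrightarrow> \<exists>i j. e = {i, j}"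
  using simple unfolding simple_graph_def card_2_iff by blast

abbreviation seg :: "'v \<Rightarrow> 'v \<Rightarrow> complex set" where
  "seg i j \<equiv> closed_segment (c i) (c j)"

lemma no_triple_point:
  assumes V: "i \<in> V" "j \<in> V" "k \<in> V" and ne: "i \<noteq> j" "i \<noteq> k" "j \<noteq> k"
    and "dist z (c i) \<le> r i" "dist z (c j) \<le> r j" "dist z (c k) \<le> r k"
  shows False
  by (rule three_opposite_vectors[of "r i" "r j" "r k" "c i - z" "c j - z" "c k - z"])
    (use assms(7-9) r_pos[OF V(1)] r_pos[OF V(2)] r_pos[OF V(3)] dist_ge[OF V(1,2) ne(1)]
      dist_ge[OF V(1,3) ne(2)] dist_ge[OF V(2,3) ne(3)] in
      \<open>simp_all add: dist_norm norm_minus_commute\<close>)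

lemma dist_seg: "z \<in> closed_segment a b \<Longrightarrow> dist z a + dist z b = dist a b"
  for a b z :: complex
  using between_mem_segment[of a b z] between[of a b z] by (simp add: dist_commute)

lemma center_inj: "inj_on c V"
proof (rule inj_onI, rule ccontr)
  fix i j assume "i \<in> V" "j \<in> V" "c i = c j" "i \<noteq> j"
  then show False using dist_ge[of i j] r_pos[of i] r_pos[of j] by simp
qed

text \<open>Add the triangle inequalities from \<open>c k\<close> via \<open>z\<close> to
  \<open>c i\<close> and to \<open>c j\<close>: the distances from \<open>z\<close> to
  \<open>c i\<close> and \<open>c j\<close> sum to \<open>r i + r j\<close> and cancel.\<close>

lemma seg_outside:
  assumes e: "{i, j} \<in> E" and z: "z \<in> seg i j" and k: "k \<in> V" "k \<notin> {i, j}"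
  shows "dist z (c k) \<ge> r k" "dist z (c k) = r k \<Longrightarrow> dist z (c i) \<le> r i \<and> dist z (c j) \<le> r j"
proof -
  have d: "dist z (c i) + dist z (c j) = r i + r j"
    using dist_seg[OF z] dist_edge[OF e] by simp
  have "r i + r k \<le> dist z (c i) + dist z (c k)" "r j + r k \<le> dist z (c j) + dist z (c k)"
    using dist_ge[of i k] dist_ge[of j k] edgeD[OF e] k
      dist_triangle[of "c i" "c k" z] dist_triangle[of "c j" "c k" z] by (auto simp: dist_commute)
  then show "dist z (c k) \<ge> r k" "dist z (c k) = r k \<Longrightarrow> dist z (c i) \<le> r i \<and> dist z (c j) \<le> r j"
    using d by auto
qed

text \<open>Rays from 0 with another common point coincide, so the distance of \<open>x\<close> and
  \<open>y\<close> would be the difference of their norms.\<close>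

lemma same_ray_eq:
  fixes x y :: complex
  assumes "norm x = p" "norm y = q" "0 \<le> s" "0 \<le> t" "s *\<^sub>R x = t *\<^sub>R y" "s *\<^sub>R x \<noteq> 0"
    and "norm (x - y) > \<bar>p - q\<bar>"
  shows False
proof -
  have st: "s > 0" "t > 0" "x \<noteq> 0" "y \<noteq> 0" using assms(3-6) by (auto simp: less_le)
  have "s * p = t * q" using arg_cong[OF assms(5), of norm] assms(1-4) by simp
  have x: "x = (t / s) *\<^sub>R y"
    using assms(5) st by (metis (no_types) divide_inverse mult.commute order_less_irrefl scaleR_one scaleR_scaleR right_inverse)
  have "x - y = (t / s - 1) *\<^sub>R y" unfolding x by (simp add: scaleR_left_diff_distrib)
  then have "norm (x - y) = \<bar>(t / s - 1) * q\<bar>" using assms(2) by (simp add: abs_mult flip: assms(2))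
  also have "(t / s - 1) * q = p - q" using \<open>s * p = t * q\<close> st by (simp add: field_simps)
  finally show False using assms(7) by simp
qed

lemma seg_inter_share:
  assumes ij: "{i, j} \<in> E" and il: "{i, l} \<in> E" and "j \<noteq> l" and z: "z \<in> seg i j" "z \<in> seg i l"
  shows "z = c i"
proof (rule ccontr)
  assume n: "z \<noteq> c i"
  obtain s t where st: "0 \<le> s" "0 \<le> t" "z = (1 - s) *\<^sub>R c i + s *\<^sub>R c j" "z = (1 - t) *\<^sub>R c i + t *\<^sub>R c l"
    using z unfolding in_segment by blast
  note V = edgeD[OF ij] edgeD[OF il]
  show False
  proof (rule same_ray_eq)
    show "norm (c j - c i) = r i + r j" "norm (c l - c i) = r i + r l"
      using dist_edge[OF ij] dist_edge[OF il] by (simp_all add: dist_norm norm_minus_commute)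
    have "z - c i = s *\<^sub>R (c j - c i)" "z - c i = t *\<^sub>R (c l - c i)"
      by (subst st(3), simp add: algebra_simps) (subst st(4), simp add: algebra_simps)
    then show "s *\<^sub>R (c j - c i) = t *\<^sub>R (c l - c i)" "s *\<^sub>R (c j - c i) \<noteq> 0" using n by auto
    show "norm (c j - c i - (c l - c i)) > \<bar>r i + r j - (r i + r l)\<bar>"
      using dist_ge[of j l] V assms(3) r_pos[of j] r_pos[of l] by (auto simp: dist_norm)
  qed (use st in auto)
qed

text \<open>For disjoint edges, \<open>z\<close> would be the point of tangency of the disks
  \<open>k\<close> and \<open>l\<close> and also lie in the disk \<open>i\<close>, which is a triple
  point. Edges with a common endpoint are rays in different directions.\<close>

lemma seg_inter:
  assumes ij: "{i, j} \<in> E" and kl: "{k, l} \<in> E" and ne: "{i, j} \<noteq> {k, l}"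
    and z: "z \<in> seg i j" "z \<in> seg k l"
  shows "z \<in> c ` ({i, j} \<inter> {k, l})"
proof (cases "{i, j} \<inter> {k, l} = {}")
  case True
  note V = edgeD[OF ij] edgeD[OF kl]
  have d: "dist z (c k) + dist z (c l) = r k + r l"
    using dist_seg[OF z(2)] dist_edge[OF kl] by simp
  have "dist z (c k) \<ge> r k" "dist z (c l) \<ge> r l"
    using seg_outside(1)[OF ij z(1), of k] seg_outside(1)[OF ij z(1), of l] True V by auto
  then have "dist z (c k) = r k" "dist z (c l) = r l" using d by auto
  moreover then have "dist z (c i) \<le> r i"
    using seg_outside(2)[OF ij z(1), of k] True V by auto
  ultimately show ?thesis
    using no_triple_point[of i k l z] V True by auto
next
  case False
  have sym: "seg a b = seg b a" for a b by (rule closed_segment_commute)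
  consider "i = k" | "i = l" | "j = k" | "j = l" using False by auto
  then show ?thesis
  proof cases
    case 1 then show ?thesis using seg_inter_share[OF ij, of l z] assms by auto
  next
    case 2 then show ?thesis using seg_inter_share[OF ij, of k z] assms sym by (auto simp: insert_commute)
  next
    case 3 then show ?thesis using seg_inter_share[of j i l z] assms sym by (auto simp: insert_commute)
  next
    case 4 then show ?thesis using seg_inter_share[of j i k z] assms sym by (auto simp: insert_commute)
  qed
qed

lemma center_on_seg:
  assumes "{i, j} \<in> E" "k \<in> V" "c k \<in> seg i j" shows "k \<in> {i, j}"
  using seg_outside(1)[OF assms(1,3,2)] r_pos[OF assms(2)] by auto

text \<open>The segments between centers form a drawing of the graph; with \<open>g\<close> for the
  edge \<open>u v\<close> it would be a drawing of a larger planar graph.\<close>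

lemma add_edge_drawing:
  assumes max: "maximal_planar_graph V E" and uv: "u \<in> V" "v \<in> V" "u \<noteq> v"
    and g: "arc g" "pathstart g = c u" "pathfinish g = c v"
    and verts: "\<And>m. m \<in> V \<Longrightarrow> c m \<in> path_image g \<Longrightarrow> m \<in> {u, v}"
    and edges: "\<And>i j z. {i, j} \<in> E \<Longrightarrow> z \<in> path_image g \<Longrightarrow> z \<in> seg i j \<Longrightarrow> z \<in> {c u, c v}"
  shows "{u, v} \<in> E"
proof (rule ccontr)
  assume n: "{u, v} \<notin> E"
  have "\<forall>e\<in>E. \<exists>h. e = {fst h, snd h}" using edge_exI by force
  \<comment> \<open>\<open>h\<close> orders the endpoints of each edge, since
    \<open>linepath\<close> needs a start and an end.\<close>
  then obtain h where h: "\<forall>e\<in>E. e = {fst (h e), snd (h e)}" by (rule bchoice[THEN exE])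
  define \<gamma> where "\<gamma> e = (if e = {u, v} then g else linepath (c (fst (h e))) (c (snd (h e))))" for e
  have old: "\<exists>i j. \<gamma> e = linepath (c i) (c j) \<and> e = {i, j}" if "e \<in> E" for e
  proof (intro exI conjI)
    show "e = {fst (h e), snd (h e)}" using h that by blast
    have "e \<noteq> {u, v}" using n that by blast
    then show "\<gamma> e = linepath (c (fst (h e))) (c (snd (h e)))" by (simp add: \<gamma>_def)
  qed
  have new: "\<gamma> {u, v} = g" by (simp add: \<gamma>_def)
  have ends: "c u \<in> path_image g" "c v \<in> path_image g"
    using g pathstart_in_path_image[of g] pathfinish_in_path_image[of g] by simp_all
  have cross: "path_image g \<inter> seg i j = c ` ({u, v} \<inter> {i, j})" if e: "{i, j} \<in> E" for i j
  proof
    show "path_image g \<inter> seg i j \<subseteq> c ` ({u, v} \<inter> {i, j})"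
    proof
      fix z assume "z \<in> path_image g \<inter> seg i j"
      then have "z \<in> {c u, c v}" "z \<in> seg i j" using edges[OF e] by auto
      then obtain m where "m \<in> {u, v}" "z = c m" "c m \<in> seg i j" by auto
      then show "z \<in> c ` ({u, v} \<inter> {i, j})" using center_on_seg[OF e, of m] uv by auto
    qed
    show "c ` ({u, v} \<inter> {i, j}) \<subseteq> path_image g \<inter> seg i j" using ends by auto
  qed
  have "planar_drawing V (insert {u, v} E) c \<gamma>"
    unfolding planar_drawing_def
  proof (intro conjI ballI impI)
    show "inj_on c V" by (rule center_inj)
    fix e assume e: "e \<in> insert {u, v} E"
    show "arc (\<gamma> e)" "{pathstart (\<gamma> e), pathfinish (\<gamma> e)} = c ` e" "path_image (\<gamma> e) \<inter> c ` V = c ` e"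
    proof (atomize(full), cases "e = {u, v}")
      case True
      have "path_image g \<inter> c ` V = c ` {u, v}" using verts ends uv by auto
      then show "arc (\<gamma> e) \<and> {pathstart (\<gamma> e), pathfinish (\<gamma> e)} = c ` e \<and> path_image (\<gamma> e) \<inter> c ` V = c ` e"
        using True new g by simp
    next
      case False
      then obtain i j where ij: "\<gamma> e = linepath (c i) (c j)" "e = {i, j}" "{i, j} \<in> E" using old e by blast
      have "c i \<noteq> c j" using center_inj edgeD[OF ij(3)] by (auto dest: inj_onD)
      moreover have "seg i j \<inter> c ` V = c ` {i, j}"
        using center_on_seg[OF ij(3)] edgeD[OF ij(3)] by auto
      ultimately show "arc (\<gamma> e) \<and> {pathstart (\<gamma> e), pathfinish (\<gamma> e)} = c ` e \<and> path_image (\<gamma> e) \<inter> c ` V = c ` e"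
        using ij by simp
    qed
    fix e' assume e': "e' \<in> insert {u, v} E" and ne: "e \<noteq> e'"
    show "path_image (\<gamma> e) \<inter> path_image (\<gamma> e') = c ` (e \<inter> e')"
    proof (cases "e = {u, v}")
      case True
      then obtain i j where ij: "\<gamma> e' = linepath (c i) (c j)" "e' = {i, j}" "{i, j} \<in> E" using old e' ne by blast
      then show ?thesis using cross[OF ij(3)] True new by simp
    next
      case False
      then obtain i j where ij: "\<gamma> e = linepath (c i) (c j)" "e = {i, j}" "{i, j} \<in> E" using old e by blast
      show ?thesis
      proof (cases "e' = {u, v}")
        case True
        then show ?thesis using cross[OF ij(3)] ij new by (simp add: Int_commute)
      next
        case False
        then obtain k l where kl: "\<gamma> e' = linepath (c k) (c l)" "e' = {k, l}" "{k, l} \<in> E" using old e' by blast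
        have "seg i j \<inter> seg k l \<subseteq> c ` ({i, j} \<inter> {k, l})"
          using seg_inter[OF ij(3) kl(3)] ne ij kl by blast
        moreover have "c ` ({i, j} \<inter> {k, l}) \<subseteq> seg i j \<inter> seg k l" by auto
        ultimately show ?thesis using ij kl by simp
      qed
    qed
  qed
  moreover have "simple_graph V (insert {u, v} E)"
    using simple uv by (auto simp: simple_graph_def)
  ultimately have "planar_graph V (insert {u, v} E)" unfolding planar_graph_def by blast
  then show False using max uv n unfolding maximal_planar_graph_def by blast
qed

text \<open>Of all pairs of disks in different components take one with the smallest gap: the segment
  between the centers meets no other disk.\<close>

lemma connected_if_maximal:
  assumes max: "maximal_planar_graph V E" shows "connected_on E V"
proof (rule ccontr)
  assume "\<not> connected_on E V"
  define R where "R = {(x, y). x \<in> V \<and> y \<in> V \<and> {x, y} \<in> E}"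
  obtain a b where ab: "a \<in> V" "b \<in> V" "(a, b) \<notin> R\<^sup>*"
    using \<open>\<not> connected_on E V\<close> unfolding connected_on_def R_def by blast
  define U where "U = {x \<in> V. (a, x) \<in> R\<^sup>*}"
  define W where "W = V - U"
  have UW: "a \<in> U" "b \<in> W" "finite U" "finite W" "U \<subseteq> V" "W \<subseteq> V"
    using ab finite_V by (auto simp: U_def W_def)
  have closed: "x \<in> U \<longleftrightarrow> y \<in> U" if "{x, y} \<in> E" for x y
  proof -
    have "(x, y) \<in> R" "(y, x) \<in> R" using that edgeD[OF that] by (auto simp: R_def insert_commute)
    then show ?thesis using edgeD[OF that] unfolding U_def by (auto intro: rtrancl_into_rtrancl)
  qed
  define gap where "gap = (\<lambda>(x, y). dist (c x) (c y) - r x - r y)"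
  define G where "G = Min (gap ` (U \<times> W))"
  have G_le: "G \<le> gap (x, y)" if "x \<in> U" "y \<in> W" for x y
    using UW that by (simp add: G_def)
  have "G \<in> gap ` (U \<times> W)" unfolding G_def using UW by (intro Min_in) auto
  then obtain u w where uw: "u \<in> U" "w \<in> W" "gap (u, w) = G" by (auto simp: gap_def)
  have uwV: "u \<in> V" "w \<in> V" "u \<noteq> w" using uw UW by (auto simp: W_def)
  have noE: "{u, w} \<notin> E" using closed[of u w] uw by (auto simp: W_def)
  have duw: "dist (c u) (c w) = r u + r w + G" using uw(3) by (simp add: gap_def)
  have G0: "G > 0" using dist_ge[of u w] edge_iff[of u w] uwV noE duw by auto
  define far where "far x y \<longleftrightarrow> dist (c x) (c y) \<ge> r x + r y + G" for x y
  have farI: "far x y" "far y x" if "x \<in> U" "y \<in> W" for x y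
    using G_le[OF that] by (auto simp: far_def gap_def dist_commute)
  \<comment> \<open>The disk \<open>m\<close> has gap at least \<open>G\<close> to \<open>q\<close>,
    so \<open>z\<close> is at least \<open>r q + G\<close> away from \<open>c q\<close>. If
    \<open>m\<close> were neither \<open>p\<close> nor \<open>q\<close>, then \<open>z\<close> would
    be common to the disks \<open>m\<close>, \<open>p\<close> and the disk around \<open>c q\<close>
    enlarged by \<open>G\<close>, contradicting \<open>three_opposite_vectors\<close>.\<close>
  have only: "m = p" if pq: "p \<in> V" "q \<in> V" "dist (c p) (c q) = r p + r q + G" "p \<noteq> q"
      and m: "m \<in> V" "far m q" "dist z (c m) \<le> r m" and z: "z \<in> seg p q" for p q m z
  proof (rule ccontr)
    assume "m \<noteq> p"
    have d: "dist z (c p) + dist z (c q) = r p + r q + G" using dist_seg[OF z] pq by simp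
    have "dist (c m) (c q) \<le> dist z (c m) + dist z (c q)" by (metis dist_commute dist_triangle)
    then have zq: "dist z (c q) \<ge> r q + G" using m by (simp add: far_def)
    show False
    proof (cases "m = q")
      case True
      then show ?thesis using m G0 zq by (simp add: far_def)
    next
      case False
      have *: "dist (c m) (c p) \<ge> r m + r p" using dist_ge \<open>m \<noteq> p\<close> m pq by auto
      have "dist (c m) (c p) \<le> dist z (c m) + dist z (c p)" by (metis dist_commute dist_triangle)
      then have "dist z (c p) \<ge> r p" using * m by simp
      then have "dist z (c q) \<le> r q + G" "dist z (c p) \<le> r p" using d zq by auto
      then show ?thesis
        using three_opposite_vectors[of "r m" "r p" "r q + G" "c m - z" "c p - z" "c q - z"]
          m r_pos[of m] r_pos[of p] r_pos[of q] pq * G0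
        by (auto simp: dist_norm norm_minus_commute far_def)
    qed
  qed
  have side: "m \<in> {u, w}" if m: "m \<in> V" "dist z (c m) \<le> r m" and z: "z \<in> seg u w" for m z
  proof (cases "m \<in> U")
    case True
    then show ?thesis using only[of u w m z] uwV duw m z farI uw by auto
  next
    case False
    then have "m \<in> W" using m by (auto simp: W_def)
    then show ?thesis
      using only[of w u m z] uwV duw m z farI uw by (auto simp: dist_commute closed_segment_commute)
  qed
  \<comment> \<open>\<open>far j q\<close> makes \<open>c j\<close> and \<open>c q\<close> too
    distant for the segments from \<open>c p\<close> to have the same direction.\<close>
  have share: "z = c p" if p: "dist (c p) (c q) = r p + r q + G" "p \<in> V" "q \<in> V" "{p, j} \<in> E" "far j q"
    and z: "z \<in> seg p q" "z \<in> seg p j" for p q j z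
  proof (rule ccontr)
    assume n: "z \<noteq> c p"
    obtain s t where st: "0 \<le> s" "0 \<le> t" "z = (1 - s) *\<^sub>R c p + s *\<^sub>R c j" "z = (1 - t) *\<^sub>R c p + t *\<^sub>R c q"
      using z unfolding in_segment by blast
    show False
    proof (rule same_ray_eq)
      show "norm (c j - c p) = r p + r j" "norm (c q - c p) = r p + r q + G"
        using dist_edge[OF p(4)] p(1) by (simp_all add: dist_norm norm_minus_commute)
      have "z - c p = s *\<^sub>R (c j - c p)" "z - c p = t *\<^sub>R (c q - c p)"
        by (subst st(3), simp add: algebra_simps) (subst st(4), simp add: algebra_simps)
      then show "s *\<^sub>R (c j - c p) = t *\<^sub>R (c q - c p)" "s *\<^sub>R (c j - c p) \<noteq> 0" using n by auto
      show "norm (c j - c p - (c q - c p)) > \<bar>r p + r j - (r p + r q + G)\<bar>"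
        using p(5) edgeD[OF p(4)] p(3) r_pos[of j] r_pos[of q] G0 by (auto simp: dist_norm far_def)
    qed (use st in auto)
  qed
  have "{u, w} \<in> E"
  proof (rule add_edge_drawing[OF max uwV, of "linepath (c u) (c w)"])
    show "arc (linepath (c u) (c w))"
      by (rule arc_linepath) (use inj_onD[OF center_inj, of u w] uwV in auto)
    show "m \<in> {u, w}" if "m \<in> V" "c m \<in> path_image (linepath (c u) (c w))" for m
      using side[of m "c m"] that r_pos[of m] by auto
    fix i j z assume e: "{i, j} \<in> E" and zg: "z \<in> path_image (linepath (c u) (c w))" and z: "z \<in> seg i j"
    have zs: "z \<in> seg u w" using zg by simp
    note V = edgeD[OF e]
    have "dist z (c i) \<le> r i \<or> dist z (c j) \<le> r j"
      using dist_seg[OF z] dist_edge[OF e] by auto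
    then have "i \<in> {u, w} \<or> j \<in> {u, w}" using side[of i z] side[of j z] V zs by auto
    moreover have end_in: "z \<in> {c u, c w}" if pj: "{p, j} \<in> E" "p \<in> {u, w}" "z \<in> seg p j" for p j
    proof (cases "p = u")
      case True
      then have "j \<in> U" using closed[OF pj(1)] uw by auto
      then show ?thesis using share[of u w j z] duw uwV pj zs farI uw True by auto
    next
      case False
      then have pw: "p = w" using pj by simp
      then have "j \<in> W" using closed[OF pj(1)] uw edgeD[OF pj(1)] by (auto simp: W_def)
      then show ?thesis
        using share[of w u j z] duw uwV pj zs farI uw pw by (auto simp: dist_commute closed_segment_commute)
    qed
    moreover have "{j, i} \<in> E" "z \<in> seg j i"
      using e z closed_segment_commute[of "c i" "c j"] by (simp_all add: insert_commute)
    ultimately show "z \<in> {c u, c w}"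
      using end_in[OF e _ z] end_in[of j i] by blast
  qed auto
  then show False using noE by simp
qed

end

text \<open>The left side lies in the sector between the directions 0 and \<phi>/2, which the ray at
  \<psi> meets only in 0. The identity \<open>rot\<close> is the component orthogonal to the
  direction \<phi>/2 and settles \<psi> below \<open>pi\<close>; otherwise the imaginary part
  does.\<close>

lemma cone_trivial:
  assumes \<phi>: "0 < \<phi>" "\<phi> < 2 * pi" and \<psi>: "\<phi> \<le> \<psi>" "\<psi> < 2 * pi" and "0 \<le> A" "0 \<le> B" "0 \<le> M"
    and eq: "of_real A + of_real B * cis (\<phi> / 2) = of_real M * cis \<psi>"
  shows "A = 0 \<and> B = 0"
proof -
  have s: "sin (\<phi> / 2) > 0" using \<phi> by (intro sin_gt_zero) auto
  have re: "A + B * cos (\<phi> / 2) = M * cos \<psi>" and im: "B * sin (\<phi> / 2) = M * sin \<psi>"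
    using arg_cong[OF eq, of Re] arg_cong[OF eq, of Im] by simp_all
  have rot: "A * sin (\<phi> / 2) + M * sin (\<psi> - \<phi> / 2) = 0"
  proof -
    have "A * sin (\<phi> / 2) = (M * cos \<psi> - B * cos (\<phi> / 2)) * sin (\<phi> / 2)" using re by simp
    also have "\<dots> = M * cos \<psi> * sin (\<phi> / 2) - cos (\<phi> / 2) * (B * sin (\<phi> / 2))" by (simp add: algebra_simps)
    finally show ?thesis unfolding im sin_diff by (simp add: algebra_simps)
  qed
  show ?thesis
  proof (cases "\<psi> < pi")
    case True
    then have "sin (\<psi> - \<phi> / 2) > 0" using \<phi> \<psi> by (intro sin_gt_zero) auto
    then have "A * sin (\<phi> / 2) = 0" "M * sin (\<psi> - \<phi> / 2) = 0"
      using rot s assms by (smt (verit) mult_nonneg_nonneg)+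
    then have "A = 0" "M = 0" using s \<open>sin (\<psi> - \<phi> / 2) > 0\<close> by auto
    then show ?thesis using im s by simp
  next
    case False
    then have "sin \<psi> \<le> 0" using \<psi> sin_le_zero by auto
    then have "M * sin \<psi> \<le> 0" using assms by (simp add: mult_nonneg_nonpos)
    moreover have "B * sin (\<phi> / 2) \<ge> 0" using assms s by simp
    ultimately have B: "B = 0" and "M * sin \<psi> = 0" using im s by auto
    then consider "M = 0" | "sin \<psi> = 0" by auto
    then show ?thesis
    proof cases
      case 1 then show ?thesis using re B by simp
    next
      case 2
      have "\<psi> = pi"
      proof (rule ccontr)
        assume "\<psi> \<noteq> pi"
        then have "sin \<psi> < 0" using False \<psi> sin_lt_zero by auto
        then show False using 2 by simp
      qed
      then show ?thesis using re B assms by simp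
    qed
  qed
qed

text \<open>A compact segment has positive distance from \<open>K\<close>, and moving one endpoint
  by \<open>\<epsilon> *\<^sub>R d\<close> moves no point by more than
  \<open>\<epsilon> * norm d\<close>.\<close>

lemma eventually_segment_avoids:
  fixes a b d :: complex
  assumes "closed K" "closed_segment a b \<inter> K = {}"
  shows "\<forall>\<^sub>F \<epsilon> in at_right 0. closed_segment a (b + \<epsilon> *\<^sub>R d) \<inter> K = {}"
proof -
  obtain \<delta> where \<delta>: "\<delta> > 0" "\<And>p q. p \<in> closed_segment a b \<Longrightarrow> q \<in> K \<Longrightarrow> \<delta> \<le> dist p q"
    using separate_compact_closed[OF compact_segment[of a b] assms] by blast
  have "\<forall>\<^sub>F \<epsilon> in at_right (0::real). \<epsilon> < \<delta> / (norm d + 1)"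
    using \<delta>(1) by (intro eventually_at_rightI[of 0 "\<delta> / (norm d + 1)"]) (auto simp: add_nonneg_pos)
  then show ?thesis
    using eventually_at_right_less[of "0::real"]
  proof eventually_elim
    case (elim \<epsilon>)
    have "norm d + 1 > 0" by (simp add: add_nonneg_pos)
    then have small: "\<epsilon> * norm d < \<delta>"
      using elim \<delta>(1) by (simp add: pos_less_divide_eq algebra_simps)
    show ?case
    proof (rule ccontr)
      assume "closed_segment a (b + \<epsilon> *\<^sub>R d) \<inter> K \<noteq> {}"
      then obtain s where s: "0 \<le> s" "s \<le> 1" "(1 - s) *\<^sub>R a + s *\<^sub>R (b + \<epsilon> *\<^sub>R d) \<in> K"
        by (auto simp: in_segment)
      have "(1 - s) *\<^sub>R a + s *\<^sub>R b \<in> closed_segment a b" using s by (auto simp: in_segment)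
      then have "\<delta> \<le> dist ((1 - s) *\<^sub>R a + s *\<^sub>R b) ((1 - s) *\<^sub>R a + s *\<^sub>R (b + \<epsilon> *\<^sub>R d))"
        using \<delta>(2) s(3) by blast
      also have "\<dots> = s * (\<epsilon> * norm d)"
        using s elim by (simp add: dist_norm algebra_simps)
      also have "\<dots> \<le> 1 * (\<epsilon> * norm d)" using s elim by (intro mult_right_mono) auto
      finally show False using small by simp
    qed
  qed
qed

section \<open>An edge between consecutive neighbours\<close>

context disk_layout
begin

definition dir :: "'v \<Rightarrow> 'v \<Rightarrow> complex" where
  "dir i j = (c j - c i) /\<^sub>R (r i + r j)"

lemma norm_dir: "{i, j} \<in> E \<Longrightarrow> norm (dir i j) = 1"
  and dir_eq: "{i, j} \<in> E \<Longrightarrow> c j - c i = (r i + r j) *\<^sub>R dir i j"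
proof -
  assume e: "{i, j} \<in> E"
  have p: "r i + r j > 0" using r_pos edgeD[OF e] by (simp add: add_pos_pos)
  then show "norm (dir i j) = 1" "c j - c i = (r i + r j) *\<^sub>R dir i j"
    using dist_edge[OF e] by (simp_all add: dir_def dist_norm norm_minus_commute)
qed

lemma dir_inj:
  assumes "{i, j} \<in> E" "{i, k} \<in> E" "dir i j = dir i k" shows "j = k"
proof (rule ccontr)
  assume "j \<noteq> k"
  note V = edgeD[OF assms(1)] edgeD[OF assms(2)]
  have "c j - c k = (r j - r k) *\<^sub>R dir i k"
    using dir_eq[OF assms(1)] dir_eq[OF assms(2)] unfolding assms(3) by (simp add: algebra_simps)
  then have "dist (c j) (c k) = \<bar>r j - r k\<bar>"
    using norm_dir[OF assms(2)] by (simp add: dist_norm)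
  then show False using dist_ge[of j k] V \<open>j \<noteq> k\<close> r_pos[of j] r_pos[of k] by auto
qed

text \<open>Half of the new edge. Edges and centers away from \<open>i\<close> and \<open>j\<close>
  keep a positive distance, and the other edges at \<open>j\<close> a positive angle, for small
  \<epsilon>. Edges at \<open>i\<close> are excluded for every positive \<epsilon>, by
  \<open>other\<close> and, for \<open>i j\<close> itself, by \<open>same\<close>.\<close>

lemma eventually_segment_clear:
  assumes ij: "{i, j} \<in> E" and ik: "{i, k} \<in> E" "j \<noteq> k"
    and other: "\<And>m A B M. {i, m} \<in> E \<Longrightarrow> m \<noteq> j \<Longrightarrow> 0 \<le> A \<Longrightarrow> 0 \<le> B \<Longrightarrow> 0 \<le> M \<Longrightarrow>
      A *\<^sub>R dir i j + B *\<^sub>R d = M *\<^sub>R dir i m \<Longrightarrow> A = 0 \<and> B = 0"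
    and same: "\<And>A B M. A *\<^sub>R dir i j + B *\<^sub>R d = M *\<^sub>R dir i j \<Longrightarrow> B = 0"
  shows "\<forall>\<^sub>F \<epsilon> in at_right 0. \<forall>z\<in>closed_segment (c j) (c i + \<epsilon> *\<^sub>R d).
     (\<forall>a b. {a, b} \<in> E \<longrightarrow> z \<in> seg a b \<longrightarrow> z = c j) \<and> (\<forall>m\<in>V. z = c m \<longrightarrow> m = j)"
proof -
  note V = edgeD[OF ij]
  have ji: "{j, i} \<in> E" using ij by (simp add: insert_commute)
  have pos: "r i + r m > 0" if "{i, m} \<in> E" for m
    using r_pos edgeD[OF that] by (simp add: add_pos_pos)
  let ?S = "\<lambda>\<epsilon>. closed_segment (c j) (c i + \<epsilon> *\<^sub>R d)"
  define P where "P = {(a, b) \<in> V \<times> V. {a, b} \<in> E \<and> {a, b} \<inter> {i, j} = {}}"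
  have "\<forall>\<^sub>F \<epsilon> in at_right 0. \<forall>p\<in>P. ?S \<epsilon> \<inter> seg (fst p) (snd p) = {}"
  proof (intro eventually_ball_finite ballI)
    show "finite P" unfolding P_def by (rule finite_subset[of _ "V \<times> V"]) (use finite_V in auto)
    fix p assume p: "p \<in> P"
    show "\<forall>\<^sub>F \<epsilon> in at_right 0. ?S \<epsilon> \<inter> seg (fst p) (snd p) = {}"
    proof (rule eventually_segment_avoids)
      have ab: "{fst p, snd p} \<in> E" "{fst p, snd p} \<inter> {j, i} = {}" using p by (auto simp: P_def)
      then have "{fst p, snd p} \<noteq> {j, i}" by auto
      then show "seg j i \<inter> seg (fst p) (snd p) = {}"
        using seg_inter[OF ji ab(1)] ab(2) by (auto simp: Int_commute)
    qed simp
  qed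
  moreover have "\<forall>\<^sub>F \<epsilon> in at_right 0. \<forall>m\<in>V - {i, j}. ?S \<epsilon> \<inter> {c m} = {}"
  proof (intro eventually_ball_finite ballI)
    fix m assume m: "m \<in> V - {i, j}"
    show "\<forall>\<^sub>F \<epsilon> in at_right 0. ?S \<epsilon> \<inter> {c m} = {}"
      by (rule eventually_segment_avoids) (use center_on_seg[OF ji, of m] m in auto)
  qed (use finite_V in simp)
  \<comment> \<open>Strict Cauchy-Schwarz: the edge \<open>j m\<close> and the new segment point in
    different directions. This is an open condition that holds at \<epsilon> = 0.\<close>
  moreover have "\<forall>\<^sub>F \<epsilon> in at_right 0. \<forall>m\<in>{m \<in> V. {j, m} \<in> E \<and> m \<noteq> i}.
     norm (c i + \<epsilon> *\<^sub>R d - c j) * norm (c m - c j) - (c i + \<epsilon> *\<^sub>R d - c j) \<bullet> (c m - c j) > 0"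
  proof (intro eventually_ball_finite ballI)
    fix m assume m: "m \<in> {m \<in> V. {j, m} \<in> E \<and> m \<noteq> i}"
    let ?h = "\<lambda>\<epsilon>. norm (c i + \<epsilon> *\<^sub>R d - c j) * norm (c m - c j) - (c i + \<epsilon> *\<^sub>R d - c j) \<bullet> (c m - c j)"
    have jm: "{j, m} \<in> E" using m by simp
    have "norm (c i - c j) *\<^sub>R (c m - c j) \<noteq> norm (c m - c j) *\<^sub>R (c i - c j)"
    proof
      assume "norm (c i - c j) *\<^sub>R (c m - c j) = norm (c m - c j) *\<^sub>R (c i - c j)"
      then have "((r j + r i) * (r j + r m)) *\<^sub>R dir j m = ((r j + r m) * (r j + r i)) *\<^sub>R dir j i"
        using norm_dir[OF ji] norm_dir[OF jm] r_pos[of i] r_pos[of j] r_pos[of m] V m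
        by (simp add: dir_eq[OF ji] dir_eq[OF jm])
      moreover have "(r j + r i) * (r j + r m) > 0"
        using r_pos[of i] r_pos[of j] r_pos[of m] V m by (simp add: add_pos_pos)
      moreover have "(r j + r m) * (r j + r i) = (r j + r i) * (r j + r m)" by simp
      ultimately have "dir j m = dir j i"
        by (metis order_less_irrefl scaleR_left_imp_eq)
      then show False using dir_inj[OF jm ji] m by simp
    qed
    then have "(c i - c j) \<bullet> (c m - c j) \<noteq> norm (c i - c j) * norm (c m - c j)"
      using norm_cauchy_schwarz_eq[of "c i - c j" "c m - c j"] by auto
    then have "?h 0 > 0" using norm_cauchy_schwarz[of "c i - c j" "c m - c j"] by simp
    moreover have "isCont ?h 0" by (intro continuous_intros)
    then have "(?h \<longlongrightarrow> ?h 0) (at_right 0)"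
      by (simp add: isCont_def filterlim_at_split)
    ultimately show "\<forall>\<^sub>F \<epsilon> in at_right 0. ?h \<epsilon> > 0" by (rule order_tendstoD(1)[rotated])
  qed (use finite_V in simp)
  ultimately show ?thesis
    using eventually_at_right_less[of "0::real"]
  proof eventually_elim
    case (elim \<epsilon>)
    have cone: "\<exists>s. 0 \<le> s \<and> s \<le> 1 \<and> z = (1 - s) *\<^sub>R c j + s *\<^sub>R (c i + \<epsilon> *\<^sub>R d) \<and>
        z - c i = ((1 - s) * (r i + r j)) *\<^sub>R dir i j + (s * \<epsilon>) *\<^sub>R d" if z: "z \<in> ?S \<epsilon>" for z
    proof -
      obtain s where s: "0 \<le> s" "s \<le> 1" "z = (1 - s) *\<^sub>R c j + s *\<^sub>R (c i + \<epsilon> *\<^sub>R d)"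
        using z unfolding in_segment by blast
      have "z - c i = (1 - s) *\<^sub>R (c j - c i) + (s * \<epsilon>) *\<^sub>R d"
        unfolding s(3) by (simp add: algebra_simps)
      then show ?thesis using s by (auto simp: dir_eq[OF ij])
    qed
    have no_i: False if z: "z \<in> ?S \<epsilon>" "z \<in> seg i m" "{i, m} \<in> E" "m \<noteq> j" for z m
    proof -
      obtain s where s: "0 \<le> s" "s \<le> 1" "z - c i = ((1 - s) * (r i + r j)) *\<^sub>R dir i j + (s * \<epsilon>) *\<^sub>R d"
        using cone[OF z(1)] by blast
      obtain t where t: "0 \<le> t" "z = (1 - t) *\<^sub>R c i + t *\<^sub>R c m" using z(2) unfolding in_segment by blast
      have "z - c i = t *\<^sub>R (c m - c i)" unfolding t(2) by (simp add: algebra_simps)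
      then have eq: "((1 - s) * (r i + r j)) *\<^sub>R dir i j + (s * \<epsilon>) *\<^sub>R d = (t * (r i + r m)) *\<^sub>R dir i m"
        using s(3) by (simp add: dir_eq[OF z(3)])
      have "(1 - s) * (r i + r j) = 0 \<and> s * \<epsilon> = 0"
        by (rule other[OF z(3,4) _ _ _ eq]) (use s t pos[OF ij] pos[OF z(3)] elim in auto)
      then show False using pos[OF ij] elim by auto
    qed
    have on_ij: "z = c j" if z: "z \<in> ?S \<epsilon>" "z \<in> seg i j" for z
    proof -
      obtain s where s: "z = (1 - s) *\<^sub>R c j + s *\<^sub>R (c i + \<epsilon> *\<^sub>R d)"
        "z - c i = ((1 - s) * (r i + r j)) *\<^sub>R dir i j + (s * \<epsilon>) *\<^sub>R d"
        using cone[OF z(1)] by blast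
      obtain t where t: "z = (1 - t) *\<^sub>R c i + t *\<^sub>R c j" using z(2) unfolding in_segment by blast
      have "z - c i = t *\<^sub>R (c j - c i)" unfolding t by (simp add: algebra_simps)
      then have "((1 - s) * (r i + r j)) *\<^sub>R dir i j + (s * \<epsilon>) *\<^sub>R d = (t * (r i + r j)) *\<^sub>R dir i j"
        using s(2) by (simp add: dir_eq[OF ij])
      then have "s * \<epsilon> = 0" by (rule same)
      then show ?thesis using s(1) elim by simp
    qed
    have on_jm: "z = c j" if z: "z \<in> ?S \<epsilon>" "z \<in> seg j m" and m: "{j, m} \<in> E" "m \<noteq> i" for z m
    proof (rule ccontr)
      assume n: "z \<noteq> c j"
      obtain s where s: "0 \<le> s" "z = (1 - s) *\<^sub>R c j + s *\<^sub>R (c i + \<epsilon> *\<^sub>R d)"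
        using cone[OF z(1)] by blast
      obtain t where t: "0 \<le> t" "z = (1 - t) *\<^sub>R c j + t *\<^sub>R c m" using z(2) unfolding in_segment by blast
      define x y where "x = c i + \<epsilon> *\<^sub>R d - c j" "y = c m - c j"
      have "z - c j = s *\<^sub>R x" unfolding s(2) x_y_def by (simp add: algebra_simps)
      moreover have "z - c j = t *\<^sub>R y" unfolding t(2) x_y_def by (simp add: algebra_simps)
      ultimately have st: "s *\<^sub>R x = t *\<^sub>R y" "s > 0" "t > 0" using n s t by (auto simp: less_le)
      have "(s * t) * (x \<bullet> y) = (s *\<^sub>R x) \<bullet> (t *\<^sub>R y)" by simp
      also have "\<dots> = norm (s *\<^sub>R x) * norm (t *\<^sub>R y)"
        unfolding st(1) by (simp only: power2_norm_eq_inner[symmetric] power2_eq_square)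
      also have "\<dots> = (s * t) * (norm x * norm y)" using st(2,3) by simp
      finally have "norm x * norm y - x \<bullet> y = 0" using st by simp
      moreover have "norm x * norm y - x \<bullet> y > 0"
        using elim m edgeD[OF m(1)] by (auto simp: x_y_def)
      ultimately show False by simp
    qed
    show ?case
    proof (intro ballI conjI allI impI)
      fix z assume z: "z \<in> ?S \<epsilon>"
      fix a b assume ab: "{a, b} \<in> E" "z \<in> seg a b"
      have half: "z = c j" if "{p, q} \<in> E" "z \<in> seg p q" "p \<in> {i, j}" for p q
      proof (cases "p = i")
        case True
        then show ?thesis using no_i[OF z, of q] on_ij[OF z] that by (cases "q = j") auto
      next
        case False
        then have p: "p = j" using that by simp
        show ?thesis
        proof (cases "q = i")
          case True
          then show ?thesis using on_ij[OF z] that p closed_segment_commute[of "c i" "c j"] by simp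
        next
          case False
          then show ?thesis using on_jm[OF z, of q] that p by simp
        qed
      qed
      show "z = c j"
      proof (cases "{a, b} \<inter> {i, j} = {}")
        case True
        then have "(a, b) \<in> P" using ab edgeD[OF ab(1)] by (simp add: P_def)
        then show ?thesis using elim z ab by fastforce
      next
        case False
        moreover have "{b, a} \<in> E" "z \<in> seg b a"
          using ab closed_segment_commute[of "c a" "c b"] by (simp_all add: insert_commute)
        ultimately show ?thesis using half[OF ab] half[of b a] by blast
      qed
    next
      fix z m assume z: "z \<in> ?S \<epsilon>" and m: "m \<in> V" "z = c m"
      show "m = j"
      proof (rule ccontr)
        assume "m \<noteq> j"
        \<comment> \<open>The center of \<open>i\<close> lies on the edge \<open>i k\<close>, to
          which \<open>no_i\<close> applies.\<close>
        then have "m = i" using elim z m by fastforce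
        then show False using no_i[OF z _ ik(1)] ik(2) m by auto
      qed
    qed
  qed
qed

text \<open>No other edge leaves \<open>i\<close> between the directions of \<open>j\<close> and \<open>k\<close>, so a path from \<open>j\<close> to \<open>k\<close>
  through a point close to the center of \<open>i\<close> on the bisector crosses nothing.\<close>

lemma successor_adjacent_if_maximal:
  assumes max: "maximal_planar_graph V E" and ij: "{i, j} \<in> E" and ik: "{i, k} \<in> E" and jk: "j \<noteq> k"
    and \<phi>: "0 < \<phi>" "\<phi> < 2 * pi" and dk: "dir i k = dir i j * cis \<phi>"
    and between: "\<And>m. {i, m} \<in> E \<Longrightarrow> m \<noteq> j \<Longrightarrow> \<exists>\<psi>. \<phi> \<le> \<psi> \<and> \<psi> < 2 * pi \<and> dir i m = dir i j * cis \<psi>"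
  shows "{j, k} \<in> E"
proof -
  define e where "e = dir i j"
  \<comment> \<open>The bisector of the turn from \<open>j\<close> to \<open>k\<close>, also when
    this turn exceeds \<open>pi\<close>.\<close>
  define d where "d = e * cis (\<phi> / 2)"
  have e0: "e \<noteq> 0" using norm_dir[OF ij] by (auto simp: e_def)
  have s0: "sin (\<phi> / 2) > 0" using \<phi> by (intro sin_gt_zero) auto
  have j_other: "A = 0 \<and> B = 0"
    if m: "{i, m} \<in> E" "m \<noteq> j" and n: "0 \<le> A" "0 \<le> B" "0 \<le> M"
      and eq: "A *\<^sub>R dir i j + B *\<^sub>R d = M *\<^sub>R dir i m" for m A B M
  proof -
    obtain \<psi> where \<psi>: "\<phi> \<le> \<psi>" "\<psi> < 2 * pi" "dir i m = e * cis \<psi>" using between[OF m] by (auto simp: e_def)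
    have "e * (of_real A + of_real B * cis (\<phi> / 2)) = e * (of_real M * cis \<psi>)"
      using eq unfolding \<psi>(3) d_def e_def[symmetric] scaleR_conv_of_real by (simp add: algebra_simps)
    then have "of_real A + of_real B * cis (\<phi> / 2) = of_real M * cis \<psi>" using e0 by simp
    then show ?thesis using cone_trivial[OF \<phi> \<psi>(1,2) n] by simp
  qed
  have j_same: "B = 0" if eq: "A *\<^sub>R dir i j + B *\<^sub>R d = M *\<^sub>R dir i j" for A B M
  proof -
    have "e * (of_real A + of_real B * cis (\<phi> / 2)) = e * of_real M"
      using eq unfolding d_def e_def[symmetric] scaleR_conv_of_real by (simp add: algebra_simps)
    then have "of_real A + of_real B * cis (\<phi> / 2) = of_real M" using e0 by simp
    from arg_cong[OF this, of Im] show ?thesis using s0 by simp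
  qed
  \<comment> \<open>Reflection in the bisector sends the angle \<psi> to \<phi> - \<psi> and
    exchanges \<open>j\<close> with \<open>k\<close>, so the case of \<open>k\<close> reduces to
    \<open>cone_trivial\<close> again.\<close>
  have flip: "of_real A + of_real B * cis (\<phi> / 2) = of_real M * cis (\<phi> - \<psi>)"
    if eq: "A *\<^sub>R dir i k + B *\<^sub>R d = M *\<^sub>R (e * cis \<psi>)" for A B M \<psi>
  proof -
    have "e * (of_real A * cis \<phi> + of_real B * cis (\<phi> / 2)) = e * (of_real M * cis \<psi>)"
      using eq unfolding d_def dk e_def[symmetric] scaleR_conv_of_real by (simp add: algebra_simps)
    then have 1: "of_real A * cis \<phi> + of_real B * cis (\<phi> / 2) = of_real M * cis \<psi>" using e0 by simp
    have 2: "cis \<phi> * cis (- \<phi>) = 1" "cis (\<phi> / 2) * cis (- \<phi>) = cis (- \<phi> / 2)" "cis \<psi> * cis (-\<phi>) = cis (\<psi> - \<phi>)"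
      by (simp_all add: cis_mult)
    have "cis (- \<phi>) * (of_real A * cis \<phi> + of_real B * cis (\<phi> / 2)) = cis (- \<phi>) * (of_real M * cis \<psi>)"
      using 1 by simp
    then have "of_real A * (cis \<phi> * cis (- \<phi>)) + of_real B * (cis (\<phi> / 2) * cis (- \<phi>)) = of_real M * (cis \<psi> * cis (- \<phi>))"
      by (simp only: ring_distribs mult_ac)
    then have "cnj (of_real A + of_real B * cis (- \<phi> / 2)) = cnj (of_real M * cis (\<psi> - \<phi>))"
      unfolding 2 by simp
    then show ?thesis by (simp add: cis_cnj)
  qed
  have k_other: "A = 0 \<and> B = 0"
    if m: "{i, m} \<in> E" "m \<noteq> k" and n: "0 \<le> A" "0 \<le> B" "0 \<le> M"
      and eq: "A *\<^sub>R dir i k + B *\<^sub>R d = M *\<^sub>R dir i m" for m A B M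
  proof -
    obtain \<psi> where \<psi>: "\<phi> < \<psi>" "\<psi> \<le> 2 * pi" "dir i m = e * cis \<psi>"
    proof (cases "m = j")
      case True
      \<comment> \<open>\<open>j\<close> gets the angle \<open>2 * pi\<close> instead of 0, so that
        \<open>\<phi> - \<psi> + 2 * pi\<close> lies between \<phi> and
        \<open>2 * pi\<close>.\<close>
      then show ?thesis using that[of "2 * pi"] \<phi> by (simp add: e_def)
    next
      case False
      then obtain \<psi> where \<psi>: "\<phi> \<le> \<psi>" "\<psi> < 2 * pi" "dir i m = e * cis \<psi>"
        using between[OF m(1)] by (auto simp: e_def)
      have "\<psi> \<noteq> \<phi>" using dir_inj[OF m(1) ik] m(2) \<psi>(3) dk by (auto simp: e_def)
      then show ?thesis using that[of \<psi>] \<psi> by simp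
    qed
    have "cis (\<phi> - \<psi> + 2 * pi) = cis (\<phi> - \<psi>)" by (simp flip: cis_mult)
    then have "of_real A + of_real B * cis (\<phi> / 2) = of_real M * cis (\<phi> - \<psi> + 2 * pi)"
      using flip[of A B M \<psi>] eq \<psi>(3) by simp
    then show ?thesis using cone_trivial[OF \<phi> _ _ n, of "\<phi> - \<psi> + 2 * pi"] \<psi> by simp
  qed
  have k_same: "B = 0" if eq: "A *\<^sub>R dir i k + B *\<^sub>R d = M *\<^sub>R dir i k" for A B M
  proof -
    have "of_real A + of_real B * cis (\<phi> / 2) = of_real M * cis (\<phi> - \<phi>)"
      using flip[of A B M \<phi>] eq dk by (simp add: e_def)
    from arg_cong[OF this, of Im] show ?thesis using s0 by simp
  qed
  define clr where "clr p \<epsilon> \<longleftrightarrow> (\<forall>z\<in>closed_segment (c p) (c i + \<epsilon> *\<^sub>R d).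
     (\<forall>a b. {a, b} \<in> E \<longrightarrow> z \<in> seg a b \<longrightarrow> z = c p) \<and> (\<forall>m\<in>V. z = c m \<longrightarrow> m = p))" for p \<epsilon>
  have "\<forall>\<^sub>F \<epsilon> in at_right 0. clr j \<epsilon>"
    unfolding clr_def by (rule eventually_segment_clear[OF ij ik jk j_other j_same])
  moreover have "\<forall>\<^sub>F \<epsilon> in at_right 0. clr k \<epsilon>"
    unfolding clr_def by (rule eventually_segment_clear[OF ik ij jk[symmetric] k_other k_same])
  ultimately have "\<forall>\<^sub>F \<epsilon> in at_right 0. 0 < \<epsilon> \<and> clr j \<epsilon> \<and> clr k \<epsilon>"
    by (intro eventually_conj eventually_at_right_less)
  then have "\<exists>\<epsilon>. 0 < \<epsilon> \<and> clr j \<epsilon> \<and> clr k \<epsilon>"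
    by (rule eventually_happens'[OF trivial_limit_at_right_real])
  then obtain \<epsilon> where \<epsilon>: "\<epsilon> > 0" and clr: "clr j \<epsilon>" "clr k \<epsilon>" by blast
  have clear: "z = c j" if "z \<in> closed_segment (c j) (c i + \<epsilon> *\<^sub>R d)" "{a, b} \<in> E" "z \<in> seg a b" for z a b
    using clr(1) that unfolding clr_def by blast
  have clear2: "z = c k" if "z \<in> closed_segment (c k) (c i + \<epsilon> *\<^sub>R d)" "{a, b} \<in> E" "z \<in> seg a b" for z a b
    using clr(2) that unfolding clr_def by blast
  have clear3: "m = j" if "m \<in> V" "c m \<in> closed_segment (c j) (c i + \<epsilon> *\<^sub>R d)" for m
    using clr(1) that unfolding clr_def by blast
  have clear4: "m = k" if "m \<in> V" "c m \<in> closed_segment (c k) (c i + \<epsilon> *\<^sub>R d)" for m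
    using clr(2) that unfolding clr_def by blast
  define x where "x = c i + \<epsilon> *\<^sub>R d"
  define g where "g = linepath (c j) x +++ linepath x (c k)"
  note V = edgeD[OF ij] edgeD[OF ik]
  have xj: "x \<noteq> c j"
  proof
    assume "x = c j"
    then have "(r i + r j) *\<^sub>R dir i j + (- \<epsilon>) *\<^sub>R d = 0 *\<^sub>R dir i j"
      using dir_eq[OF ij] by (simp add: x_def algebra_simps)
    from j_same[OF this] show False using \<epsilon> by simp
  qed
  have xk: "x \<noteq> c k"
  proof
    assume "x = c k"
    then have "(r i + r k) *\<^sub>R dir i k + (- \<epsilon>) *\<^sub>R d = 0 *\<^sub>R dir i k"
      using dir_eq[OF ik] by (simp add: x_def algebra_simps)
    from k_same[OF this] show False using \<epsilon> by simp
  qed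
  have meet: "z = x" if z: "z \<in> closed_segment (c j) x" "z \<in> closed_segment x (c k)" for z
  proof -
    obtain s where s: "0 \<le> s" "s \<le> 1" "z = (1 - s) *\<^sub>R c j + s *\<^sub>R x" using z(1) unfolding in_segment by blast
    obtain t where t: "0 \<le> t" "t \<le> 1" "z = (1 - t) *\<^sub>R x + t *\<^sub>R c k" using z(2) unfolding in_segment by blast
    have "z - c i = (1 - s) *\<^sub>R (c j - c i) + (s * \<epsilon>) *\<^sub>R d"
      unfolding s(3) x_def by (simp add: algebra_simps)
    moreover have "z - c i = ((1 - t) * \<epsilon>) *\<^sub>R d + t *\<^sub>R (c k - c i)"
      unfolding t(3) x_def by (simp add: algebra_simps)
    ultimately have "(1 - s) *\<^sub>R ((r i + r j) *\<^sub>R e) + (s * \<epsilon>) *\<^sub>R d = ((1 - t) * \<epsilon>) *\<^sub>R d + t *\<^sub>R ((r i + r k) *\<^sub>R (e * cis \<phi>))"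
      using dir_eq[OF ij] dir_eq[OF ik] dk by (simp add: e_def)
    then have "(t * (r i + r k)) *\<^sub>R dir i k + ((1 - t) * \<epsilon> - s * \<epsilon>) *\<^sub>R d = ((1 - s) * (r i + r j)) *\<^sub>R (e * cis 0)"
      by (simp add: dk e_def algebra_simps)
    from flip[OF this] have "of_real (t * (r i + r k)) + of_real ((1 - t) * \<epsilon> - s * \<epsilon>) * cis (\<phi> / 2)
      = of_real ((1 - s) * (r i + r j)) * cis \<phi>" by simp
    \<comment> \<open>A turn by -\<phi>/2 makes the bisector the real axis; the imaginary parts of
      the two sides then have opposite signs, so both vanish.\<close>
    then have *: "(of_real (t * (r i + r k)) + of_real ((1 - t) * \<epsilon> - s * \<epsilon>) * cis (\<phi> / 2)) * cis (- (\<phi> / 2))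
      = of_real ((1 - s) * (r i + r j)) * (cis \<phi> * cis (- (\<phi> / 2)))" by (simp only: mult.assoc)
    have "cis \<phi> * cis (- (\<phi> / 2)) = cis (\<phi> / 2)" by (simp add: cis_mult)
    moreover have "cis (\<phi> / 2) * cis (- (\<phi> / 2)) = 1" by (simp add: cis_mult)
    ultimately have "of_real (t * (r i + r k)) * cis (- (\<phi> / 2)) + of_real ((1 - t) * \<epsilon> - s * \<epsilon>)
      = of_real ((1 - s) * (r i + r j)) * cis (\<phi> / 2)"
      using * by (simp only: distrib_right mult.assoc mult_1_right)
    from arg_cong[OF this, of Im] have "((1 - s) * (r i + r j) + t * (r i + r k)) * sin (\<phi> / 2) = 0"
      by (simp add: algebra_simps)
    then have "(1 - s) * (r i + r j) + t * (r i + r k) = 0" using s0 by simp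
    moreover have "r i + r j > 0" "r i + r k > 0" using r_pos V by (auto simp: add_pos_pos)
    moreover have "(1 - s) * (r i + r j) \<ge> 0" "t * (r i + r k) \<ge> 0" using s t calculation(2,3) by auto
    ultimately have "(1 - s) * (r i + r j) = 0" by linarith
    then have "s = 1" using \<open>r i + r j > 0\<close> by simp
    then show ?thesis using s(3) by simp
  qed
  have img: "path_image g = closed_segment (c j) x \<union> closed_segment (c k) x"
    by (simp add: g_def path_image_join closed_segment_commute[of x])
  show ?thesis
  proof (rule add_edge_drawing[OF max _ _ jk, of g])
    show "arc g" unfolding g_def
      by (rule arc_join) (use xj xk meet in auto)
    show "pathstart g = c j" "pathfinish g = c k" by (simp_all add: g_def)
    show "m \<in> {j, k}" if "m \<in> V" "c m \<in> path_image g" for m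
      using clear3[of m] clear4[of m] that by (auto simp: img x_def)
    show "z \<in> {c j, c k}" if "{a, b} \<in> E" "z \<in> path_image g" "z \<in> seg a b" for a b z
      using clear[of z a b] clear2[of z a b] that by (auto simp: img x_def)
  qed (use V in auto)
qed

end

section \<open>Packings of disks\<close>

definition disk_lvec :: "complex \<Rightarrow> real \<Rightarrow> lvec" where
  "disk_lvec c r = (c /\<^sub>R r, 1 / r, ((norm c)\<^sup>2 - r\<^sup>2) / r)"

lemma mem_disk_lvec:
  assumes "0 < r" shows "{x. mem (disk_lvec c r) x} = Some ` cball c r"
proof -
  have "mem (disk_lvec c r) (Some z) \<longleftrightarrow> z \<in> cball c r" for z
  proof -
    have "(dist c z)\<^sup>2 = (norm c)\<^sup>2 + (norm z)\<^sup>2 - 2 * Re (c * cnj z)"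
      by (simp add: dist_norm cmod_power2) (simp add: power2_eq_square algebra_simps)
    moreover have "lk (disk_lvec c r) * (norm z)\<^sup>2 - 2 * Re (lw (disk_lvec c r) * cnj z) + ll (disk_lvec c r) =
        ((norm c)\<^sup>2 + (norm z)\<^sup>2 - 2 * Re (c * cnj z) - r\<^sup>2) / r"
      using assms by (simp add: disk_lvec_def divide_inverse algebra_simps)
    ultimately have "mem (disk_lvec c r) (Some z) \<longleftrightarrow> ((dist c z)\<^sup>2 - r\<^sup>2) / r \<le> 0"
      by (simp only: mem.simps)
    also have "\<dots> \<longleftrightarrow> (dist c z)\<^sup>2 \<le> r\<^sup>2" using assms by (simp add: divide_le_0_iff)
    also have "\<dots> \<longleftrightarrow> z \<in> cball c r" using assms by (simp add: power_mono_iff)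
    finally show ?thesis .
  qed
  moreover have "\<not> mem (disk_lvec c r) None" using assms by (simp add: disk_lvec_def)
  ultimately have "mem (disk_lvec c r) x \<longleftrightarrow> x \<in> Some ` cball c r" for x
    by (cases x) (simp_all del: mem.simps mem_cball add: image_iff)
  then show ?thesis by blast
qed

text \<open>The inversive product of two circles: 1 for equal disks, -1 exactly when the distance of
  the centers is \<open>r + r'\<close>.\<close>

lemma lor_disk_lvec:
  assumes "0 < r" "0 < r'"
  shows "lor (disk_lvec c r) (disk_lvec c' r') = 1 - ((dist c c')\<^sup>2 - (r - r')\<^sup>2) / (2 * r * r')"
proof -
  have "(dist c c')\<^sup>2 = (norm c)\<^sup>2 + (norm c')\<^sup>2 - 2 * Re (c * cnj c')"
    by (simp add: dist_norm cmod_power2) (simp add: power2_eq_square algebra_simps)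
  then have *: "Re (c * cnj c') = ((norm c)\<^sup>2 + (norm c')\<^sup>2 - (dist c c')\<^sup>2) / 2" by simp
  have "lw (disk_lvec c r) * cnj (lw (disk_lvec c' r')) = (c * cnj c') /\<^sub>R (r * r')"
    by (simp add: disk_lvec_def)
  then have "Re (lw (disk_lvec c r) * cnj (lw (disk_lvec c' r'))) = Re (c * cnj c') / (r * r')"
    by (simp only: scaleR_complex.sel divide_inverse mult.commute)
  then have "lor (disk_lvec c r) (disk_lvec c' r') = Re (c * cnj c') / (r * r')
      - (1 / r * (((norm c')\<^sup>2 - r'\<^sup>2) / r') + ((norm c)\<^sup>2 - r\<^sup>2) / r * (1 / r')) / 2"
    by (simp only: lor_def) (simp add: disk_lvec_def)
  also have "\<dots> = 1 - ((dist c c')\<^sup>2 - (r - r')\<^sup>2) / (2 * r * r')"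
    unfolding * using assms by (simp add: field_simps power2_eq_square)
  finally show ?thesis .
qed

lemma mobius_equiv_single_disk:
  assumes "0 < r" "0 < r'"
  shows "mobius_equiv V (\<lambda>_. disk_lvec c r) (\<lambda>_. disk_lvec c' r')"
proof -
  define a :: complex where "a = of_real (r' / r)"
  have a: "a \<noteq> 0" "norm a = r' / r" "sgn a = 1" using assms by (simp_all add: a_def sgn_eq norm_divide)
  have 1: "ltrans (-c) (disk_lvec c r) = (0, 1 / r, - r)"
    using assms by (simp add: ltrans_def disk_lvec_def divide_inverse cmod_power2)
      (simp add: field_simps power2_eq_square)
  have 2: "lscale a (0, 1 / r, - r) = (0, 1 / r', - r')"
    using assms by (simp add: lscale_def a)
  have 3: "ltrans c' (0, 1 / r', - r') = disk_lvec c' r'"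
    using assms by (simp add: ltrans_def disk_lvec_def field_simps power2_eq_square)
  have "mobius_equiv V (\<lambda>_. disk_lvec c r) (\<lambda>_. (0, 1 / r, - r))"
    using mobius_equiv_ltrans[of V "\<lambda>_. disk_lvec c r" "-c"] by (simp add: 1)
  moreover have "mobius_equiv V (\<lambda>_. (0, 1 / r, - r)) (\<lambda>_. (0, 1 / r', - r'))"
    using mobius_equiv_lscale[OF a(1), of V "\<lambda>_. (0, 1 / r, - r)"] by (simp add: 2)
  moreover have "mobius_equiv V (\<lambda>_. (0, 1 / r', - r')) (\<lambda>_. disk_lvec c' r')"
    using mobius_equiv_ltrans[of V "\<lambda>_. (0, 1 / r', - r')" c'] by (simp add: 3)
  ultimately show ?thesis by (blast intro: mobius_equiv_trans)
qed

lemma dist_ge_if_interiors_disjoint: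
  fixes c c' :: complex
  assumes r: "0 < r" "0 < r'" and "ball c r \<inter> ball c' r' = {}"
  shows "r + r' \<le> dist c c'"
proof (rule ccontr)
  assume n: "\<not> ?thesis"
  \<comment> \<open>The point dividing the segment of the centers in the ratio of the radii lies in
    both open disks if they are too close.\<close>
  define p where "p = c + (r / (r + r')) *\<^sub>R (c' - c)"
  have s: "r + r' > 0" using r by simp
  have "dist c p = r / (r + r') * dist c c'"
    using r by (simp add: p_def dist_norm norm_minus_commute)
  also have "\<dots> < r / (r + r') * (r + r')" using n r s by (intro mult_strict_left_mono) auto
  finally have "p \<in> ball c r" using s by simp
  have "c' - p = (r' / (r + r')) *\<^sub>R (c' - c)"
  proof -
    have "r' / (r + r') = 1 - r / (r + r')" using s by (simp add: field_simps)
    moreover have "c' - (c + x *\<^sub>R (c' - c)) = (1 - x) *\<^sub>R (c' - c)" for x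
      by (simp add: algebra_simps)
    ultimately show ?thesis by (simp only: p_def)
  qed
  then have "dist c' p = r' / (r + r') * dist c c'"
    using r by (simp add: dist_norm norm_minus_commute)
  also have "\<dots> < r' / (r + r') * (r + r')" using n r s by (intro mult_strict_left_mono) auto
  finally have "p \<in> ball c' r'" using s by simp
  then show False using \<open>p \<in> ball c r\<close> assms(3) by blast
qed

lemma tangent_iff_dist:
  fixes c c' :: complex
  assumes r: "0 < r" "0 < r'" and ge: "r + r' \<le> dist c c'"
  shows "tangent_disks (cball c r) (cball c' r') \<longleftrightarrow> dist c c' = r + r'"
proof
  assume "tangent_disks (cball c r) (cball c' r')"
  then obtain p where "p \<in> cball c r" "p \<in> cball c' r'" unfolding tangent_disks_def by blast
  then have "dist c c' \<le> r + r'"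
    using dist_triangle[of c c' p] by (simp add: dist_commute)
  then show "dist c c' = r + r'" using ge by simp
next
  assume d: "dist c c' = r + r'"
  define p where "p = c + (r / (r + r')) *\<^sub>R (c' - c)"
  have s: "r + r' > 0" using r by simp
  have "dist c p = r / (r + r') * dist c c'"
    using r by (simp add: p_def dist_norm norm_minus_commute)
  then have p1: "p \<in> cball c r" using s d by simp
  have "c' - p = (r' / (r + r')) *\<^sub>R (c' - c)"
  proof -
    have "r' / (r + r') = 1 - r / (r + r')" using s by (simp add: field_simps)
    moreover have "c' - (c + x *\<^sub>R (c' - c)) = (1 - x) *\<^sub>R (c' - c)" for x
      by (simp add: algebra_simps)
    ultimately show ?thesis by (simp only: p_def)
  qed
  then have "dist c' p = r' / (r + r') * dist c c'"
    using r by (simp add: dist_norm norm_minus_commute)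
  then have p2: "p \<in> cball c' r'" using s d by simp
  have "q = p" if q: "q \<in> cball c r" "q \<in> cball c' r'" for q
  proof -
    \<comment> \<open>A common point gives equality in the triangle inequality, hence lies on the
      segment of the centers at distance \<open>r\<close> from \<open>c\<close>.\<close>
    have eq: "dist c q = r" "dist c' q = r'"
      using q d dist_triangle[of c c' q] by (auto simp: dist_commute)
    then have "q \<in> closed_segment c c'"
      using between_mem_segment[of c c' q] between[of c c' q] d by (simp add: dist_commute)
    then obtain u where u: "0 \<le> u" "q = (1 - u) *\<^sub>R c + u *\<^sub>R c'" unfolding in_segment by blast
    then have qc: "q = c + u *\<^sub>R (c' - c)" by (simp add: algebra_simps)
    then have "u * dist c c' = r" using eq(1) u(1) by (simp add: dist_norm norm_minus_commute)
    then have "u = r / (r + r')" using d s by (simp add: field_simps)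
    then show "q = p" using qc by (simp add: p_def)
  qed
  then have "cball c r \<inter> cball c' r' = {p}" using p1 p2 by blast
  then show "tangent_disks (cball c r) (cball c' r')"
    using r unfolding tangent_disks_def is_disk_def by blast
qed

lemma disk_layout_of_packing:
  assumes pack: "disk_packing V D" and E: "contact_graph_edges V D = E" and simple: "simple_graph V E"
  obtains c r where "disk_layout V E c r" "\<And>i. i \<in> V \<Longrightarrow> D i = cball (c i) (r i)"
proof -
  have "\<forall>i\<in>V. \<exists>x. 0 < snd x \<and> D i = cball (fst x) (snd x)"
    using pack unfolding disk_packing_def is_disk_def by auto
  then obtain x where x: "\<And>i. i \<in> V \<Longrightarrow> 0 < snd (x i) \<and> D i = cball (fst (x i)) (snd (x i))"
    by (metis bchoice)
  define c r where "c i = fst (x i)" and "r i = snd (x i)" for i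
  have r: "0 < r i" and D: "D i = cball (c i) (r i)" if "i \<in> V" for i
    using x[OF that] by (simp_all add: c_def r_def)
  have ge: "r i + r j \<le> dist (c i) (c j)" if "i \<in> V" "j \<in> V" "i \<noteq> j" for i j
  proof (rule dist_ge_if_interiors_disjoint)
    have "interior (D i) \<inter> interior (D j) = {}"
      using pack that unfolding disk_packing_def disjoint_family_on_def by blast
    then show "ball (c i) (r i) \<inter> ball (c j) (r j) = {}" using D that by simp
  qed (use r that in auto)
  have edge: "{i, j} \<in> E \<longleftrightarrow> dist (c i) (c j) = r i + r j" if ij: "i \<in> V" "j \<in> V" "i \<noteq> j" for i j
  proof -
    have sym: "tangent_disks A B \<Longrightarrow> tangent_disks B A" for A B
      by (auto simp: tangent_disks_def Int_commute)
    have "{i, j} \<in> E \<longleftrightarrow> tangent_disks (D i) (D j)"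
      using ij sym unfolding E[symmetric] contact_graph_edges_def by (auto simp: doubleton_eq_iff)
    then show ?thesis using tangent_iff_dist[OF r[OF ij(1)] r[OF ij(2)] ge[OF ij]] D ij by simp
  qed
  show ?thesis
    by (rule that[of c r]) (auto simp: disk_layout_def simple r ge edge D)
qed

text \<open>Carries the results on drawings over to Lorentz vectors: \<open>tdir\<close> of the disk
  vectors is the direction \<open>dir\<close> between the centers.\<close>

lemma (in disk_layout) rotation_packing:
  assumes max: "maximal_planar_graph V E"
  shows "rotation_packing V E (\<lambda>i. disk_lvec (c i) (r i))"
proof -
  let ?s = "\<lambda>i. disk_lvec (c i) (r i)"
  have L: "lorentz_packing V E ?s"
  proof
    show "simple_graph V E" by (rule simple)
    show "lor (?s i) (?s i) = 1" if "i \<in> V" for i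
      using r_pos[OF that] by (simp add: lor_disk_lvec)
    fix i j assume ij: "i \<in> V" "j \<in> V" "i \<noteq> j"
    have p: "0 < r i" "0 < r j" using r_pos ij by auto
    have d: "r i + r j \<le> dist (c i) (c j)" using dist_ge ij by blast
    have *: "lor (?s i) (?s j) + 1 = - ((dist (c i) (c j))\<^sup>2 - (r i + r j)\<^sup>2) / (2 * r i * r j)"
      unfolding lor_disk_lvec[OF p] using p by (simp add: field_simps power2_eq_square)
    have sq: "(r i + r j)\<^sup>2 \<le> (dist (c i) (c j))\<^sup>2" using d p by (intro power_mono) auto
    have "- ((dist (c i) (c j))\<^sup>2 - (r i + r j)\<^sup>2) / (2 * r i * r j) \<le> 0"
      using sq p by (intro divide_nonpos_pos) auto
    then show "lor (?s i) (?s j) \<le> -1" using * by linarith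
    have "lor (?s i) (?s j) = -1 \<longleftrightarrow> (dist (c i) (c j))\<^sup>2 = (r i + r j)\<^sup>2"
      using * p by (auto simp: add_eq_0_iff2)
    also have "\<dots> \<longleftrightarrow> dist (c i) (c j) = r i + r j" using p d by (auto simp: power2_eq_iff)
    also have "\<dots> \<longleftrightarrow> {i, j} \<in> E" using edge_iff ij by blast
    finally show "{i, j} \<in> E \<longleftrightarrow> lor (?s i) (?s j) = -1" by simp
  qed
  have tdir: "tdir (?s i) (?s j) = dir i j" if e: "{i, j} \<in> E" for i j
  proof -
    have p: "0 < r i" "0 < r j" using r_pos edgeD[OF e] by auto
    then have "r i + r j \<noteq> 0" by simp
    have "1 / r i / (1 / r j + 1 / r i) = r j / (r i + r j)" using p by (simp add: field_simps)
    then have "tdir (?s i) (?s j) = (r j / (r i + r j)) *\<^sub>R (c j /\<^sub>R r j + c i /\<^sub>R r i) - c i /\<^sub>R r i"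
      by (simp add: tdir_def disk_lvec_def)
    also have "\<dots> = (1 / (r i + r j)) *\<^sub>R c j + (r j / (r i + r j) / r i - 1 / r i) *\<^sub>R c i"
      using p by (simp add: algebra_simps divide_inverse)
    also have "r j / (r i + r j) / r i - 1 / r i = - (1 / (r i + r j))"
    proof -
      have "r j / (r i + r j) = 1 - r i / (r i + r j)" using \<open>r i + r j \<noteq> 0\<close> by (simp add: field_simps)
      then show ?thesis using p by (simp add: diff_divide_distrib)
    qed
    finally show ?thesis by (simp add: dir_def algebra_simps divide_inverse)
  qed
  have "rotation_packing_axioms V E ?s"
  proof
    show "lk (?s i) > 0" if "i \<in> V" for i using r_pos[OF that] by (simp add: disk_lvec_def)
    show "connected_on E V" by (rule connected_if_maximal[OF max])
    fix i j k \<phi>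
    assume e: "{i, j} \<in> E" "{i, k} \<in> E" "j \<noteq> k" "0 < \<phi>" "\<phi> < 2 * pi"
      and t: "tdir (?s i) (?s k) = tdir (?s i) (?s j) * cis \<phi>"
      and m: "\<And>m. {i, m} \<in> E \<Longrightarrow> m \<noteq> j \<Longrightarrow>
        \<exists>\<psi>. \<phi> \<le> \<psi> \<and> \<psi> < 2 * pi \<and> tdir (?s i) (?s m) = tdir (?s i) (?s j) * cis \<psi>"
    show "{j, k} \<in> E"
    proof (rule successor_adjacent_if_maximal[OF max e])
      show "dir i k = dir i j * cis \<phi>" using t by (simp add: tdir e)
      show "\<exists>\<psi>. \<phi> \<le> \<psi> \<and> \<psi> < 2 * pi \<and> dir i m = dir i j * cis \<psi>" if "{i, m} \<in> E" "m \<noteq> j" for m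
        using m[OF that] by (simp add: tdir e that)
    qed
  qed
  then show ?thesis using L by (simp add: rotation_packing_def)
qed

theorem theorem10p2:
  fixes V :: "'v set" and E :: "'v set set" and n :: nat
    and D D' :: "'v \<Rightarrow> complex set"
  assumes "maximal_planar_graph V E" and "card V = n"
    and "disk_packing V D" and "contact_graph_edges V D = E"
    and "disk_packing V D'" and "contact_graph_edges V D' = E"
  shows "\<exists>f\<in>generalized_mobius. \<forall>i\<in>V. f ` (Some ` D i) = Some ` D' i"
proof -
  note max = assms(1)
  have simple: "simple_graph V E"
    using max by (simp add: maximal_planar_graph_def planar_graph_def)
  obtain c r where cr: "disk_layout V E c r" and D: "\<And>i. i \<in> V \<Longrightarrow> D i = cball (c i) (r i)"
    using disk_layout_of_packing[OF assms(3,4) simple] by blast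
  obtain c' r' where cr': "disk_layout V E c' r'" and D': "\<And>i. i \<in> V \<Longrightarrow> D' i = cball (c' i) (r' i)"
    using disk_layout_of_packing[OF assms(5,6) simple] by blast
  interpret L: disk_layout V E c r by fact
  interpret L': disk_layout V E c' r' by fact
  define s where "s i = disk_lvec (c i) (r i)" for i
  define t where "t i = disk_lvec (c' i) (r' i)" for i
  interpret R: rotation_packing V E s
    using L.rotation_packing[OF max] by (simp add: s_def[abs_def])
  interpret R': rotation_packing V E t
    using L'.rotation_packing[OF max] by (simp add: t_def[abs_def])
  have "mobius_equiv V s t"
  proof (cases "card V \<ge> 2")
    case False
    show ?thesis
    proof (cases "V = {}")
      case True
      then show ?thesis
        \<comment> \<open>For empty \<open>V\<close> any transformation will do; the translation by
          0 provides one with its inverse.\<close>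
        using mobius_equiv_ltrans[of V s 0] by (simp add: mobius_equiv_def)
    next
      case False
      then have "card V = 1" using \<open>\<not> 2 \<le> card V\<close> R.finite_V by (simp add: not_le less_Suc_eq numeral_2_eq_2)
      then obtain v where v: "V = {v}" by (auto simp: card_1_singleton_iff)
      have "mobius_equiv V (\<lambda>_. s v) (\<lambda>_. t v)"
        unfolding s_def t_def using L.r_pos L'.r_pos v by (intro mobius_equiv_single_disk) auto
      then show ?thesis by (simp add: mobius_equiv_def v)
    qed
  next
    case True
    then obtain a where "a \<in> V" by force
    then obtain b where ab: "{a, b} \<in> E" using R.has_nbr True by blast
    have "lor (s i) (s j) = lor (t i) (t j)" if ij: "i \<in> V" "j \<in> V" for i j
    proof (cases "card V \<ge> 4")
      case True
      show ?thesis
        by (rule lorentz_packing_rigid[OF R.lorentz_packing_axioms R'.lorentz_packing_axioms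
            R.edges_in_two_faces[OF True] R.lk_pos R'.lk_pos ij]) (use ab in auto)
    next
      case False
      \<comment> \<open>With two or three vertices all distinct disks are tangent, so both Gram
        matrices have 1 on the diagonal and -1 elsewhere.\<close>
      then show ?thesis
        using R.complete_if_small[of i j] R.lor_self[of i] R'.lor_self[of i] R.lor_edge[of i j] R'.lor_edge[of i j] ij
        by (cases "i = j") auto
    qed
    then show ?thesis
      using mobius_equiv_of_lor_eq[OF R.lorentz_packing_axioms R'.lorentz_packing_axioms R.lk_pos R'.lk_pos _ ab]
      by blast
  qed
  then obtain f g where f: "f \<in> generalized_mobius" "\<And>x. f (g x) = x"
    "\<And>i x. i \<in> V \<Longrightarrow> mem (s i) x \<longleftrightarrow> mem (t i) (f x)"
    unfolding mobius_equiv_def by blast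
  have "f ` (Some ` D i) = Some ` D' i" if i: "i \<in> V" for i
  proof -
    have "Some ` D i = {x. mem (s i) x}" "Some ` D' i = {x. mem (t i) x}"
      using mem_disk_lvec L.r_pos[OF i] L'.r_pos[OF i] by (simp_all add: D[OF i] D'[OF i] s_def t_def)
    moreover have "f ` {x. mem (s i) x} = {x. mem (t i) x}"
      using f(2) f(3)[OF i] by (auto simp: image_iff) (metis f(2))
    ultimately show ?thesis by simp
  qed
  then show ?thesis using f(1) by blast
qed

end
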